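(* Let $X$ and $U$ be Banach lattices. Let $A$ be a densely defined resolvent positive operator on $X$ such that, for some real $\lambda_0>s(A)$ and some $c>0$, $$\|R(\lambda_0,A)x\|\ge c\,\|x\|\qquad\text{for all } x\in X_+ .$$ If $B\in\mathcal L_+(U,X_{-1,A})$, i.e. $B:U\to X_{-1,A}$ is a positive bounded linear operator, then $(A,B)$ is positive $L^1$-admissible.
   Context: For an operator $A$ on $X$, $\rho(A)$ is the resolvent set, $R(\lambda,A)=(\lambda I-A)^{-1}$, and $s(A)=\sup\{\mathrm{Re}\,\lambda:\lambda\in\sigma(A)\}$ is the spectral bound (complexify when needed). $A$ is resolvent positive if there is $\omega\in\mathbb R$ with $(\omega,\infty)\subset\rho(A)$ and $R(\lambda,A)\ge 0$ for all $\lambda>\omega$. $X_+$ and $U_+$ denote the positive cones. $X_{-1,A}$ is the completion of $X$ in the norm $\|x\|_{-1}=\|R(\lambda,A)x\|$ for some $\lambda\in\rho(A)$. Its positive cone $(X_{-1,A})_+$ is the closure of $X_+$ in $X_{-1,A}$. An operator $B\in\mathcal L(U,X_{-1,A})$ is positive, written $B\in\mathcal L_+(U,X_{-1,A})$, if $BU_+\subset (X_{-1,A})_+$. When $A$ generates a $C_0$-semigroup $(T(t))_{t\ge0}$ on $X$ (by a known theorem of Arendt this is the case, with a positive semigroup, under the hypotheses of the claim), $(T_{-1}(t))_{t\ge 0}$ denotes its extension to a $C_0$-semigroup on $X_{-1,A}$. For $p\ge1$ and $\tau\ge0$ put $$\Phi_\tau u=\int_0^\tau T_{-1}(\tau-s)Bu(s)\,ds\in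 X_{-1,A},\qquad u\in L^p(\mathbb R_+;U).$$ $L^p_+(\mathbb R_+;U)$ is the set of $u\in L^p(\mathbb R_+;U)$ with $u(t)\in U_+$ for a.e. $t$. For positive $B$ and a positive semigroup, $(A,B)$ is called positive $L^p$-admissible if, for some $\tau>0$, $\Phi_\tau u\in X_+$ for all $u\in L^p_+(\mathbb R_+;U)$. *)

theory Defs
  imports "HOL-Analysis.Analysis"
begin

section \<open>Banach lattices\<close>

text \<open>The modulus of \<open>x\<close> is written \<open>sup x (- x)\<close>.\<close>

class banach_lattice = banach + ordered_real_vector + lattice +
  assumes norm_mono_modulus: "sup x (- x) \<le> sup y (- y) \<Longrightarrow> norm x \<le> norm y"


section \<open>Unbounded operators, spectrum and resolvent\<close>

text \<open>An unbounded operator is given by its domain \<open>D\<close> and a function \<open>A\<close> that is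
  only relevant on \<open>D\<close>.\<close>

definition linear_operator :: "'a::real_vector set \<Rightarrow> ('a \<Rightarrow> 'a) \<Rightarrow> bool" where
  "linear_operator D A \<longleftrightarrow> subspace D \<and>
     (\<forall>x\<in>D. \<forall>y\<in>D. A (x + y) = A x + A y) \<and> (\<forall>r. \<forall>x\<in>D. A (r *\<^sub>R x) = r *\<^sub>R A x)"

text \<open>Complexification: the pair \<open>(x, y)\<close> stands for \<open>x + i y\<close>. The norm of the
  product type is equivalent to the usual norms on the complexification, and only
  boundedness of operators matters below.\<close>

definition cscale :: "complex \<Rightarrow> 'a::real_vector \<times> 'a \<Rightarrow> 'a \<times> 'a" where
  "cscale l z = (Re l *\<^sub>R fst z - Im l *\<^sub>R snd z, Re l *\<^sub>R snd z + Im l *\<^sub>R fst z)"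

definition complexify :: "('a \<Rightarrow> 'a) \<Rightarrow> 'a \<times> 'a \<Rightarrow> 'a \<times> 'a" where
  "complexify A z = (A (fst z), A (snd z))"

definition resolvent_set :: "'a::real_normed_vector set \<Rightarrow> ('a \<Rightarrow> 'a) \<Rightarrow> complex set" where
  "resolvent_set D A =
     {l. bij_betw (\<lambda>z. cscale l z - complexify A z) (D \<times> D) UNIV \<and>
         bounded_linear (inv_into (D \<times> D) (\<lambda>z. cscale l z - complexify A z))}"

definition spectrum :: "'a::real_normed_vector set \<Rightarrow> ('a \<Rightarrow> 'a) \<Rightarrow> complex set" where
  "spectrum D A = - resolvent_set D A"

text \<open>Extended real valued: \<open>-\<infinity>\<close> for empty spectrum.\<close>

definition spectral_bound :: "'a::real_normed_vector set \<Rightarrow> ('a \<Rightarrow> 'a) \<Rightarrow> ereal" where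
  "spectral_bound D A = (SUP l\<in>spectrum D A. ereal (Re l))"

text \<open>The resolvent at a real point, as an operator on the real space; meaningful if
  \<open>complex_of_real l \<in> resolvent_set D A\<close>.\<close>

definition resolvent :: "'a::real_normed_vector set \<Rightarrow> ('a \<Rightarrow> 'a) \<Rightarrow> real \<Rightarrow> 'a \<Rightarrow> 'a" where
  "resolvent D A l = inv_into D (\<lambda>x. l *\<^sub>R x - A x)"

definition resolvent_positive :: "'a::banach_lattice set \<Rightarrow> ('a \<Rightarrow> 'a) \<Rightarrow> bool" where
  "resolvent_positive D A \<longleftrightarrow>
     (\<exists>w. \<forall>l>w. complex_of_real l \<in> resolvent_set D A \<and> (\<forall>x\<ge>0. 0 \<le> resolvent D A l x))"


section \<open>The extrapolation space\<close>

text \<open>\<open>j :: 'a \<Rightarrow> 'b\<close> exhibits the Banach space \<open>'b\<close> as a completion of \<open>'a\<close> with respect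
  to the norm \<open>x \<mapsto> norm (resolvent D A l x)\<close>. A completion is unique up to isometric
  isomorphism, and different choices of \<open>l\<close> yield equivalent norms.\<close>

definition extrapolation_space ::
    "'a::real_normed_vector set \<Rightarrow> ('a \<Rightarrow> 'a) \<Rightarrow> ('a \<Rightarrow> 'b::banach) \<Rightarrow> bool" where
  "extrapolation_space D A j \<longleftrightarrow> linear j \<and> closure (range j) = UNIV \<and>
     (\<exists>l. complex_of_real l \<in> resolvent_set D A \<and> (\<forall>x. norm (j x) = norm (resolvent D A l x)))"

definition extrapolation_cone :: "('a::banach_lattice \<Rightarrow> 'b::banach) \<Rightarrow> 'b set" where
  "extrapolation_cone j = closure (j ` {x. 0 \<le> x})"

definition positive_control ::
    "('a::banach_lattice \<Rightarrow> 'b::banach) \<Rightarrow> ('u::banach_lattice \<Rightarrow>\<^sub>L 'b) \<Rightarrow> bool" where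
  "positive_control j B \<longleftrightarrow> (\<forall>u\<ge>0. blinfun_apply B u \<in> extrapolation_cone j)"


section \<open>Semigroups\<close>

text \<open>Only the values at times \<open>t \<ge> 0\<close> are relevant.\<close>

definition C0_semigroup :: "(real \<Rightarrow> 'a::banach \<Rightarrow>\<^sub>L 'a) \<Rightarrow> bool" where
  "C0_semigroup T \<longleftrightarrow> T 0 = id_blinfun \<and>
     (\<forall>s\<ge>0. \<forall>t\<ge>0. T (s + t) = T s o\<^sub>L T t) \<and>
     (\<forall>x. ((\<lambda>t. blinfun_apply (T t) x) \<longlongrightarrow> x) (at_right 0))"

definition generates ::
    "'a::banach set \<Rightarrow> ('a \<Rightarrow> 'a) \<Rightarrow> (real \<Rightarrow> 'a \<Rightarrow>\<^sub>L 'a) \<Rightarrow> bool" where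
  "generates D A T \<longleftrightarrow>
     D = {x. \<exists>y. ((\<lambda>h. (blinfun_apply (T h) x - x) /\<^sub>R h) \<longlongrightarrow> y) (at_right 0)} \<and>
     (\<forall>x\<in>D. ((\<lambda>h. (blinfun_apply (T h) x - x) /\<^sub>R h) \<longlongrightarrow> A x) (at_right 0))"

definition positive_semigroup :: "(real \<Rightarrow> 'a::banach_lattice \<Rightarrow>\<^sub>L 'a) \<Rightarrow> bool" where
  "positive_semigroup T \<longleftrightarrow> (\<forall>t\<ge>0. \<forall>x\<ge>0. 0 \<le> blinfun_apply (T t) x)"

definition extends_semigroup ::
    "('a::banach \<Rightarrow> 'b::banach) \<Rightarrow> (real \<Rightarrow> 'a \<Rightarrow>\<^sub>L 'a) \<Rightarrow> (real \<Rightarrow> 'b \<Rightarrow>\<^sub>L 'b) \<Rightarrow> bool" where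
  "extends_semigroup j T S \<longleftrightarrow> C0_semigroup S \<and>
     (\<forall>t\<ge>0. \<forall>x. blinfun_apply (S t) (j x) = j (blinfun_apply (T t) x))"


section \<open>Bochner integration without separability\<close>

text \<open>The library's \<^const>\<open>has_bochner_integral\<close> is confined to second countable spaces.
  Here Borel measurability is replaced by strong measurability, so that arbitrary Banach
  spaces are covered.\<close>

definition strongly_measurable :: "'t measure \<Rightarrow> ('t \<Rightarrow> 'a::real_normed_vector) \<Rightarrow> bool" where
  "strongly_measurable M f \<longleftrightarrow>
     (\<exists>s. (\<forall>i. simple_function M (s i)) \<and> (AE t in M. (\<lambda>i. s i t) \<longlonglongrightarrow> f t))"

definition has_strong_bochner_integral ::
    "'t measure \<Rightarrow> ('t \<Rightarrow> 'a::real_normed_vector) \<Rightarrow> 'a \<Rightarrow> bool" where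
  "has_strong_bochner_integral M f y \<longleftrightarrow> strongly_measurable M f \<and>
     (\<exists>s. (\<forall>i. Bochner_Integration.simple_bochner_integrable M (s i)) \<and>
          (\<lambda>i. \<integral>\<^sup>+t. ennreal (norm (f t - s i t)) \<partial>M) \<longlonglongrightarrow> 0 \<and>
          (\<lambda>i. Bochner_Integration.simple_bochner_integral M (s i)) \<longlonglongrightarrow> y)"

text \<open>No default value is chosen for functions that are not integrable.\<close>

definition strong_bochner_integral ::
    "'t measure \<Rightarrow> ('t \<Rightarrow> 'a::real_normed_vector) \<Rightarrow> 'a" where
  "strong_bochner_integral M f = (THE y. has_strong_bochner_integral M f y)"


section \<open>Admissibility\<close>

text \<open>Functions rather than equivalence classes; values at negative times are irrelevant.\<close>

definition Lp :: "real \<Rightarrow> (real \<Rightarrow> 'u::banach) set" where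
  "Lp p = {u. strongly_measurable (lebesgue_on {0..}) u \<and>
     (\<integral>\<^sup>+t. ennreal (norm (u t) powr p) \<partial>lebesgue_on {0..}) < \<infinity>}"

definition Lp_pos :: "real \<Rightarrow> (real \<Rightarrow> 'u::banach_lattice) set" where
  "Lp_pos p = {u \<in> Lp p. AE t in lebesgue_on {0..}. 0 \<le> u t}"

definition input_map ::
    "(real \<Rightarrow> 'b::banach \<Rightarrow>\<^sub>L 'b) \<Rightarrow> ('u::banach \<Rightarrow>\<^sub>L 'b) \<Rightarrow> real \<Rightarrow> (real \<Rightarrow> 'u) \<Rightarrow> 'b" where
  "input_map S B \<tau> u = strong_bochner_integral (lebesgue_on {0..\<tau>})
     (\<lambda>s. blinfun_apply (S (\<tau> - s)) (blinfun_apply B (u s)))"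

text \<open>For \<open>p \<ge> 1\<close>. For nonnegative times, \<open>T\<close> is determined by its generator and \<open>S\<close> by
  \<open>T\<close>, so the existential quantifiers amount to the assertion that \<open>A\<close> generates a
  positive semigroup, followed by a statement about that semigroup and its extension.\<close>

definition positive_Lp_admissible ::
    "real \<Rightarrow> 'a::banach_lattice set \<Rightarrow> ('a \<Rightarrow> 'a) \<Rightarrow> ('a \<Rightarrow> 'b::banach) \<Rightarrow>
     ('u::banach_lattice \<Rightarrow>\<^sub>L 'b) \<Rightarrow> bool" where
  "positive_Lp_admissible p D A j B \<longleftrightarrow>
     (\<exists>T S. C0_semigroup T \<and> generates D A T \<and> positive_semigroup T \<and> extends_semigroup j T S \<and>
        (\<exists>\<tau>>0. \<forall>u\<in>Lp_pos p. input_map S B \<tau> u \<in> j ` {x. 0 \<le> x}))"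

end

theory Submission
  imports Defs "HOL-Library.Lattice_Algebras"
begin

text \<open>
  Shift the operator: let \<open>A' = A - \<mu>\<close>, so that \<open>R = R(\<mu>, A)\<close> is \<open>- A'\<inverse>\<close>, and let
  \<open>E h = (1 - h A')\<inverse>\<close> be the backward Euler step. Real resolvents above the spectral bound are
  positive (\<open>R_positive\<close>), so the resolvent identity \<open>E h (R x) = R x - h E h x\<close> gives
  \<open>E h (R x) \<le> R x\<close> for \<open>x \<ge> 0\<close>. Iterating, \<open>R ((E h)^n x) \<le> R x\<close>, and the lower bound on \<open>R\<close> over
  the positive cone turns this into a bound on \<open>(E h)^n\<close> that is uniform in \<open>h\<close> and \<open>n\<close>
  (\<open>shifted_euler_scheme\<close>). This is the hypothesis of the Hille--Yosida theorem. The semigroup \<open>T\<close>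
  of \<open>A'\<close> is constructed as the limit of the Euler approximations along dyadic step sizes, so that
  every property of the steps that survives a limit (positivity, commutation with \<open>R\<close>,
  \<open>T t (R x) \<le> R x\<close>) is inherited at once.

  The map \<open>- j A'\<close> on the domain extends to an isomorphism \<open>J\<close> of \<open>X\<close> onto the extrapolation space
  with \<open>J (R x) = j x\<close> (\<open>exists_extension_isomorphism\<close>); conjugation with \<open>J\<close> extends the semigroup.
  Hence everything takes place in \<open>X\<close>: the control operator becomes \<open>r = J\<inverse> B\<close>, positivity of \<open>B\<close>
  says that \<open>r v\<close> lies in the closure of \<open>R (X\<^sub>+)\<close> for \<open>v \<ge> 0\<close>, and the input map has values in \<open>j X\<close> iff
  \<open>\<integral> T (1 - s) (r (u s)) ds\<close> lies in the range of \<open>R\<close>.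

  For \<open>r\<close> in the closure of \<open>R (X\<^sub>+)\<close> the orbit \<open>t \<mapsto> T t r\<close> decreases, and
  \<open>R (T a r - T b r)\<close> is the integral of the orbit over \<open>[a, b]\<close>. The element \<open>T a r - T b r\<close> is
  positive, so its norm is controlled by that of its image under \<open>R\<close>, that is, by
  \<open>(b - a) * norm r\<close> (\<open>T_lipschitz_on_cone\<close>). Therefore the map sending a positive step function
  to the element of \<open>X\<close> that represents its input is bounded for the \<open>L\<^sup>1\<close> norm; splitting values into
  positive and negative parts, it is bounded on all step functions (\<open>step_input_distance\<close>). For a
  positive integrable \<open>u\<close>, positive step functions converging to \<open>u\<close> in \<open>L\<^sup>1\<close> are then sent to a Cauchy
  sequence of positive elements of \<open>X\<close>, and its limit represents the input of \<open>u\<close>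
  (\<open>positive_input_integral\<close>). The factor \<open>exp (\<mu> t)\<close> lost in the shift is absorbed into \<open>u\<close>.
\<close>

section \<open>Banach lattices\<close>

subclass (in banach_lattice) lattice_ab_group_add ..

lemma modulus_pos: "0 \<le> x \<Longrightarrow> sup x (- x) = x" for x :: "'a::banach_lattice"
  by (meson dual_order.trans neg_le_0_iff_le sup.absorb1)

lemma modulus_nonneg: "0 \<le> sup x (- x)" for x :: "'a::banach_lattice"
proof -
  have "x + (- x) \<le> sup x (- x) + sup x (- x)"
    by (intro add_mono) auto
  then show ?thesis by (metis add.right_inverse zero_le_double_add_iff_zero_le_single_add)
qed

lemma norm_mono_pos: "0 \<le> x \<Longrightarrow> x \<le> y \<Longrightarrow> norm x \<le> norm y" for x y :: "'a::banach_lattice"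
  by (intro norm_mono_modulus) (simp add: modulus_pos order.trans[of 0 x y])

lemma norm_le_of_abs_le:
  fixes x y :: "'a::banach_lattice"
  assumes "x \<le> sup y (- y)" "- x \<le> sup y (- y)"
  shows "norm x \<le> norm y"
  using assms by (intro norm_mono_modulus) auto

lemma norm_pprt_le: "norm (pprt x) \<le> norm x" for x :: "'a::banach_lattice"
proof (rule norm_le_of_abs_le)
  show "pprt x \<le> sup x (- x)" by (simp add: pprt_def modulus_nonneg)
  show "- pprt x \<le> sup x (- x)"
    by (meson modulus_nonneg neg_le_0_iff_le order.trans zero_le_pprt)
qed

text \<open>
  The positive part is a contraction; this makes the cone closed, and it allows values of an
  approximating function to be replaced by their positive parts without increasing the
  error.
\<close>

lemma norm_pprt_diff_le: "norm (pprt x - pprt y) \<le> norm (x - y)" for x y :: "'a::banach_lattice"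
proof -
  have *: "pprt x - pprt y \<le> sup (x - y) (- (x - y))" for x y :: 'a
  proof -
    have "x \<le> (x - y) + y" by simp
    also have "\<dots> \<le> sup (x - y) (- (x - y)) + pprt y"
      by (intro add_mono) (auto simp: pprt_def)
    finally have "x \<le> sup (x - y) (- (x - y)) + pprt y" .
    moreover have "0 \<le> sup (x - y) (- (x - y)) + pprt y"
      by (intro add_nonneg_nonneg modulus_nonneg) auto
    ultimately have "pprt x \<le> sup (x - y) (- (x - y)) + pprt y"
      by (simp add: pprt_def[of x])
    then show ?thesis by (simp only: diff_le_eq)
  qed
  show ?thesis
    using *[of x y] *[of y x] by (intro norm_le_of_abs_le) (auto simp: sup_commute)
qed

lemma pos_neg_decomp:
  fixes x :: "'a::banach_lattice"
  shows "x = pprt x - pprt (- x)" "norm (pprt (- x)) \<le> norm x"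
  using prts[of x] norm_pprt_le[of "- x"] by (auto simp: pprt_neg)

lemma closed_positive_cone: "closed {x::'a::banach_lattice. 0 \<le> x}"
proof -
  have "continuous_on UNIV (\<lambda>x::'a. pprt (- x))"
    unfolding continuous_on_iff
    by (metis (no_types, lifting) dist_norm minus_diff_minus norm_minus_cancel norm_pprt_diff_le order_le_less_trans)
  then have "closed {x::'a. pprt (- x) = 0}"
    by (intro closed_Collect_eq) auto
  moreover have "pprt (- x) = 0 \<longleftrightarrow> 0 \<le> x" for x :: 'a
    by (metis le_zero_iff_zero_pprt neg_le_0_iff_le)
  ultimately show ?thesis by simp
qed

lemma tendsto_nonneg:
  fixes x :: "'a::banach_lattice"
  assumes "f \<longlonglongrightarrow> x" "\<And>n. 0 \<le> f n"
  shows "0 \<le> x"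
  using closed_sequentially[OF closed_positive_cone, of f x] assms by auto


section \<open>Resolvents on a half-line\<close>

locale resolvent_family =
  fixes D :: "'x::banach set" and A :: "'x \<Rightarrow> 'x" and R :: "real \<Rightarrow> 'x \<Rightarrow> 'x" and \<mu> :: real
  assumes op: "linear_operator D A"
    and bounded: "\<mu> \<le> l \<Longrightarrow> bounded_linear (R l)"
    and range_R: "\<mu> \<le> l \<Longrightarrow> R l x \<in> D"
    and A_R: "\<mu> \<le> l \<Longrightarrow> A (R l x) = l *\<^sub>R R l x - x"
    and R_left: "\<mu> \<le> l \<Longrightarrow> x \<in> D \<Longrightarrow> R l (l *\<^sub>R x - A x) = x"
begin

lemma subspace_D: "subspace D"
  using op by (simp add: linear_operator_def)

lemma A_scaleR: "x \<in> D \<Longrightarrow> A (r *\<^sub>R x) = r *\<^sub>R A x"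
  using op by (auto simp: linear_operator_def)

lemma linear_R: "\<mu> \<le> l \<Longrightarrow> linear (R l)"
  using bounded bounded_linear.linear by blast

lemma resolvent_identity:
  assumes "\<mu> \<le> l" "\<mu> \<le> m"
  shows "R m x = R l x + (l - m) *\<^sub>R R l (R m x)"
proof -
  have "l *\<^sub>R R m x - A (R m x) = x + (l - m) *\<^sub>R R m x"
    using A_R[OF assms(2)] by (simp add: algebra_simps)
  then show ?thesis
    using R_left[OF assms(1) range_R[OF assms(2)], of x] linear_R[OF assms(1)]
    by (metis linear_add linear_scale)
qed

lemma R_commute:
  assumes "\<mu> \<le> l" "\<mu> \<le> m"
  shows "R l (R m x) = R m (R l x)"
proof (cases "l = m")
  case False
  have "(l - m) *\<^sub>R R l (R m x) = R m x - R l x"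
    using resolvent_identity[OF assms, of x] by (metis add_diff_cancel_left')
  moreover have "(m - l) *\<^sub>R R m (R l x) = R l x - R m x"
    using resolvent_identity[OF assms(2,1), of x] by (metis add_diff_cancel_left')
  ultimately have "(l - m) *\<^sub>R R l (R m x) = (l - m) *\<^sub>R R m (R l x)"
    by (metis minus_diff_eq scaleR_minus_left)
  with False show ?thesis by simp
qed simp

lemma A_commute_R:
  assumes "\<mu> \<le> l" "x \<in> D"
  shows "A (R l x) = R l (A x)"
  using A_R[OF assms(1), of x] R_left[OF assms] linear_R[OF assms(1)]
  by (simp add: linear_diff linear_scale diff_eq_eq eq_diff_eq)

end

text \<open>
  The spectrum is defined through the complexification. At a real point the complexified map
  acts as the real one on each coordinate, so the real resolvent is the first coordinate of
  the complex one.
\<close>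

lemma resolvent_eqs:
  assumes op: "linear_operator D A" and l: "complex_of_real l \<in> resolvent_set D A"
  shows "bounded_linear (resolvent D A l)" "resolvent D A l x \<in> D"
    "A (resolvent D A l x) = l *\<^sub>R resolvent D A l x - x"
    "y \<in> D \<Longrightarrow> resolvent D A l (l *\<^sub>R y - A y) = y"
proof -
  define g where "g = (\<lambda>x. l *\<^sub>R x - A x)"
  define G where "G = (\<lambda>z. cscale (complex_of_real l) z - complexify A z)"
  have G: "G z = (g (fst z), g (snd z))" for z
    by (simp add: G_def g_def cscale_def complexify_def)
  have bij: "bij_betw G (D \<times> D) UNIV" and bl: "bounded_linear (inv_into (D \<times> D) G)"
    using l by (auto simp: resolvent_set_def G_def)
  have D0: "0 \<in> D" using op by (simp add: linear_operator_def subspace_0)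
  have "A 0 = 0"
    using op D0 unfolding linear_operator_def by (metis scaleR_zero_left)
  then have g0: "g 0 = 0" by (simp add: g_def)
  have inj: "inj_on g D"
  proof (rule inj_onI)
    fix x y assume "x \<in> D" "y \<in> D" "g x = g y"
    then have "G (x, x) = G (y, y)" "(x, x) \<in> D \<times> D" "(y, y) \<in> D \<times> D"
      by (auto simp: G)
    then show "x = y" using bij unfolding bij_betw_def inj_on_def by blast
  qed
  have surj: "g ` D = UNIV"
  proof -
    have "y \<in> g ` D" for y
    proof -
      have "(y, y) \<in> G ` (D \<times> D)" using bij by (auto simp: bij_betw_def)
      then show ?thesis by (auto simp: G)
    qed
    then show ?thesis by auto
  qed
  have res: "resolvent D A l = inv_into D g" by (simp add: resolvent_def g_def)
  have inD: "inv_into D g x \<in> D" and inv: "g (inv_into D g x) = x" for x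
    using surj by (auto intro: inv_into_into f_inv_into_f)
  have "inv_into D g = (\<lambda>x. fst (inv_into (D \<times> D) G (x, 0)))"
  proof
    fix x
    have "inv_into (D \<times> D) G (x, 0) = (inv_into D g x, 0)"
      by (rule inv_into_f_eq) (use bij inD inv D0 g0 in \<open>auto simp: bij_betw_def G\<close>)
    then show "inv_into D g x = fst (inv_into (D \<times> D) G (x, 0))" by simp
  qed
  then show "bounded_linear (resolvent D A l)"
    unfolding res
    using bounded_linear_compose[OF bounded_linear_fst
       bounded_linear_compose[OF bl bounded_linear_Pair[OF bounded_linear_ident bounded_linear_zero]]]
    by (simp add: o_def)
  show "resolvent D A l x \<in> D" using inD res by simp
  show "A (resolvent D A l x) = l *\<^sub>R resolvent D A l x - x"
    using inv[of x] by (simp add: g_def res algebra_simps)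
  show "resolvent D A l (l *\<^sub>R y - A y) = y" if "y \<in> D"
    using inv_into_f_f[OF inj that] by (simp add: res) (simp add: g_def)
qed

lemma resolvent_set_above_spectral_bound:
  assumes "spectral_bound D A < ereal \<mu>" "\<mu> \<le> l"
  shows "complex_of_real l \<in> resolvent_set D A"
proof (rule ccontr)
  assume "complex_of_real l \<notin> resolvent_set D A"
  then have "ereal (Re (complex_of_real l)) \<le> spectral_bound D A"
    unfolding spectral_bound_def spectrum_def by (intro SUP_upper) auto
  with assms show False by (metis Re_complex_of_real ereal_less_eq(3) leD le_less_trans)
qed

lemma resolvent_family_resolvent:
  assumes "linear_operator D A" "spectral_bound D A < ereal \<mu>"
  shows "resolvent_family D A (resolvent D A) \<mu>"
  using assms resolvent_eqs[OF assms(1) resolvent_set_above_spectral_bound[OF assms(2)]]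
  by (simp add: resolvent_family_def)

locale positive_resolvent_family = resolvent_family D A R \<mu>
  for D :: "'x::banach_lattice set" and A R \<mu>
begin

text \<open>
  Since \<open>R m x = R l x + (l - m) R l (R m x)\<close>, the vector \<open>R m x\<close> is the fixed point of a
  contraction that preserves the cone, hence the limit of positive iterates started at zero.
  This is the Neumann series of \<open>R m\<close> around \<open>l\<close>.
\<close>

lemma R_positive_step:
  assumes "\<mu> \<le> m" "m \<le> l" and pos: "\<And>x. 0 \<le> x \<Longrightarrow> 0 \<le> R l x"
    and C: "\<And>x. norm (R l x) \<le> C * norm x" and "(l - m) * C < 1" "0 \<le> C" and x: "0 \<le> x"
  shows "0 \<le> R m x"
proof -
  define f where "f = (\<lambda>z. R l x + (l - m) *\<^sub>R R l z)"
  define q where "q = (l - m) * C"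
  have q: "0 \<le> q" "q < 1" using assms by (auto simp: q_def)
  have l: "\<mu> \<le> l" using assms by simp
  have fix_pt: "f (R m x) = R m x"
    using resolvent_identity[OF l assms(1), of x] by (simp add: f_def)
  have contr: "norm (f y - f z) \<le> q * norm (y - z)" for y z
  proof -
    have "f y - f z = (l - m) *\<^sub>R R l (y - z)"
      using linear_R[OF l] by (simp add: f_def linear_diff scaleR_diff_right)
    then show ?thesis
      using C[of "y - z"] assms(2) by (simp add: q_def mult.assoc mult_left_mono)
  qed
  have bound: "norm ((f ^^ n) 0 - R m x) \<le> q ^ n * norm (R m x)" for n
  proof (induction n)
    case (Suc n)
    have "norm ((f ^^ Suc n) 0 - R m x) \<le> q * norm ((f ^^ n) 0 - R m x)"
      using contr[of "(f ^^ n) 0" "R m x"] by (simp add: fix_pt)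
    also have "\<dots> \<le> q * (q ^ n * norm (R m x))"
      using Suc q by (intro mult_left_mono) auto
    finally show ?case by (simp add: mult.assoc)
  qed simp
  have "(\<lambda>n. q ^ n * norm (R m x)) \<longlonglongrightarrow> 0"
    using q by (intro tendsto_mult_left_zero LIMSEQ_realpow_zero) auto
  then have "(\<lambda>n. (f ^^ n) 0 - R m x) \<longlonglongrightarrow> 0"
    by (rule Lim_null_comparison[rotated]) (use bound in auto)
  then have "(\<lambda>n. (f ^^ n) 0) \<longlonglongrightarrow> R m x" by (simp add: LIM_zero_iff)
  moreover have "0 \<le> (f ^^ n) 0" for n
    by (induction n) (use assms in \<open>auto simp: f_def intro!: add_nonneg_nonneg scaleR_nonneg_nonneg\<close>)
  ultimately show ?thesis by (rule tendsto_nonneg)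
qed

text \<open>
  Positivity holds far to the right and propagates to the left by \<open>R_positive_step\<close>. It cannot
  stop at a point \<open>m0 > \<mu>\<close>: the resolvents just to the right of \<open>m0\<close> are bounded by twice the
  bound at \<open>m0\<close>, so the step starting there reaches beyond \<open>m0\<close>.
\<close>

lemma R_positive:
  assumes ev: "\<And>l x. w < l \<Longrightarrow> 0 \<le> x \<Longrightarrow> 0 \<le> R l x" and "\<mu> \<le> l" "0 \<le> x"
  shows "0 \<le> R l x"
proof -
  define S where "S = {m. \<mu> \<le> m \<and> (\<forall>l\<ge>m. \<forall>x\<ge>0. 0 \<le> R l x)}"
  have ne: "max (w + 1) \<mu> \<in> S" using ev by (auto simp: S_def)
  have bdd: "bdd_below S" by (auto simp: S_def intro: bdd_belowI)
  define m0 where "m0 = Inf S"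
  have m0: "\<mu> \<le> m0" unfolding m0_def
  proof (rule cInf_greatest)
    show "S \<noteq> {}" using ne by blast
  qed (auto simp: S_def)
  have above: "0 \<le> R l x" if "m0 < l" "0 \<le> x" for l x
  proof -
    obtain s where "s \<in> S" "s < l"
      using \<open>m0 < l\<close> cInf_lessD[of S l] ne unfolding m0_def by blast
    with \<open>0 \<le> x\<close> show ?thesis by (auto simp: S_def)
  qed
  obtain K where K: "0 \<le> K" "\<And>x. norm (R m0 x) \<le> norm x * K"
    using bounded_linear.nonneg_bounded[OF bounded[OF m0]] by blast
  \<comment> \<open>Small enough that \<open>\<delta> K \<le> 1 / 8\<close>: one step from \<open>m0 + \<delta>\<close> then covers a distance \<open>2 \<delta>\<close>.\<close>
  define \<delta> where "\<delta> = 1 / (8 * (K + 1))"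
  have \<delta>: "0 < \<delta>" "\<delta> * K \<le> 1 / 8" using K by (auto simp: \<delta>_def field_simps)
  have C: "norm (R (m0 + \<delta>) x) \<le> 2 * K * norm x" for x
  proof -
    have "R (m0 + \<delta>) x = R m0 x - \<delta> *\<^sub>R R m0 (R (m0 + \<delta>) x)"
      using resolvent_identity[OF m0, of "m0 + \<delta>" x] m0 \<delta> by simp
    then have "norm (R (m0 + \<delta>) x) \<le> norm (R m0 x) + \<delta> * norm (R m0 (R (m0 + \<delta>) x))"
      by (metis \<delta>(1) abs_of_pos norm_scaleR norm_triangle_ineq4)
    also have "\<dots> \<le> norm x * K + \<delta> * (norm (R (m0 + \<delta>) x) * K)"
      using K \<delta> by (intro add_mono mult_left_mono) auto
    also have "\<dots> = norm x * K + (\<delta> * K) * norm (R (m0 + \<delta>) x)" by simp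
    also have "\<dots> \<le> norm x * K + (1 / 8) * norm (R (m0 + \<delta>) x)"
      using \<delta>(2) by (intro add_mono mult_right_mono order.refl norm_ge_zero)
    finally have "7 / 8 * norm (R (m0 + \<delta>) x) \<le> norm x * K" by simp
    moreover have "0 \<le> norm x * K" using K by simp
    ultimately show ?thesis by (simp add: algebra_simps)
  qed
  have below: "0 \<le> R m x" if "\<mu> \<le> m" "m0 - \<delta> \<le> m" "0 \<le> x" for m x
  proof (cases "m \<le> m0 + \<delta>")
    case True
    have "(m0 + \<delta> - m) * (2 * K) \<le> (2 * \<delta>) * (2 * K)"
      using that K by (intro mult_right_mono) auto
    also have "\<dots> = 4 * (\<delta> * K)" by simp
    also have "\<dots> < 1" using \<delta>(2) by linarith
    finally have "(m0 + \<delta> - m) * (2 * K) < 1" .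
    with that True above C K \<delta> show ?thesis
      by (intro R_positive_step[of m "m0 + \<delta>" "2 * K"]) auto
  next
    case False
    with that above \<delta> show ?thesis by simp
  qed
  have "max \<mu> (m0 - \<delta>) \<in> S" using below by (auto simp: S_def)
  then have "m0 \<le> max \<mu> (m0 - \<delta>)" unfolding m0_def using bdd by (rule cInf_lower)
  with m0 \<delta> have "m0 = \<mu>" by (auto simp: max_def split: if_splits)
  with assms below \<delta> show ?thesis by simp
qed

end

section \<open>Generation of semigroups by the backward Euler scheme\<close>

lemma uniformly_bounded_convergent_on_dense:
  fixes L :: "nat \<Rightarrow> 'a::real_normed_vector \<Rightarrow> 'b::banach"
  assumes lin: "\<And>k. linear (L k)" and bound: "\<And>k x. norm (L k x) \<le> C * norm x"
    and dense: "closure S = UNIV" and conv: "\<And>x. x \<in> S \<Longrightarrow> convergent (\<lambda>k. L k x)"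
  shows "convergent (\<lambda>k. L k x)"
proof -
  have "Cauchy (\<lambda>k. L k x)"
  proof (rule metric_CauchyI)
    fix e :: real assume e: "0 < e"
    define d where "d = e / (3 * (\<bar>C\<bar> + 1))"
    have d: "0 < d" using e by (auto simp: d_def)
    have "\<bar>C\<bar> * d < (\<bar>C\<bar> + 1) * d" using d by simp
    also have "\<dots> = e / 3" by (simp add: d_def field_simps)
    finally have Cd: "\<bar>C\<bar> * d < e / 3" .
    obtain s where s: "s \<in> S" "dist s x < d"
      using dense d closure_approachable[of x S] by auto
    obtain N where N: "\<And>m n. m \<ge> N \<Longrightarrow> n \<ge> N \<Longrightarrow> dist (L m s) (L n s) < e / 3"
      using metric_CauchyD[OF convergent_Cauchy[OF conv[OF s(1)]], of "e / 3"] e by auto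
    have near: "dist (L k x) (L k s) < e / 3" for k
    proof -
      have "norm (L k x - L k s) \<le> C * norm (x - s)"
        using bound[of k "x - s"] by (simp add: linear_diff[OF lin])
      also have "\<dots> \<le> \<bar>C\<bar> * d"
        using s(2) by (intro mult_mono) (auto simp: dist_norm norm_minus_commute)
      finally show ?thesis using Cd by (simp add: dist_norm)
    qed
    have "dist (L m x) (L n x) < e" if "m \<ge> N" "n \<ge> N" for m n
    proof -
      have "dist (L m x) (L n x) \<le> dist (L m x) (L m s) + dist (L m s) (L n s) + dist (L n x) (L n s)"
        by (metis dist_commute dist_triangle add_mono_thms_linordered_semiring(3) order.trans)
      then show ?thesis using near[of m] near[of n] N[OF that] by simp
    qed
    then show "\<exists>N. \<forall>m\<ge>N. \<forall>n\<ge>N. dist (L m x) (L n x) < e" by blast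
  qed
  then show ?thesis by (simp add: Cauchy_convergent_iff)
qed

lemma strong_limit_blinfun:
  fixes L :: "nat \<Rightarrow> 'a::real_normed_vector \<Rightarrow> 'b::banach"
  assumes lin: "\<And>k. linear (L k)" and bound: "\<And>k x. norm (L k x) \<le> C * norm x"
    and conv: "\<And>x. convergent (\<lambda>k. L k x)"
  shows "\<exists>T :: 'a \<Rightarrow>\<^sub>L 'b. \<forall>x. (\<lambda>k. L k x) \<longlonglongrightarrow> T x"
proof -
  have lim: "(\<lambda>k. L k x) \<longlonglongrightarrow> lim (\<lambda>k. L k x)" for x
    using conv by (simp add: convergent_LIMSEQ_iff)
  have "bounded_linear (\<lambda>x. lim (\<lambda>k. L k x))"
  proof (rule bounded_linear_intro)
    show "lim (\<lambda>k. L k (x + y)) = lim (\<lambda>k. L k x) + lim (\<lambda>k. L k y)" for x y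
      using tendsto_add[OF lim[of x] lim[of y]] by (intro limI) (simp add: linear_add[OF lin])
    show "lim (\<lambda>k. L k (r *\<^sub>R x)) = r *\<^sub>R lim (\<lambda>k. L k x)" for r x
      using tendsto_scaleR[OF tendsto_const lim[of x], of r]
      by (intro limI) (simp add: linear_scale[OF lin])
    show "norm (lim (\<lambda>k. L k x)) \<le> norm x * C" for x
      using Lim_bounded[OF tendsto_norm[OF lim[of x]], of 0 "C * norm x"] bound
      by (simp add: mult.commute)
  qed
  then show ?thesis
    using lim by (intro exI[of _ "Blinfun (\<lambda>x. lim (\<lambda>k. L k x))"]) (simp add: bounded_linear_Blinfun_apply)
qed

lemma uniformly_bounded_tendsto_id_on_dense:
  fixes L :: "'i \<Rightarrow> 'a::real_normed_vector \<Rightarrow> 'a"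
  assumes lin: "\<And>t. linear (L t)" and bound: "eventually (\<lambda>t. \<forall>x. norm (L t x) \<le> C * norm x) F"
    and dense: "closure S = UNIV" and conv: "\<And>x. x \<in> S \<Longrightarrow> ((\<lambda>t. L t x) \<longlongrightarrow> x) F"
  shows "((\<lambda>t. L t x) \<longlongrightarrow> x) F"
proof (rule tendstoI)
  fix e :: real assume e: "0 < e"
  define d where "d = e / (3 * (\<bar>C\<bar> + 1))"
  have d: "0 < d" using e by (auto simp: d_def)
  have eq: "(\<bar>C\<bar> + 1) * d = e / 3" by (simp add: d_def field_simps)
  obtain s where s: "s \<in> S" "dist s x < d"
    using dense d closure_approachable[of x S] by auto
  have "0 < e / 3" using e by simp
  from tendstoD[OF conv[OF s(1)] this] bound
  show "eventually (\<lambda>t. dist (L t x) x < e) F"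
  proof eventually_elim
    case (elim t)
    have "norm (L t x - L t s) \<le> C * norm (x - s)"
      using elim(2)[rule_format, of "x - s"] by (simp add: linear_diff[OF lin])
    also have "\<dots> \<le> \<bar>C\<bar> * d"
      using s(2) by (intro mult_mono) (auto simp: dist_norm norm_minus_commute)
    finally have "dist (L t x) (L t s) \<le> \<bar>C\<bar> * d" by (simp add: dist_norm)
    moreover have "\<bar>C\<bar> * d + d = e / 3" using eq by (simp add: distrib_right)
    moreover have "dist (L t x) x \<le> dist (L t x) (L t s) + dist (L t s) s + dist s x"
      by (metis dist_triangle add_mono_thms_linordered_semiring(3) order.trans)
    ultimately show ?case using elim(1) s(2) e by linarith
  qed
qed

lemma linear_funpow: "linear f \<Longrightarrow> linear (f ^^ n)" for f :: "'a::real_vector \<Rightarrow> 'a"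
proof (induction n)
  case 0
  then show ?case by (auto simp: linear_iff)
next
  case (Suc n)
  then show ?case using linear_compose[of "f ^^ n" f] by (simp add: o_def)
qed

lemma dyadic_floor:
  assumes "0 \<le> t"
  shows "real (nat \<lfloor>t * 2 ^ k\<rfloor>) / 2 ^ k \<le> t" "t - real (nat \<lfloor>t * 2 ^ k\<rfloor>) / 2 ^ k \<le> 1 / 2 ^ k"
proof -
  have n: "real (nat \<lfloor>t * 2 ^ k\<rfloor>) \<le> t * 2 ^ k" "t * 2 ^ k \<le> real (nat \<lfloor>t * 2 ^ k\<rfloor>) + 1"
    using assms by (auto simp: of_nat_nat)
  from n(1) show "real (nat \<lfloor>t * 2 ^ k\<rfloor>) / 2 ^ k \<le> t" by (simp add: divide_le_eq)
  have "t = t * 2 ^ k / 2 ^ k" by simp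
  also have "\<dots> \<le> (real (nat \<lfloor>t * 2 ^ k\<rfloor>) + 1) / 2 ^ k"
    using n(2) by (intro divide_right_mono) auto
  finally show "t - real (nat \<lfloor>t * 2 ^ k\<rfloor>) / 2 ^ k \<le> 1 / 2 ^ k" by (simp add: add_divide_distrib)
qed

lemma inverse_two_power_tendsto_zero: "(\<lambda>k. c / 2 ^ k) \<longlonglongrightarrow> (0::real)"
  using LIMSEQ_divide_realpow_zero[of 2 c] by simp

text \<open>
  \<open>E h\<close> stands for \<open>(1 - h A)\<inverse>\<close>. A bound on all its powers, uniform in the step size, is the
  stability condition of the Hille--Yosida theorem for a bounded semigroup.
\<close>

locale euler_scheme =
  fixes D :: "'x::banach set" and A :: "'x \<Rightarrow> 'x" and E :: "real \<Rightarrow> 'x \<Rightarrow> 'x" and M :: real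
  assumes op: "linear_operator D A" and dense: "closure D = UNIV" and M_nonneg: "0 \<le> M"
    and linear_E: "0 < h \<Longrightarrow> linear (E h)"
    and range_E: "0 < h \<Longrightarrow> E h x \<in> D"
    and A_E: "0 < h \<Longrightarrow> h *\<^sub>R A (E h x) = E h x - x"
    and A_commute_E: "0 < h \<Longrightarrow> x \<in> D \<Longrightarrow> A (E h x) = E h (A x)"
    and E_commute: "0 < h \<Longrightarrow> 0 < h' \<Longrightarrow> E h (E h' x) = E h' (E h x)"
    and stable: "0 < h \<Longrightarrow> norm ((E h ^^ n) x) \<le> M * norm x"
begin

lemma subspace_D: "subspace D"
  using op by (simp add: linear_operator_def)

lemma A_add: "x \<in> D \<Longrightarrow> y \<in> D \<Longrightarrow> A (x + y) = A x + A y"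
  and A_scaleR: "x \<in> D \<Longrightarrow> A (r *\<^sub>R x) = r *\<^sub>R A x"
  using op by (auto simp: linear_operator_def)

lemma A_diff: "x \<in> D \<Longrightarrow> y \<in> D \<Longrightarrow> A (x - y) = A x - A y"
  using A_add[of x "(- 1) *\<^sub>R y"] A_scaleR[of y "- 1"] subspace_scale[OF subspace_D, of y "- 1"] by simp

lemma linear_pow: "0 < h \<Longrightarrow> linear (E h ^^ n)"
  by (simp add: linear_funpow linear_E)

lemma norm_E: "0 < h \<Longrightarrow> norm (E h x) \<le> M * norm x"
  using stable[of h 1 x] by simp

lemma pow_D: "0 < h \<Longrightarrow> x \<in> D \<Longrightarrow> (E h ^^ n) x \<in> D"
  by (induction n) (auto simp: range_E)

lemma A_pow: "0 < h \<Longrightarrow> x \<in> D \<Longrightarrow> A ((E h ^^ n) x) = (E h ^^ n) (A x)"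
  by (induction n) (auto simp: A_commute_E pow_D)

lemma E_diff: "0 < h \<Longrightarrow> x \<in> D \<Longrightarrow> E h x - x = h *\<^sub>R E h (A x)"
  by (metis A_E A_commute_E)

lemma pow_step: 
  assumes "0 < h" "x \<in> D"
  shows "(E h ^^ Suc n) x - (E h ^^ n) x = h *\<^sub>R (E h ^^ Suc n) (A x)"
proof -
  have "(E h ^^ Suc n) x - (E h ^^ n) x = (E h ^^ n) (E h x - x)"
    using assms by (simp add: linear_diff[OF linear_pow] funpow_swap1)
  also have "\<dots> = h *\<^sub>R (E h ^^ Suc n) (A x)"
    using assms by (simp add: E_diff linear_scale[OF linear_pow] funpow_swap1)
  finally show ?thesis .
qed

text \<open>
  Every step moves a point of the domain by \<open>h E h (A x)\<close>, so \<open>n\<close> steps move it by at most the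
  elapsed time \<open>n h\<close> times a constant.
\<close>

lemma pow_diff_bound:
  assumes "0 < h" "x \<in> D"
  shows "norm ((E h ^^ n) x - x) \<le> real n * h * (M * norm (A x))"
proof (induction n)
  case (Suc n)
  have "(E h ^^ Suc n) x - x = h *\<^sub>R (E h ^^ Suc n) (A x) + ((E h ^^ n) x - x)"
    using pow_step[OF assms, of n] by (simp add: algebra_simps)
  then have "norm ((E h ^^ Suc n) x - x) \<le> norm (h *\<^sub>R (E h ^^ Suc n) (A x)) + norm ((E h ^^ n) x - x)"
    by (metis norm_triangle_ineq)
  also have "\<dots> \<le> h * (M * norm (A x)) + real n * h * (M * norm (A x))"
    using Suc stable[OF assms(1), of "Suc n" "A x"] assms(1) by (intro add_mono) (auto simp del: funpow.simps)
  finally show ?case by (simp add: algebra_simps)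
qed simp

text \<open>
  The increments \<open>h (E h)^i (A x)\<close> differ from \<open>h A x\<close> by the motion of the vector \<open>A x\<close>. As \<open>A x\<close>
  need not be in the domain, this motion is estimated through an auxiliary \<open>z\<close> in the domain,
  which can later be chosen close to \<open>A x\<close>. The estimate yields the generator without any
  integral of the orbit.
\<close>

lemma pow_taylor_bound:
  assumes h: "0 < h" and x: "x \<in> D" and z: "z \<in> D"
  shows "norm ((E h ^^ n) x - x - (real n * h) *\<^sub>R A x) \<le>
    (real n * h) * ((M + 1) * norm (A x - z) + real n * h * (M * norm (A z)))"
proof (induction n)
  case (Suc n)
  define b where "b = (\<lambda>n::nat. (M + 1) * norm (A x - z) + real n * h * (M * norm (A z)))"
  have b_mono: "b n \<le> b (Suc n)"
    using h M_nonneg by (auto simp: b_def intro!: mult_right_mono)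
  have bound: "norm ((E h ^^ n) (A x) - A x) \<le> b n" for n
  proof -
    have "(E h ^^ n) (A x) - A x = (E h ^^ n) (A x - z) + ((E h ^^ n) z - z) + (z - A x)"
      by (simp add: linear_diff[OF linear_pow[OF h]])
    then have "norm ((E h ^^ n) (A x) - A x) \<le> norm ((E h ^^ n) (A x - z)) + norm ((E h ^^ n) z - z) + norm (z - A x)"
      by (metis norm_triangle_ineq norm_triangle_le add_right_mono)
    also have "\<dots> \<le> M * norm (A x - z) + real n * h * (M * norm (A z)) + norm (A x - z)"
      using stable[OF h] pow_diff_bound[OF h z] by (intro add_mono) (auto simp: norm_minus_commute[of z])
    finally show ?thesis by (simp add: b_def algebra_simps)
  qed
  have "(E h ^^ Suc n) x - x - (real (Suc n) * h) *\<^sub>R A x =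
      ((E h ^^ n) x - x - (real n * h) *\<^sub>R A x) + h *\<^sub>R ((E h ^^ Suc n) (A x) - A x)"
    using pow_step[OF h x, of n] by (simp add: algebra_simps del: funpow.simps)
  then have "norm ((E h ^^ Suc n) x - x - (real (Suc n) * h) *\<^sub>R A x) \<le>
      norm ((E h ^^ n) x - x - (real n * h) *\<^sub>R A x) + norm (h *\<^sub>R ((E h ^^ Suc n) (A x) - A x))"
    by (metis norm_triangle_ineq)
  also have "\<dots> \<le> real n * h * b n + h * b (Suc n)"
    using Suc bound[of "Suc n"] h by (intro add_mono) (auto simp: b_def simp del: funpow.simps)
  also have "\<dots> \<le> real n * h * b (Suc n) + h * b (Suc n)"
    using b_mono h by (intro add_mono mult_left_mono) auto
  also have "\<dots> = real (Suc n) * h * b (Suc n)" by (simp add: algebra_simps)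
  finally show ?case by (simp add: b_def)
qed simp

lemma E_inverse: "0 < h \<Longrightarrow> x \<in> D \<Longrightarrow> E h (x - h *\<^sub>R A x) = x"
  using A_E[of h x] A_commute_E[of h x] linear_E[of h]
  by (simp add: linear_diff linear_scale)

text \<open>
  One step of size \<open>h\<close> and two steps of size \<open>h / 2\<close> agree up to second order:
  \<open>(1 - h/2 A)\<^sup>2 = (1 - h A) + h\<^sup>2/4 A\<^sup>2\<close>.
\<close>

lemma halving_defect:
  assumes h: "0 < h" and x: "x \<in> D" "A x \<in> D"
  shows "E h x - E (h / 2) (E (h / 2) x) = (h\<^sup>2 / 4) *\<^sub>R E (h / 2) (E (h / 2) (E h (A (A x))))"
proof -
  define G where "G = E (h / 2)"
  define y where "y = E h x"
  define w where "w = E h (A (A x))"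
  have h2: "0 < h / 2" using h by simp
  have y: "y \<in> D" "A y \<in> D" "A (A y) = w"
    using h x by (auto simp: y_def w_def range_E A_commute_E)
  have xy: "x = y - h *\<^sub>R A y" using A_E[OF h, of x] by (simp add: y_def)
  define p where "p = y - (h / 2) *\<^sub>R A y"
  have p: "p \<in> D" using y by (auto simp: p_def intro: subspace_diff subspace_scale subspace_D)
  have "G p = y" using E_inverse[OF h2 y(1)] by (simp add: G_def p_def)
  moreover have "G (p - (h / 2) *\<^sub>R A p) = p" using E_inverse[OF h2 p] by (simp add: G_def)
  moreover have "p - (h / 2) *\<^sub>R A p = x + (h\<^sup>2 / 4) *\<^sub>R w"
  proof -
    have "A p = A y - (h / 2) *\<^sub>R w"
      using y by (simp add: p_def A_diff A_scaleR subspace_scale[OF subspace_D])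
    then have "p - (h / 2) *\<^sub>R A p = y - ((h / 2) *\<^sub>R A y + (h / 2) *\<^sub>R A y) + ((h / 2) * (h / 2)) *\<^sub>R w"
      by (simp add: p_def scaleR_diff_right)
    also have "(h / 2) *\<^sub>R A y + (h / 2) *\<^sub>R A y = h *\<^sub>R A y"
      by (simp flip: scaleR_add_left)
    finally show ?thesis by (simp add: xy power2_eq_square)
  qed
  ultimately have "G (G (x + (h\<^sup>2 / 4) *\<^sub>R w)) = y" by simp
  moreover have "linear G" using h2 by (simp add: G_def linear_E)
  ultimately have "y = G (G x) + (h\<^sup>2 / 4) *\<^sub>R G (G w)"
    by (simp add: linear_add linear_scale)
  then show ?thesis by (simp add: y_def G_def w_def)
qed

text \<open>
  Telescoping replaces coarse steps by pairs of fine steps one at a time. The extra power \<open>m\<close>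
  in front collects the fine steps already made; with it the induction uses the stability
  bound once for each side and never multiplies up powers of \<open>M\<close>.
\<close>

lemma halving_bound:
  assumes h: "0 < h" and x: "x \<in> D" "A x \<in> D"
  shows "norm ((E (h / 2) ^^ m) ((E h ^^ n) x - (E (h / 2) ^^ (2 * n)) x)) \<le>
    real n * (h\<^sup>2 / 4 * (M * (M * norm (A (A x)))))"
proof (induction n arbitrary: m)
  case (Suc n)
  define G where "G = E (h / 2)"
  define z where "z = (E h ^^ n) x"
  have h2: "0 < h / 2" using h by simp
  have linG: "linear (G ^^ m)" for m using h2 by (simp add: G_def linear_pow)
  have z: "z \<in> D" "A z \<in> D" "A (A z) = (E h ^^ n) (A (A x))"
    using h x by (auto simp: z_def pow_D A_pow)
  have "(E h ^^ Suc n) x - (G ^^ (2 * Suc n)) x = (E h z - G (G z)) + (G (G z) - G (G ((G ^^ (2 * n)) x)))"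
    by (simp add: z_def)
  also have "G (G z) - G (G ((G ^^ (2 * n)) x)) = (G ^^ 2) (z - (G ^^ (2 * n)) x)"
    unfolding linear_diff[OF linG] by (simp add: numeral_2_eq_2)
  also have "E h z - G (G z) = (h\<^sup>2 / 4) *\<^sub>R (G ^^ 2) ((E h ^^ Suc n) (A (A x)))"
    using halving_defect[OF h z(1,2)] z(3) by (simp add: G_def numeral_2_eq_2)
  finally have split: "(E h ^^ Suc n) x - (G ^^ (2 * Suc n)) x =
      (h\<^sup>2 / 4) *\<^sub>R (G ^^ 2) ((E h ^^ Suc n) (A (A x))) + (G ^^ 2) (z - (G ^^ (2 * n)) x)" .
  have "(G ^^ m) ((E h ^^ Suc n) x - (G ^^ (2 * Suc n)) x) =
      (h\<^sup>2 / 4) *\<^sub>R (G ^^ (m + 2)) ((E h ^^ Suc n) (A (A x))) + (G ^^ (m + 2)) (z - (G ^^ (2 * n)) x)"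
    unfolding split by (simp only: linear_add[OF linG] linear_scale[OF linG] funpow_add o_apply)
  then have "norm ((G ^^ m) ((E h ^^ Suc n) x - (G ^^ (2 * Suc n)) x)) \<le>
      norm ((h\<^sup>2 / 4) *\<^sub>R (G ^^ (m + 2)) ((E h ^^ Suc n) (A (A x)))) + norm ((G ^^ (m + 2)) (z - (G ^^ (2 * n)) x))"
    by (metis norm_triangle_ineq)
  also have "\<dots> \<le> h\<^sup>2 / 4 * (M * (M * norm (A (A x)))) + real n * (h\<^sup>2 / 4 * (M * (M * norm (A (A x)))))"
  proof (rule add_mono)
    have "norm ((G ^^ (m + 2)) ((E h ^^ Suc n) (A (A x)))) \<le> M * norm ((E h ^^ Suc n) (A (A x)))"
      unfolding G_def by (rule stable[OF h2])
    also have "\<dots> \<le> M * (M * norm (A (A x)))"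
      by (intro mult_left_mono stable h M_nonneg)
    finally show "norm ((h\<^sup>2 / 4) *\<^sub>R (G ^^ (m + 2)) ((E h ^^ Suc n) (A (A x)))) \<le> h\<^sup>2 / 4 * (M * (M * norm (A (A x))))"
      by (simp add: mult_left_mono del: funpow.simps)
    show "norm ((G ^^ (m + 2)) (z - (G ^^ (2 * n)) x)) \<le> real n * (h\<^sup>2 / 4 * (M * (M * norm (A (A x)))))"
      unfolding G_def z_def by (rule Suc)
  qed
  finally show ?case by (simp add: G_def algebra_simps del: funpow.simps)
qed (use h in \<open>simp add: linear_0[OF linear_pow]\<close>)

text \<open>
  For negative \<open>t\<close> the truncation makes the number of steps zero, so that these operators are
  the identity there.
\<close>

definition euler :: "nat \<Rightarrow> real \<Rightarrow> 'x \<Rightarrow> 'x" where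
  "euler k t = E (1 / 2 ^ k) ^^ nat \<lfloor>t * 2 ^ k\<rfloor>"

lemma linear_euler: "linear (euler k t)"
  by (simp add: euler_def linear_pow)

lemma norm_euler: "norm (euler k t x) \<le> M * norm x"
  by (simp add: euler_def stable)

text \<open>
  Passing to half the step size doubles the number of steps and possibly adds one; the
  doubling costs \<open>t h\<close> and the additional step costs \<open>h\<close>, up to constants.
\<close>

lemma euler_Cauchy_bound:
  assumes t: "0 \<le> t" and x: "x \<in> D" "A x \<in> D"
  shows "norm (euler (Suc k) t x - euler k t x) \<le>
    (t / 4 * (M * (M * norm (A (A x)))) + M * (M * norm (A x))) / 2 ^ k"
proof -
  define h :: real where "h = 1 / 2 ^ k"
  define n where "n = nat \<lfloor>t * 2 ^ k\<rfloor>"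
  define n' where "n' = nat \<lfloor>t * 2 ^ Suc k\<rfloor>"
  define G where "G = E (h / 2)"
  have h: "0 < h" "0 < h / 2" by (auto simp: h_def)
  have nh: "real n * h \<le> t" using dyadic_floor(1)[OF t, of k] by (simp add: n_def h_def)
  have n': "n' = 2 * n \<or> n' = Suc (2 * n)"
  proof -
    define r where "r = t * 2 ^ k"
    have "0 \<le> r" using t by (simp add: r_def)
    have "\<lfloor>r * 2\<rfloor> = 2 * \<lfloor>r\<rfloor> \<or> \<lfloor>r * 2\<rfloor> = 2 * \<lfloor>r\<rfloor> + 1" by linarith
    moreover have "0 \<le> \<lfloor>r\<rfloor>" using \<open>0 \<le> r\<close> by simp
    moreover have "n = nat \<lfloor>r\<rfloor>" "n' = nat \<lfloor>r * 2\<rfloor>" by (auto simp: n_def n'_def r_def mult_ac)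
    ultimately show ?thesis by linarith
  qed
  have eq: "euler k t = E h ^^ n" "euler (Suc k) t = G ^^ n'"
    by (auto simp: euler_def h_def n_def n'_def G_def mult.commute)
  have 1: "norm ((G ^^ (2 * n)) x - (E h ^^ n) x) \<le> t / 4 * (M * (M * norm (A (A x)))) * h"
  proof -
    have "norm ((E h ^^ n) x - (G ^^ (2 * n)) x) \<le> real n * (h\<^sup>2 / 4 * (M * (M * norm (A (A x)))))"
      using halving_bound[OF h(1) x, of 0 n] by (simp add: G_def)
    also have "\<dots> = (real n * h) * (h / 4 * (M * (M * norm (A (A x)))))"
      by (simp add: power2_eq_square)
    also have "\<dots> \<le> t * (h / 4 * (M * (M * norm (A (A x)))))"
      using nh h M_nonneg by (intro mult_right_mono) auto
    finally show ?thesis by (simp add: norm_minus_commute mult_ac)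
  qed
  have 2: "norm ((G ^^ n') x - (G ^^ (2 * n)) x) \<le> M * (M * norm (A x)) * h"
  proof (cases "n' = 2 * n")
    case True
    then show ?thesis using h M_nonneg by simp
  next
    case False
    then have "(G ^^ n') x - (G ^^ (2 * n)) x = (G ^^ (2 * n)) (G x - x)"
      using n' h(2) by (simp add: G_def linear_diff[OF linear_pow] funpow_swap1)
    also have "norm \<dots> \<le> M * norm (G x - x)" using stable[OF h(2)] by (simp add: G_def)
    also have "\<dots> \<le> M * (h / 2 * (M * norm (A x)))"
      using pow_diff_bound[OF h(2) x(1), of 1] M_nonneg by (intro mult_left_mono) (auto simp: G_def)
    also have "\<dots> \<le> M * (M * norm (A x)) * h"
      using h M_nonneg by (simp add: mult_ac)
    finally show ?thesis .
  qed
  have "norm ((G ^^ n') x - (E h ^^ n) x) \<le> norm ((G ^^ n') x - (G ^^ (2 * n)) x) + norm ((G ^^ (2 * n)) x - (E h ^^ n) x)"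
    by (metis diff_add_cancel add_diff_eq norm_triangle_ineq)
  also have "\<dots> \<le> M * (M * norm (A x)) * h + t / 4 * (M * (M * norm (A (A x)))) * h"
    by (rule add_mono[OF 2 1])
  finally show ?thesis unfolding eq by (simp add: h_def add_divide_distrib)
qed

lemma E_tendsto_id: "(\<lambda>k. E (1 / 2 ^ k) x) \<longlonglongrightarrow> x"
proof (rule uniformly_bounded_tendsto_id_on_dense[OF _ _ dense])
  show "linear (E (1 / 2 ^ k))" for k by (simp add: linear_E)
  show "\<forall>\<^sub>F k in sequentially. \<forall>x. norm (E (1 / 2 ^ k) x) \<le> M * norm x"
    by (simp add: norm_E)
  fix x assume x: "x \<in> D"
  have "norm (E (1 / 2 ^ k) x - x) \<le> (M * norm (A x)) / 2 ^ k" for k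
    using pow_diff_bound[of "1 / 2 ^ k" x 1] x by simp
  then have "(\<lambda>k. E (1 / 2 ^ k) x - x) \<longlonglongrightarrow> 0"
    by (intro Lim_null_comparison[OF _ inverse_two_power_tendsto_zero[of "M * norm (A x)"]]) auto
  then show "(\<lambda>k. E (1 / 2 ^ k) x) \<longlonglongrightarrow> x" by (simp add: LIM_zero_iff)
qed

lemma dense_D2: "closure {x \<in> D. A x \<in> D} = UNIV"
proof -
  have "x \<in> closure {x \<in> D. A x \<in> D}" for x
  proof -
    define e where "e = (\<lambda>k::nat. E (1 / 2 ^ k))"
    have "(\<lambda>k. e k x - x) \<longlonglongrightarrow> 0" using E_tendsto_id[of x] by (simp add: LIM_zero e_def)
    then have "(\<lambda>k. M * norm (e k x - x)) \<longlonglongrightarrow> 0"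
      by (simp add: tendsto_mult_right_zero tendsto_norm_zero)
    then have "(\<lambda>k. e k (e k x - x)) \<longlonglongrightarrow> 0"
      by (rule Lim_null_comparison[rotated]) (simp add: e_def norm_E)
    then have "(\<lambda>k. e k (e k x) - e k x) \<longlonglongrightarrow> 0"
      by (simp add: e_def linear_diff[OF linear_E])
    then have "(\<lambda>k. (e k (e k x) - e k x) + e k x) \<longlonglongrightarrow> 0 + x"
      using E_tendsto_id[of x] by (intro tendsto_add) (auto simp: e_def)
    then have lim: "(\<lambda>k. e k (e k x)) \<longlonglongrightarrow> x" by simp
    have mem: "e k (e k x) \<in> {x \<in> D. A x \<in> D}" for k
      by (auto simp: e_def range_E A_commute_E)
    show ?thesis unfolding closure_sequential using lim mem by fast
  qed
  then show ?thesis by auto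
qed

lemma euler_convergent: "convergent (\<lambda>k. euler k t x)"
proof (cases "0 \<le> t")
  case True
  show ?thesis
  proof (rule uniformly_bounded_convergent_on_dense[OF linear_euler norm_euler dense_D2])
    fix x assume "x \<in> {x \<in> D. A x \<in> D}"
    then have x: "x \<in> D" "A x \<in> D" by auto
    define c where "c = t / 4 * (M * (M * norm (A (A x)))) + M * (M * norm (A x))"
    have "summable (\<lambda>k. c * (1 / 2) ^ k)" by (intro summable_mult summable_geometric) auto
    then have "summable (\<lambda>k. euler (Suc k) t x - euler k t x)"
      by (rule summable_comparison_test'[where N = 0])
        (use euler_Cauchy_bound[OF True x] in \<open>simp add: c_def power_divide\<close>)
    then have "convergent (\<lambda>n. \<Sum>k<n. euler (Suc k) t x - euler k t x)"
      using summable_iff_convergent by blast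
    then have "convergent (\<lambda>n. (euler n t x - euler 0 t x))"
      by (simp only: sum_lessThan_telescope[of "\<lambda>n. euler n t x"])
    then have "convergent (\<lambda>n. (euler n t x - euler 0 t x) + euler 0 t x)"
      by (intro convergent_add convergent_const)
    then show "convergent (\<lambda>k. euler k t x)" by simp
  qed
next
  case False
  have "t * 2 ^ k < 0" for k using False by (simp add: mult_neg_pos)
  then have "nat \<lfloor>t * 2 ^ k\<rfloor> = 0" for k by (metis floor_mono floor_zero less_imp_le nat_le_0)
  then show ?thesis by (simp add: euler_def convergent_const)
qed

definition semigroup :: "real \<Rightarrow> 'x \<Rightarrow>\<^sub>L 'x" where
  "semigroup t = (SOME T. \<forall>x. (\<lambda>k. euler k t x) \<longlonglongrightarrow> blinfun_apply T x)"

lemma semigroup_lim: "(\<lambda>k. euler k t x) \<longlonglongrightarrow> semigroup t x"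
proof -
  have "\<exists>T :: 'x \<Rightarrow>\<^sub>L 'x. \<forall>x. (\<lambda>k. euler k t x) \<longlonglongrightarrow> T x"
    by (rule strong_limit_blinfun[where C = M, OF linear_euler norm_euler euler_convergent])
  from someI_ex[OF this] show ?thesis unfolding semigroup_def by (rule spec)
qed

lemma norm_semigroup: "norm (semigroup t x) \<le> M * norm x"
  using Lim_bounded[OF tendsto_norm[OF semigroup_lim[of t x]], of 0 "M * norm x"] norm_euler by simp

lemma semigroup_invariant:
  assumes "closed C" "\<And>h x. 0 < h \<Longrightarrow> x \<in> C \<Longrightarrow> E h x \<in> C" "x \<in> C"
  shows "semigroup t x \<in> C"
proof (rule closed_sequentially[OF assms(1) _ semigroup_lim])
  have "(E h ^^ n) x \<in> C" if "0 < h" for h n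
    using assms that by (induction n) auto
  then show "euler k t x \<in> C" for k by (simp add: euler_def)
qed

lemma semigroup_0: "semigroup 0 x = x"
  using LIMSEQ_unique[OF semigroup_lim[of 0 x], of x] by (simp add: euler_def)

text \<open>
  The number of steps for \<open>s + t\<close> exceeds the sum of the numbers for \<open>s\<close> and \<open>t\<close> by at most one,
  and one step tends strongly to the identity.
\<close>

lemma semigroup_add:
  assumes "0 \<le> s" "0 \<le> t"
  shows "semigroup (s + t) x = semigroup s (semigroup t x)"
proof -
  have 1: "(\<lambda>k. euler k s (euler k t x)) \<longlonglongrightarrow> semigroup s (semigroup t x)"
  proof -
    have "(\<lambda>k. M * norm (euler k t x - semigroup t x)) \<longlonglongrightarrow> 0"
      using semigroup_lim[of t x] by (simp add: tendsto_mult_right_zero tendsto_norm_zero LIM_zero)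
    then have "(\<lambda>k. euler k s (euler k t x - semigroup t x)) \<longlonglongrightarrow> 0"
      by (rule Lim_null_comparison[rotated]) (simp add: norm_euler)
    then have "(\<lambda>k. euler k s (euler k t x) - euler k s (semigroup t x)) \<longlonglongrightarrow> 0"
      by (simp add: linear_diff[OF linear_euler])
    from tendsto_add[OF this semigroup_lim[of s "semigroup t x"]] show ?thesis by simp
  qed
  have 2: "norm (euler k (s + t) x - euler k s (euler k t x)) \<le> M * norm (E (1 / 2 ^ k) x - x)" for k
  proof -
    define h :: real where "h = 1 / 2 ^ k"
    have h: "0 < h" by (simp add: h_def)
    define m n p where "m = nat \<lfloor>s * 2 ^ k\<rfloor>" and "n = nat \<lfloor>t * 2 ^ k\<rfloor>" and "p = nat \<lfloor>(s + t) * 2 ^ k\<rfloor>"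
    have p: "p = m + n \<or> p = Suc (m + n)"
    proof -
      define a b where "a = s * 2 ^ k" and "b = t * 2 ^ k"
      have "0 \<le> a" "0 \<le> b" using assms by (auto simp: a_def b_def)
      moreover have "\<lfloor>a + b\<rfloor> = \<lfloor>a\<rfloor> + \<lfloor>b\<rfloor> \<or> \<lfloor>a + b\<rfloor> = \<lfloor>a\<rfloor> + \<lfloor>b\<rfloor> + 1" by linarith
      moreover have "0 \<le> \<lfloor>a\<rfloor>" "0 \<le> \<lfloor>b\<rfloor>" using calculation by auto
      moreover have "m = nat \<lfloor>a\<rfloor>" "n = nat \<lfloor>b\<rfloor>" "p = nat \<lfloor>a + b\<rfloor>"
        by (auto simp: m_def n_def p_def a_def b_def distrib_right)
      ultimately show ?thesis by linarith
    qed
    have eq: "euler k s (euler k t x) = (E h ^^ (m + n)) x" "euler k (s + t) x = (E h ^^ p) x"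
      by (auto simp: euler_def m_def n_def p_def h_def funpow_add)
    show ?thesis
    proof (cases "p = m + n")
      case True
      then show ?thesis using M_nonneg by (simp add: eq)
    next
      case False
      with p have "(E h ^^ p) x - (E h ^^ (m + n)) x = (E h ^^ (m + n)) (E h x - x)"
        by (simp add: linear_diff[OF linear_pow[OF h]] funpow_swap1)
      then show ?thesis using stable[OF h, of "m + n" "E h x - x"] by (simp add: eq h_def)
    qed
  qed
  have "(\<lambda>k. M * norm (E (1 / 2 ^ k) x - x)) \<longlonglongrightarrow> 0"
    using E_tendsto_id[of x] by (simp add: tendsto_mult_right_zero tendsto_norm_zero LIM_zero)
  then have "(\<lambda>k. euler k (s + t) x - euler k s (euler k t x)) \<longlonglongrightarrow> 0"
    by (rule Lim_null_comparison[rotated]) (simp add: 2)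
  from tendsto_add[OF this 1] have "(\<lambda>k. euler k (s + t) x) \<longlonglongrightarrow> semigroup s (semigroup t x)" by simp
  then show ?thesis using semigroup_lim LIMSEQ_unique by blast
qed

lemma dyadic_floor_tendsto:
  assumes "0 \<le> t"
  shows "(\<lambda>k. real (nat \<lfloor>t * 2 ^ k\<rfloor>) * (1 / 2 ^ k)) \<longlonglongrightarrow> t"
proof -
  have "(\<lambda>k. t - real (nat \<lfloor>t * 2 ^ k\<rfloor>) * (1 / 2 ^ k)) \<longlonglongrightarrow> 0"
    by (rule Lim_null_comparison[OF _ inverse_two_power_tendsto_zero[of 1]])
      (use dyadic_floor[OF assms] in \<open>simp add: abs_of_nonneg\<close>)
  from tendsto_diff[OF tendsto_const[of t] this] show ?thesis by simp
qed

lemma semigroup_diff_bound: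
  assumes "0 \<le> t" "x \<in> D"
  shows "norm (semigroup t x - x) \<le> t * (M * norm (A x))"
proof (rule LIMSEQ_le)
  show "(\<lambda>k. norm (euler k t x - x)) \<longlonglongrightarrow> norm (semigroup t x - x)"
    by (intro tendsto_intros semigroup_lim)
  show "(\<lambda>k. real (nat \<lfloor>t * 2 ^ k\<rfloor>) * (1 / 2 ^ k) * (M * norm (A x))) \<longlonglongrightarrow> t * (M * norm (A x))"
    by (intro tendsto_intros dyadic_floor_tendsto assms)
  show "\<exists>N. \<forall>n\<ge>N. norm (euler n t x - x) \<le> real (nat \<lfloor>t * 2 ^ n\<rfloor>) * (1 / 2 ^ n) * (M * norm (A x))"
    unfolding euler_def by (intro exI allI impI pow_diff_bound assms) simp
qed

lemma semigroup_taylor_bound: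
  assumes t: "0 \<le> t" and x: "x \<in> D" and z: "z \<in> D"
  shows "norm (semigroup t x - x - t *\<^sub>R A x) \<le> t * ((M + 1) * norm (A x - z) + t * (M * norm (A z)))"
proof (rule LIMSEQ_le)
  define \<theta> where "\<theta> = (\<lambda>k. real (nat \<lfloor>t * 2 ^ k\<rfloor>) * (1 / 2 ^ k))"
  have \<theta>: "\<theta> \<longlonglongrightarrow> t" using dyadic_floor_tendsto[OF t] by (simp add: \<theta>_def)
  show "(\<lambda>k. norm (euler k t x - x - \<theta> k *\<^sub>R A x)) \<longlonglongrightarrow> norm (semigroup t x - x - t *\<^sub>R A x)"
    by (intro tendsto_intros semigroup_lim \<theta>)
  show "(\<lambda>k. \<theta> k * ((M + 1) * norm (A x - z) + \<theta> k * (M * norm (A z))))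
      \<longlonglongrightarrow> t * ((M + 1) * norm (A x - z) + t * (M * norm (A z)))"
    by (intro tendsto_intros \<theta>)
  show "\<exists>N. \<forall>n\<ge>N. norm (euler n t x - x - \<theta> n *\<^sub>R A x) \<le> \<theta> n * ((M + 1) * norm (A x - z) + \<theta> n * (M * norm (A z)))"
    unfolding euler_def \<theta>_def by (intro exI allI impI pow_taylor_bound x z) simp
qed

lemma semigroup_taylor:
  assumes x: "x \<in> D" and e: "0 < e"
  obtains d where "0 < d" "\<And>t. 0 \<le> t \<Longrightarrow> t \<le> d \<Longrightarrow> norm (semigroup t x - x - t *\<^sub>R A x) \<le> t * e"
proof -
  obtain z where z: "z \<in> D" "dist z (A x) < e / (2 * (M + 1))"
  proof -
    have "0 < e / (2 * (M + 1))" using e M_nonneg by simp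
    then show ?thesis using that dense closure_approachable[of "A x" D] by blast
  qed
  then have z1: "(M + 1) * norm (A x - z) \<le> e / 2"
    using M_nonneg by (simp add: dist_norm norm_minus_commute field_simps)
  define d where "d = e / (2 * (M * norm (A z) + 1))"
  have pos: "0 < M * norm (A z) + 1" using M_nonneg by (simp add: add_nonneg_pos)
  show thesis
  proof
    show "0 < d" using e pos by (simp add: d_def)
    fix t assume t: "0 \<le> t" "t \<le> d"
    have "t * (M * norm (A z)) \<le> d * (M * norm (A z) + 1)"
      using t M_nonneg by (intro mult_mono) auto
    also have "\<dots> = e / 2" using pos unfolding d_def by (metis divide_divide_eq_left' nonzero_eq_divide_eq less_irrefl mult.commute)
    finally have "(M + 1) * norm (A x - z) + t * (M * norm (A z)) \<le> e" using z1 by simp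
    then show "norm (semigroup t x - x - t *\<^sub>R A x) \<le> t * e"
      using semigroup_taylor_bound[OF t(1) x z(1)] mult_left_mono[OF _ t(1)] by (meson order.trans)
  qed
qed

lemma semigroup_tendsto_id: "((\<lambda>t. semigroup t x) \<longlongrightarrow> x) (at_right 0)"
proof (rule uniformly_bounded_tendsto_id_on_dense[OF _ _ dense])
  show "linear (blinfun_apply (semigroup t))" for t
    by (simp add: blinfun.bounded_linear_right bounded_linear.linear)
  show "\<forall>\<^sub>F t in at_right 0. \<forall>x. norm (semigroup t x) \<le> M * norm x"
    by (simp add: norm_semigroup)
  fix x assume x: "x \<in> D"
  have ev: "\<forall>\<^sub>F t in at_right (0::real). norm (semigroup t x - x) \<le> t * (M * norm (A x))"
    by (auto simp: eventually_at_right_less intro!: eventually_at_rightI[of 0 1] semigroup_diff_bound x)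
  have "((\<lambda>t. t * (M * norm (A x))) \<longlongrightarrow> 0) (at_right 0)"
    by (intro tendsto_mult_left_zero tendsto_ident_at)
  with ev have "((\<lambda>t. semigroup t x - x) \<longlongrightarrow> 0) (at_right 0)"
    by (rule Lim_null_comparison)
  then show "((\<lambda>t. semigroup t x) \<longlongrightarrow> x) (at_right 0)" by (simp add: LIM_zero_iff)
qed

theorem C0_semigroup_semigroup: "C0_semigroup semigroup"
  unfolding C0_semigroup_def
  by (auto intro!: blinfun_eqI semigroup_tendsto_id simp: semigroup_0 semigroup_add)

lemma semigroup_commute_E:
  assumes "0 < h"
  shows "semigroup t (E h x) = E h (semigroup t x)"
proof -
  have "E h ((E h' ^^ n) x) = (E h' ^^ n) (E h x)" if "0 < h'" for h' n
    using assms that by (induction n) (auto simp: E_commute[OF assms that])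
  then have eq: "euler k t (E h x) = E h (euler k t x)" for k by (simp add: euler_def)
  have "bounded_linear (E h)"
    using linear_E[OF assms] norm_E[OF assms]
    by (intro bounded_linear_intro[of _ M]) (auto simp: linear_add linear_scale mult.commute)
  from bounded_linear.tendsto[OF this semigroup_lim]
  have "(\<lambda>k. euler k t (E h x)) \<longlonglongrightarrow> E h (semigroup t x)" by (simp add: eq)
  then show ?thesis using semigroup_lim LIMSEQ_unique by blast
qed

lemma semigroup_derivative:
  assumes x: "x \<in> D"
  shows "((\<lambda>h. (semigroup h x - x) /\<^sub>R h) \<longlongrightarrow> A x) (at_right 0)"
proof (rule tendstoI)
  fix e :: real assume e: "0 < e"
  then obtain d where d: "0 < d" and b: "\<And>t. 0 \<le> t \<Longrightarrow> t \<le> d \<Longrightarrow> norm (semigroup t x - x - t *\<^sub>R A x) \<le> t * (e / 2)"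
    using semigroup_taylor[OF x, of "e / 2"] by auto
  show "\<forall>\<^sub>F h in at_right 0. dist ((semigroup h x - x) /\<^sub>R h) (A x) < e"
  proof (rule eventually_at_rightI[of 0 d])
    fix h assume "h \<in> {0<..<d}"
    then have h: "0 < h" "h \<le> d" by auto
    have "(semigroup h x - x) /\<^sub>R h - A x = (semigroup h x - x - h *\<^sub>R A x) /\<^sub>R h"
      using h by (simp add: scaleR_diff_right)
    then have "norm ((semigroup h x - x) /\<^sub>R h - A x) = norm (semigroup h x - x - h *\<^sub>R A x) / h"
      using h by (simp add: divide_inverse mult.commute)
    also have "\<dots> \<le> e / 2" using b[of h] h by (simp add: divide_le_eq mult.commute)
    finally show "dist ((semigroup h x - x) /\<^sub>R h) (A x) < e" using e by (simp add: dist_norm)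
  qed (use d in simp)
qed

text \<open>
  The difference quotients converge on \<open>D\<close>. Conversely, if they converge at \<open>x\<close> to \<open>y\<close>, applying
  the bounded operator \<open>E 1\<close>, which commutes with the semigroup and maps into \<open>D\<close>, gives
  \<open>E 1 y = A (E 1 x) = E 1 x - x\<close>, so that \<open>x\<close> is in the range of \<open>E 1\<close>.
\<close>

theorem generates_semigroup: "generates D A semigroup"
proof -
  have "x \<in> D" if y: "((\<lambda>h. (semigroup h x - x) /\<^sub>R h) \<longlongrightarrow> y) (at_right 0)" for x y
  proof -
    have bl: "bounded_linear (E 1)"
      using linear_E[of 1] norm_E[of 1]
      by (intro bounded_linear_intro[of _ M]) (auto simp: linear_add linear_scale mult.commute)
    have "((\<lambda>h. E 1 ((semigroup h x - x) /\<^sub>R h)) \<longlongrightarrow> E 1 y) (at_right 0)"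
      by (rule bounded_linear.tendsto[OF bl y])
    moreover have "E 1 ((semigroup h x - x) /\<^sub>R h) = (semigroup h (E 1 x) - E 1 x) /\<^sub>R h" for h
      using linear_E[of 1] by (simp add: linear_diff linear_scale semigroup_commute_E)
    ultimately have "E 1 y = A (E 1 x)"
      using semigroup_derivative[OF range_E[of 1 x]] tendsto_unique[of "at_right (0::real)"]
      by (simp add: trivial_limit_at_right_real)
    also have "\<dots> = E 1 x - x" using A_E[of 1 x] by simp
    finally have "x = E 1 (x - y)" using linear_E[of 1] by (simp add: linear_diff)
    then show "x \<in> D" using range_E[of 1 "x - y"] by simp
  qed
  then show ?thesis using semigroup_derivative unfolding generates_def by blast
qed

end

section \<open>Strong measurability and uniqueness of the integral\<close>

lemma strongly_measurable_simple: "simple_function M f \<Longrightarrow> strongly_measurable M f"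
  unfolding strongly_measurable_def by (intro exI[of _ "\<lambda>_. f"]) auto

lemma strongly_measurable_compose2:
  assumes "continuous_on UNIV (\<lambda>z. p (fst z) (snd z))" "strongly_measurable M f" "strongly_measurable M g"
  shows "strongly_measurable M (\<lambda>t. p (f t) (g t))"
proof -
  obtain s where s: "\<And>i. simple_function M (s i)" "AE t in M. (\<lambda>i. s i t) \<longlonglongrightarrow> f t"
    using assms(2) by (auto simp: strongly_measurable_def)
  obtain r where r: "\<And>i. simple_function M (r i)" "AE t in M. (\<lambda>i. r i t) \<longlonglongrightarrow> g t"
    using assms(3) by (auto simp: strongly_measurable_def)
  have "simple_function M (\<lambda>t. p (s i t) (r i t))" for i
    by (rule simple_function_compose2[OF s(1) r(1)])
  moreover have "AE t in M. (\<lambda>i. p (s i t) (r i t)) \<longlonglongrightarrow> p (f t) (g t)"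
    using s(2) r(2)
  proof eventually_elim
    case (elim t)
    have "(\<lambda>i. (\<lambda>z. p (fst z) (snd z)) (s i t, r i t)) \<longlonglongrightarrow> (\<lambda>z. p (fst z) (snd z)) (f t, g t)"
      by (rule continuous_on_tendsto_compose[OF assms(1) tendsto_Pair[OF elim]]) auto
    then show ?case by simp
  qed
  ultimately show ?thesis
    unfolding strongly_measurable_def by (intro exI[of _ "\<lambda>i t. p (s i t) (r i t)"]) auto
qed

lemma strongly_measurable_diff:
  "strongly_measurable M f \<Longrightarrow> strongly_measurable M g \<Longrightarrow> strongly_measurable M (\<lambda>t. f t - g t)"
  by (rule strongly_measurable_compose2[where p = "(-)"]) (intro continuous_intros)

text \<open>
  The simple functions converge only almost everywhere and the measure need not be complete,
  so the norm of \<open>f\<close> itself may fail to be measurable. It agrees almost everywhere with the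
  limit of the norms of the simple functions.
\<close>

lemma strongly_measurable_norm:
  assumes "strongly_measurable M f"
  obtains g where "g \<in> borel_measurable M" "AE t in M. g t = norm (f t)"
proof -
  obtain s where s: "\<And>i. simple_function M (s i)" "AE t in M. (\<lambda>i. s i t) \<longlonglongrightarrow> f t"
    using assms by (auto simp: strongly_measurable_def)
  have "(\<lambda>t. norm (s i t)) \<in> borel_measurable M" for i
    by (rule borel_measurable_simple_function[OF simple_function_compose1[OF s(1)]])
  then have "(\<lambda>t. lim (\<lambda>i. norm (s i t))) \<in> borel_measurable M" by measurable
  moreover have "AE t in M. lim (\<lambda>i. norm (s i t)) = norm (f t)"
    using s(2) by eventually_elim (intro limI tendsto_norm)
  ultimately show thesis by (rule that)
qed

text \<open>
  The nonnegative integral is additive only on measurable functions, so this is not plain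
  monotonicity: it holds because the norms on the right can be replaced by measurable
  functions.
\<close>

lemma nn_integral_norm_le:
  assumes f: "strongly_measurable M f" and g: "strongly_measurable M g" and nn: "0 \<le> a" "0 \<le> b"
    and le: "AE t in M. norm (h t) \<le> a * norm (f t) + b * norm (g t)"
  shows "(\<integral>\<^sup>+t. ennreal (norm (h t)) \<partial>M) \<le>
    ennreal a * (\<integral>\<^sup>+t. ennreal (norm (f t)) \<partial>M) + ennreal b * (\<integral>\<^sup>+t. ennreal (norm (g t)) \<partial>M)"
proof -
  obtain f' where [measurable]: "f' \<in> borel_measurable M" and f': "AE t in M. f' t = norm (f t)"
    by (rule strongly_measurable_norm[OF f])
  obtain g' where [measurable]: "g' \<in> borel_measurable M" and g': "AE t in M. g' t = norm (g t)"
    by (rule strongly_measurable_norm[OF g])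
  have "(\<integral>\<^sup>+t. ennreal (norm (h t)) \<partial>M) \<le> (\<integral>\<^sup>+t. ennreal a * ennreal (f' t) + ennreal b * ennreal (g' t) \<partial>M)"
  proof (rule nn_integral_mono_AE)
    show "AE t in M. ennreal (norm (h t)) \<le> ennreal a * ennreal (f' t) + ennreal b * ennreal (g' t)"
      using f' g' le
    proof eventually_elim
      case (elim t)
      then have "ennreal (norm (h t)) \<le> ennreal (a * norm (f t) + b * norm (g t))" by (intro ennreal_leI)
      then show ?case using elim nn by (simp add: ennreal_plus ennreal_mult)
    qed
  qed
  also have "\<dots> = ennreal a * (\<integral>\<^sup>+t. ennreal (f' t) \<partial>M) + ennreal b * (\<integral>\<^sup>+t. ennreal (g' t) \<partial>M)"
    by (simp add: nn_integral_add nn_integral_cmult)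
  also have "(\<integral>\<^sup>+t. ennreal (f' t) \<partial>M) = (\<integral>\<^sup>+t. ennreal (norm (f t)) \<partial>M)"
    using f' by (intro nn_integral_cong_AE) auto
  also have "(\<integral>\<^sup>+t. ennreal (g' t) \<partial>M) = (\<integral>\<^sup>+t. ennreal (norm (g t)) \<partial>M)"
    using g' by (intro nn_integral_cong_AE) auto
  finally show ?thesis .
qed

lemma nn_integral_norm_triangle:
  assumes "strongly_measurable M f" "strongly_measurable M g" "strongly_measurable M h"
  shows "(\<integral>\<^sup>+t. ennreal (norm (f t - h t)) \<partial>M) \<le>
    (\<integral>\<^sup>+t. ennreal (norm (f t - g t)) \<partial>M) + (\<integral>\<^sup>+t. ennreal (norm (g t - h t)) \<partial>M)"
  using nn_integral_norm_le[OF strongly_measurable_diff[OF assms(1,2)] strongly_measurable_diff[OF assms(2,3)],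
      of 1 1 "\<lambda>t. f t - h t"]
  by (simp add: norm_triangle_le_diff order.trans[OF _ norm_triangle_ineq])

lemma norm_simple_bochner_integral_le:
  assumes f: "Bochner_Integration.simple_bochner_integrable M f"
  shows "ennreal (norm (Bochner_Integration.simple_bochner_integral M f)) \<le> (\<integral>\<^sup>+t. ennreal (norm (f t)) \<partial>M)"
proof -
  have "Bochner_Integration.simple_bochner_integrable M (\<lambda>t. norm (f t))"
    using simple_bochner_integrable_compose2[of "\<lambda>x y. norm x", OF _ f f] by simp
  from simple_bochner_integral_eq_nn_integral[OF this]
  show ?thesis
    using simple_bochner_integral_norm_bound[OF f] by (metis ennreal_leI norm_ge_zero)
qed

lemma strongly_measurable_integrable:
  "Bochner_Integration.simple_bochner_integrable M f \<Longrightarrow> strongly_measurable M f"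
  by (auto elim!: simple_bochner_integrable.cases intro: strongly_measurable_simple)

lemma has_strong_bochner_integral_unique:
  assumes "has_strong_bochner_integral M f y" "has_strong_bochner_integral M f z"
  shows "y = z"
proof -
  have f: "strongly_measurable M f" using assms by (simp add: has_strong_bochner_integral_def)
  obtain s where s: "\<And>i. Bochner_Integration.simple_bochner_integrable M (s i)"
      "(\<lambda>i. \<integral>\<^sup>+t. ennreal (norm (f t - s i t)) \<partial>M) \<longlonglongrightarrow> 0"
      "(\<lambda>i. Bochner_Integration.simple_bochner_integral M (s i)) \<longlonglongrightarrow> y"
    using assms(1) by (auto simp: has_strong_bochner_integral_def)
  obtain r where r: "\<And>i. Bochner_Integration.simple_bochner_integrable M (r i)"
      "(\<lambda>i. \<integral>\<^sup>+t. ennreal (norm (f t - r i t)) \<partial>M) \<longlonglongrightarrow> 0"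
      "(\<lambda>i. Bochner_Integration.simple_bochner_integral M (r i)) \<longlonglongrightarrow> z"
    using assms(2) by (auto simp: has_strong_bochner_integral_def)
  have le: "ennreal (norm (Bochner_Integration.simple_bochner_integral M (s i) - Bochner_Integration.simple_bochner_integral M (r i)))
      \<le> (\<integral>\<^sup>+t. ennreal (norm (f t - s i t)) \<partial>M) + (\<integral>\<^sup>+t. ennreal (norm (f t - r i t)) \<partial>M)" for i
  proof -
    have "Bochner_Integration.simple_bochner_integrable M (\<lambda>t. s i t - r i t)"
      by (rule simple_bochner_integrable_compose2[OF _ s(1) r(1)]) simp
    then have "ennreal (norm (Bochner_Integration.simple_bochner_integral M (\<lambda>t. s i t - r i t)))
        \<le> (\<integral>\<^sup>+t. ennreal (norm (s i t - r i t)) \<partial>M)"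
      by (rule norm_simple_bochner_integral_le)
    also have "\<dots> \<le> (\<integral>\<^sup>+t. ennreal (norm (s i t - f t)) \<partial>M) + (\<integral>\<^sup>+t. ennreal (norm (f t - r i t)) \<partial>M)"
      by (intro nn_integral_norm_triangle strongly_measurable_integrable s r f)
    finally show ?thesis
      by (simp add: simple_bochner_integral_diff[OF s(1) r(1)] norm_minus_commute)
  qed
  have lim1: "(\<lambda>i. ennreal (norm (Bochner_Integration.simple_bochner_integral M (s i) - Bochner_Integration.simple_bochner_integral M (r i)))) \<longlonglongrightarrow> ennreal (norm (y - z))"
    by (intro tendsto_intros tendsto_ennrealI s(3) r(3))
  have lim2: "(\<lambda>i. (\<integral>\<^sup>+t. ennreal (norm (f t - s i t)) \<partial>M) + (\<integral>\<^sup>+t. ennreal (norm (f t - r i t)) \<partial>M)) \<longlonglongrightarrow> 0 + 0"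
    by (intro tendsto_add s(2) r(2))
  have "ennreal (norm (y - z)) \<le> 0 + 0"
    by (rule LIMSEQ_le[OF lim1 lim2]) (use le in blast)
  then show ?thesis by (simp add: ennreal_eq_0_iff)
qed

lemma strong_bochner_integral_eq:
  "has_strong_bochner_integral M f y \<Longrightarrow> strong_bochner_integral M f = y"
  unfolding strong_bochner_integral_def using has_strong_bochner_integral_unique by blast

section \<open>Step functions on a uniform mesh\<close>

abbreviation unit_interval :: "real measure" where
  "unit_interval \<equiv> lebesgue_on {0..1}"

lemma emeasure_unit_interval: "E \<subseteq> {0..1} \<Longrightarrow> emeasure unit_interval E = emeasure lebesgue E"
  by (simp add: emeasure_restrict_space)

lemma finite_emeasure_unit_interval: "emeasure unit_interval E \<noteq> \<infinity>" 
proof -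
  have "emeasure unit_interval E \<le> emeasure unit_interval {0..1}"
    using emeasure_space[of unit_interval E] by simp
  also have "\<dots> = 1" by (simp add: emeasure_unit_interval)
  finally show ?thesis by (auto simp: top_unique)
qed

lemma simple_bochner_integrable_unit:
  "simple_function unit_interval f \<Longrightarrow> Bochner_Integration.simple_bochner_integrable unit_interval f"
  by (simp add: simple_bochner_integrable.intros finite_emeasure_unit_interval del: infinity_ennreal_def)

text \<open>
  The number of the cell of the uniform mesh of width \<open>1 / N\<close> that contains \<open>s\<close>. Step functions
  are written \<open>w (mesh_index N s)\<close>; at \<open>s = 1\<close> the index is \<open>N\<close>, one more than that of the last
  cell of positive length.
\<close>

definition mesh_index :: "nat \<Rightarrow> real \<Rightarrow> nat" where
  "mesh_index N s = nat \<lfloor>real N * s\<rfloor>"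

lemma mesh_index_iff:
  assumes "0 < N" "0 \<le> s"
  shows "mesh_index N s = k \<longleftrightarrow> real k / real N \<le> s \<and> s < real (Suc k) / real N"
proof -
  have "mesh_index N s = k \<longleftrightarrow> \<lfloor>real N * s\<rfloor> = int k"
    using assms by (auto simp: mesh_index_def)
  also have "\<dots> \<longleftrightarrow> real k \<le> real N * s \<and> real N * s < real k + 1"
    by (simp add: floor_eq_iff)
  finally show ?thesis using assms by (simp add: field_simps)
qed

lemma mesh_index_le: "s \<le> 1 \<Longrightarrow> mesh_index N s \<le> N"
proof -
  assume "s \<le> 1"
  then have "real N * s \<le> real N" by (simp add: mult_left_le)
  then show ?thesis unfolding mesh_index_def by linarith
qed

text \<open>
  Every mesh refines to one with \<open>m\<close> times as many cells, so any two step functions can be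
  written over the common mesh with \<open>N * K\<close> cells.
\<close>

lemma mesh_index_refine:
  assumes "0 < m"
  shows "mesh_index N s = mesh_index (N * m) s div m"
proof -
  have "\<lfloor>real N * s\<rfloor> = \<lfloor>real (N * m) * s / real_of_int (int m)\<rfloor>"
    using assms by simp
  also have "\<dots> = \<lfloor>real (N * m) * s\<rfloor> div int m"
    by (rule floor_divide_real_eq_div) simp
  finally have "nat \<lfloor>real N * s\<rfloor> = nat (\<lfloor>real (N * m) * s\<rfloor> div int m)" by simp
  then show ?thesis
    unfolding mesh_index_def
    by (cases "0 \<le> \<lfloor>real (N * m) * s\<rfloor>")
      (auto simp: nat_div_distrib div_neg_pos_less0 assms not_le intro!: nat_le_0 order.strict_implies_order)
qed

lemma measurable_mesh_index: "mesh_index N \<in> measurable unit_interval (count_space UNIV)"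
proof -
  have "mesh_index N \<in> measurable borel (count_space UNIV)"
    unfolding mesh_index_def by measurable
  then have "mesh_index N \<in> measurable lebesgue (count_space UNIV)"
    by (intro measurable_completion) simp
  then show ?thesis by (rule measurable_restrict_space1)
qed

lemma simple_mesh_index: "simple_function unit_interval (mesh_index N)"
  unfolding simple_function_def
proof
  have "mesh_index N ` {0..1} \<subseteq> {..N}" using mesh_index_le by auto
  then show "finite (mesh_index N ` space unit_interval)" by (simp add: finite_subset)
  show "\<forall>x\<in>mesh_index N ` space unit_interval. mesh_index N -` {x} \<inter> space unit_interval \<in> sets unit_interval"
    using measurable_sets[OF measurable_mesh_index[of N]] by simp
qed

lemma simple_step: "simple_function unit_interval (\<lambda>s. w (mesh_index N s))"
  by (rule simple_function_compose1[OF simple_mesh_index])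

lemma integrable_step: "Bochner_Integration.simple_bochner_integrable unit_interval (\<lambda>s. w (mesh_index N s))"
  by (rule simple_bochner_integrable_unit[OF simple_step])

lemma integral_step:
  assumes N: "0 < N"
  shows "Bochner_Integration.simple_bochner_integral unit_interval (\<lambda>s. w (mesh_index N s)) = (\<Sum>k<N. (1 / real N) *\<^sub>R w k)"
proof -
  have meas: "measure unit_interval {s \<in> space unit_interval. mesh_index N s = k} = (if k < N then 1 / real N else 0)"
    if "k \<le> N" for k
  proof (cases "k < N")
    case True
    then have "real (Suc k) / real N \<le> 1" using N by simp
    have k0: "0 \<le> real k / real N" by simp
    have "{s \<in> space unit_interval. mesh_index N s = k} = {real k / real N..<real (Suc k) / real N}"
    proof (intro equalityI subsetI)
      fix s assume "s \<in> {s \<in> space unit_interval. mesh_index N s = k}"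
      then show "s \<in> {real k / real N..<real (Suc k) / real N}" using mesh_index_iff[OF N, of s k] by auto
    next
      fix s assume s: "s \<in> {real k / real N..<real (Suc k) / real N}"
      then have "real k / real N \<le> s" "s < real (Suc k) / real N" by auto
      with k0 \<open>real (Suc k) / real N \<le> 1\<close> have "0 \<le> s" "s \<le> 1" by linarith+
      with s show "s \<in> {s \<in> space unit_interval. mesh_index N s = k}" using mesh_index_iff[OF N, of s k] by auto
    qed
    moreover have "{real k / real N..<real (Suc k) / real N} \<subseteq> {0..1}"
      using \<open>real (Suc k) / real N \<le> 1\<close> by (auto simp: order.trans[of 0 "real k / real N"])
    moreover have "real k / real N \<le> real (Suc k) / real N" by (simp add: divide_right_mono)
    ultimately show ?thesis
      using True by (simp add: measure_def emeasure_unit_interval) (simp add: add_divide_distrib)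
  next
    case False
    with that have k: "k = N" by simp
    have "{s \<in> space unit_interval. mesh_index N s = k} = {1}"
    proof (intro equalityI subsetI)
      fix s assume "s \<in> {s \<in> space unit_interval. mesh_index N s = k}"
      then show "s \<in> {1}" using N mesh_index_iff[OF N, of s N] by (auto simp: k)
    next
      fix s :: real assume "s \<in> {1}"
      then show "s \<in> {s \<in> space unit_interval. mesh_index N s = k}"
        using N mesh_index_iff[OF N, of 1 N] by (simp add: k)
    qed
    then show ?thesis using False by (simp add: measure_def emeasure_unit_interval)
  qed
  have img: "mesh_index N ` space unit_interval = {..N}"
  proof
    show "mesh_index N ` space unit_interval \<subseteq> {..N}" using mesh_index_le by auto
    have "k \<in> mesh_index N ` space unit_interval" if "k \<le> N" for k
    proof
      show "k = mesh_index N (real k / real N)"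
        using N mesh_index_iff[OF N, of "real k / real N" k] by (simp add: divide_strict_right_mono)
      show "real k / real N \<in> space unit_interval" using that N by simp
    qed
    then show "{..N} \<subseteq> mesh_index N ` space unit_interval" by auto
  qed
  have "Bochner_Integration.simple_bochner_integral unit_interval (\<lambda>s. w (mesh_index N s)) =
      (\<Sum>k\<in>mesh_index N ` space unit_interval. measure unit_interval {s \<in> space unit_interval. mesh_index N s = k} *\<^sub>R w k)"
    by (rule simple_bochner_integral_partition[OF integrable_step simple_mesh_index]) auto
  also have "\<dots> = (\<Sum>k\<le>N. (if k < N then 1 / real N else 0) *\<^sub>R w k)"
    unfolding img using meas by (intro sum.cong) simp_all
  also have "\<dots> = (\<Sum>k<N. (1 / real N) *\<^sub>R w k)"
    by (simp flip: lessThan_Suc_atMost)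
  finally show ?thesis .
qed

lemma nn_integral_norm_step:
  assumes N: "0 < N"
  shows "(\<integral>\<^sup>+s. ennreal (norm (w (mesh_index N s))) \<partial>unit_interval) = ennreal (\<Sum>k<N. norm (w k) / real N)"
  using simple_bochner_integral_eq_nn_integral[OF integrable_step[of "\<lambda>k. norm (w k)" N]]
    integral_step[OF N, of "\<lambda>k. norm (w k)"]
  by simp

section \<open>Density of step functions\<close>

definition step_approximable :: "(real \<Rightarrow> 'a::real_normed_vector) \<Rightarrow> bool" where
  "step_approximable u \<longleftrightarrow> strongly_measurable unit_interval u \<and>
     (\<forall>e>0. \<exists>N>0. \<exists>w. (\<integral>\<^sup>+s. ennreal (norm (u s - w (mesh_index N s))) \<partial>unit_interval) < ennreal e)"

lemma strongly_measurable_step: "strongly_measurable unit_interval (\<lambda>s. w (mesh_index N s))"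
  by (rule strongly_measurable_simple[OF simple_step])

lemma step_approximableI:
  assumes "strongly_measurable unit_interval u"
    and "\<And>e. 0 < e \<Longrightarrow> \<exists>v. step_approximable v \<and> (\<integral>\<^sup>+s. ennreal (norm (u s - v s)) \<partial>unit_interval) < ennreal e"
  shows "step_approximable u"
  unfolding step_approximable_def
proof (intro conjI allI impI assms(1))
  fix e :: real assume "0 < e"
  then have e: "0 < e / 2" by simp
  obtain v where v: "step_approximable v" "(\<integral>\<^sup>+s. ennreal (norm (u s - v s)) \<partial>unit_interval) < ennreal (e / 2)"
    using assms(2)[OF e] by blast
  obtain N w where N: "0 < N" and w: "(\<integral>\<^sup>+s. ennreal (norm (v s - w (mesh_index N s))) \<partial>unit_interval) < ennreal (e / 2)"
    using v(1) e unfolding step_approximable_def by blast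
  have "(\<integral>\<^sup>+s. ennreal (norm (u s - w (mesh_index N s))) \<partial>unit_interval) \<le>
      (\<integral>\<^sup>+s. ennreal (norm (u s - v s)) \<partial>unit_interval) + (\<integral>\<^sup>+s. ennreal (norm (v s - w (mesh_index N s))) \<partial>unit_interval)"
    using v(1) by (intro nn_integral_norm_triangle assms strongly_measurable_step) (simp add: step_approximable_def)
  also have "\<dots> < ennreal (e / 2) + ennreal (e / 2)" by (rule add_strict_mono[OF v(2) w])
  also have "\<dots> = ennreal e" using e by (simp flip: ennreal_plus)
  finally show "\<exists>N>0. \<exists>w. (\<integral>\<^sup>+s. ennreal (norm (u s - w (mesh_index N s))) \<partial>unit_interval) < ennreal e"
    using N by blast
qed

lemma step_approximable_cong:
  assumes "\<And>s. 0 \<le> s \<Longrightarrow> s \<le> 1 \<Longrightarrow> u s = v s" "step_approximable u"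
  shows "step_approximable v"
proof -
  have "strongly_measurable unit_interval v \<longleftrightarrow> strongly_measurable unit_interval u"
  proof -
    have "(AE t in unit_interval. (\<lambda>i. s i t) \<longlonglongrightarrow> v t) \<longleftrightarrow> (AE t in unit_interval. (\<lambda>i. s i t) \<longlonglongrightarrow> u t)" for s
      by (intro AE_cong) (simp add: assms(1))
    then show ?thesis unfolding strongly_measurable_def by simp
  qed
  moreover have "(\<integral>\<^sup>+s. ennreal (norm (v s - w (mesh_index N s))) \<partial>unit_interval)
     = (\<integral>\<^sup>+s. ennreal (norm (u s - w (mesh_index N s))) \<partial>unit_interval)" for N w
    by (intro nn_integral_cong) (simp add: assms(1))
  ultimately show ?thesis using assms(2) by (simp add: step_approximable_def)
qed

lemma step_approximable_step:
  assumes "0 < N"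
  shows "step_approximable (\<lambda>s. w (mesh_index N s))"
  unfolding step_approximable_def
proof (intro conjI allI impI strongly_measurable_step)
  fix e :: real assume "0 < e"
  then show "\<exists>N'>0. \<exists>w'. (\<integral>\<^sup>+s. ennreal (norm (w (mesh_index N s) - w' (mesh_index N' s))) \<partial>unit_interval) < ennreal e"
    using assms by (intro exI[of _ N] conjI exI[of _ w]) auto
qed

lemma step_approximable_const: "step_approximable (\<lambda>s. v)"
  using step_approximable_step[of 1 "\<lambda>_. v"] by simp

lemma step_approximable_diff:
  assumes u: "step_approximable u" and v: "step_approximable v"
  shows "step_approximable (\<lambda>s. u s - v s)"
proof (rule step_approximableI)
  have mu: "strongly_measurable unit_interval u" and mv: "strongly_measurable unit_interval v"
    using u v by (auto simp: step_approximable_def)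
  then show "strongly_measurable unit_interval (\<lambda>s. u s - v s)" by (rule strongly_measurable_diff)
  fix e :: real assume "0 < e"
  then have e: "0 < e / 2" by simp
  obtain N x where N: "0 < N" and x: "(\<integral>\<^sup>+s. ennreal (norm (u s - x (mesh_index N s))) \<partial>unit_interval) < ennreal (e / 2)"
    using u e unfolding step_approximable_def by blast
  obtain K y where K: "0 < K" and y: "(\<integral>\<^sup>+s. ennreal (norm (v s - y (mesh_index K s))) \<partial>unit_interval) < ennreal (e / 2)"
    using v e unfolding step_approximable_def by blast
  define w where "w = (\<lambda>k. x (k div K) - y (k div N))"
  have w: "w (mesh_index (N * K) s) = x (mesh_index N s) - y (mesh_index K s)" for s
    using mesh_index_refine[OF K, of N s] mesh_index_refine[OF N, of K s] by (simp add: w_def mult.commute)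
  have "(\<integral>\<^sup>+s. ennreal (norm (u s - v s - w (mesh_index (N * K) s))) \<partial>unit_interval) \<le>
      ennreal 1 * (\<integral>\<^sup>+s. ennreal (norm (u s - x (mesh_index N s))) \<partial>unit_interval) +
      ennreal 1 * (\<integral>\<^sup>+s. ennreal (norm (v s - y (mesh_index K s))) \<partial>unit_interval)"
  proof (rule nn_integral_norm_le)
    show "AE s in unit_interval. norm (u s - v s - w (mesh_index (N * K) s)) \<le>
       1 * norm (u s - x (mesh_index N s)) + 1 * norm (v s - y (mesh_index K s))"
    proof (rule AE_I2)
      fix s
      have "u s - v s - w (mesh_index (N * K) s) = (u s - x (mesh_index N s)) - (v s - y (mesh_index K s))"
        by (simp add: w)
      then show "norm (u s - v s - w (mesh_index (N * K) s)) \<le>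
         1 * norm (u s - x (mesh_index N s)) + 1 * norm (v s - y (mesh_index K s))"
        using norm_triangle_ineq4[of "u s - x (mesh_index N s)" "v s - y (mesh_index K s)"] by (simp only: mult_1)
    qed
  qed (auto intro: strongly_measurable_diff mu mv strongly_measurable_step)
  also have "\<dots> < ennreal (e / 2) + ennreal (e / 2)" using add_strict_mono[OF x y] by simp
  also have "\<dots> = ennreal e" using e by (simp flip: ennreal_plus)
  finally show "\<exists>w. step_approximable w \<and> (\<integral>\<^sup>+s. ennreal (norm (u s - v s - w s)) \<partial>unit_interval) < ennreal e"
    using N K step_approximable_step[of "N * K" w] by fastforce
qed

lemma step_approximable_add:
  assumes "step_approximable u" "step_approximable v"
  shows "step_approximable (\<lambda>s. u s + v s)"
  using step_approximable_diff[OF assms(1) step_approximable_diff[OF step_approximable_const[of 0] assms(2)]] by simp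

lemma step_approximable_sum:
  "finite I \<Longrightarrow> (\<And>i. i \<in> I \<Longrightarrow> step_approximable (u i)) \<Longrightarrow> step_approximable (\<lambda>s. \<Sum>i\<in>I. u i s)"
  by (induction I rule: finite_induct) (auto intro: step_approximable_add step_approximable_const)

lemma simple_indicator:
  assumes "E \<in> sets lebesgue"
  shows "simple_function unit_interval (\<lambda>s. indicator E s *\<^sub>R v)"
proof -
  have "E \<inter> {0..1} \<in> sets unit_interval" using assms by (auto simp: sets_restrict_space)
  then have "simple_function unit_interval (indicator E :: real \<Rightarrow> real)"
    using simple_function_indicator[of "E \<inter> {0..1}" unit_interval]
    by (subst simple_function_cong[where g = "indicator (E \<inter> {0..1})"]) (auto simp: indicator_def)
  then show ?thesis by (rule simple_function_compose1)
qed

lemma nn_integral_indicator_norm: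
  assumes "E \<in> sets lebesgue"
  shows "(\<integral>\<^sup>+s. ennreal (norm (indicator E s *\<^sub>R v)) \<partial>unit_interval) = ennreal (norm v) * emeasure lebesgue (E \<inter> {0..1})"
proof -
  have E: "E \<inter> {0..1} \<in> sets unit_interval" using assms by (auto simp: sets_restrict_space)
  have "(\<integral>\<^sup>+s. ennreal (norm (indicator E s *\<^sub>R v)) \<partial>unit_interval) =
      (\<integral>\<^sup>+s. ennreal (norm v) * indicator (E \<inter> {0..1}) s \<partial>unit_interval)"
    by (intro nn_integral_cong) (auto simp: indicator_def)
  also have "\<dots> = ennreal (norm v) * emeasure unit_interval (E \<inter> {0..1})"
    by (rule nn_integral_cmult_indicator[OF E])
  finally show ?thesis by (simp add: emeasure_unit_interval)
qed

text \<open>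
  The step function with value \<open>v\<close> on the cells up to the one containing \<open>a\<close> differs from the
  indicator only within distance \<open>1 / N\<close> to the right of \<open>a\<close>.
\<close>

lemma step_approximable_atMost: "step_approximable (\<lambda>s. indicator {..a} s *\<^sub>R v)"
proof (rule step_approximableI)
  show "strongly_measurable unit_interval (\<lambda>s. indicator {..a} s *\<^sub>R v)"
    by (intro strongly_measurable_simple simple_indicator) simp
  fix e :: real assume e: "0 < e"
  obtain N0 :: nat where N0: "norm v / e < real N0" using reals_Archimedean2 by blast
  define N where "N = Suc N0"
  have N: "0 < N" "norm v / e < real N" using N0 by (auto simp: N_def)
  define w where "w = (\<lambda>k. if int k \<le> \<lfloor>real N * a\<rfloor> then v else 0)"
  have le: "norm (indicator {..a} s *\<^sub>R v - w (mesh_index N s)) \<le> norm (indicator {a..a + 1 / real N} s *\<^sub>R v)"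
    if s: "0 \<le> s" for s
  proof (cases "s \<le> a")
    case True
    then have "\<lfloor>real N * s\<rfloor> \<le> \<lfloor>real N * a\<rfloor>" by (intro floor_mono mult_left_mono) auto
    moreover have "int (mesh_index N s) = \<lfloor>real N * s\<rfloor>" using s by (simp add: mesh_index_def)
    ultimately show ?thesis using True by (simp add: w_def)
  next
    case False
    show ?thesis
    proof (cases "int (mesh_index N s) \<le> \<lfloor>real N * a\<rfloor>")
      case True
      have "\<lfloor>real N * s\<rfloor> \<le> \<lfloor>real N * a\<rfloor>" using True s by (simp add: mesh_index_def)
      then have "real N * s \<le> real N * a + 1" by linarith
      then have "s \<le> a + 1 / real N" using N(1) by (simp add: field_simps)
      with False show ?thesis by (simp add: w_def)
    next
      case F: False
      with False show ?thesis by (simp add: w_def)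
    qed
  qed
  have "(\<integral>\<^sup>+s. ennreal (norm (indicator {..a} s *\<^sub>R v - w (mesh_index N s))) \<partial>unit_interval) \<le>
     (\<integral>\<^sup>+s. ennreal (norm (indicator {a..a + 1 / real N} s *\<^sub>R v)) \<partial>unit_interval)"
    by (intro nn_integral_mono ennreal_leI le) simp
  also have "\<dots> = ennreal (norm v) * emeasure lebesgue ({a..a + 1 / real N} \<inter> {0..1})"
    by (rule nn_integral_indicator_norm) simp
  also have "\<dots> \<le> ennreal (norm v) * emeasure lebesgue {a..a + 1 / real N}"
    by (intro mult_left_mono emeasure_mono) auto
  also have "\<dots> = ennreal (norm v * (1 / real N))" by (subst ennreal_mult) simp_all
  also have "\<dots> < ennreal e"
    using N e by (intro ennreal_lessI) (auto simp: field_simps)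
  finally show "\<exists>w. step_approximable w \<and> (\<integral>\<^sup>+s. ennreal (norm (indicator {..a} s *\<^sub>R v - w s)) \<partial>unit_interval) < ennreal e"
    using step_approximable_step[OF N(1), of w] by fastforce
qed

text \<open>
  Half-lines form an intersection-stable generator of the Borel sets, so the approximable
  sets, being closed under complements and countable disjoint unions, contain all of them.
\<close>

lemma step_approximable_borel:
  assumes "E \<in> sets borel"
  shows "step_approximable (\<lambda>s. indicator E s *\<^sub>R v)"
proof -
  have "Int_stable (range (\<lambda>a::real. {..a}))"
    by (auto simp: Int_stable_def)
  moreover have "range (\<lambda>a::real. {..a}) \<subseteq> Pow UNIV" by simp
  moreover have "E \<in> sigma_sets UNIV (range (\<lambda>a::real. {..a}))"
    using assms by (simp add: borel_eq_atMost)
  ultimately show ?thesis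
  proof (induction rule: sigma_sets_induct_disjoint)
    case (basic A)
    then show ?case using step_approximable_atMost by auto
  next
    case empty
    then show ?case using step_approximable_const[of 0] by simp
  next
    case (compl A)
    have "(\<lambda>s. indicator (UNIV - A) s *\<^sub>R v) = (\<lambda>s. v - indicator A s *\<^sub>R v)"
      by (auto simp: indicator_def)
    then show ?case using step_approximable_diff[OF step_approximable_const compl(2)] by simp
  next
    case (union A)
    have A: "A i \<in> sets borel" for i using union(2) by (auto simp: borel_eq_atMost)
    define U where "U = (\<lambda>n. \<Union>i<n. A i)"
    have U: "U n \<in> sets borel" "(\<Union>i. A i) - U n \<in> sets borel" for n using A by (auto simp: U_def)
    have approx: "step_approximable (\<lambda>s. indicator (U n) s *\<^sub>R v)" for n
    proof -
      have "disjoint_family_on A {..<n}" using union(1) by (rule disjoint_family_on_mono[rotated]) simp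
      then have "(\<lambda>s. indicator (U n) s *\<^sub>R v) = (\<lambda>s. \<Sum>i<n. indicator (A i) s *\<^sub>R v)"
        by (simp add: U_def indicator_UN_disjoint scaleR_sum_left fun_eq_iff)
      then show ?thesis using step_approximable_sum[of "{..<n}" "\<lambda>i s. indicator (A i) s *\<^sub>R v"] union(3) by simp
    qed
    define F where "F = (\<lambda>n. ((\<Union>i. A i) - U n) \<inter> {0..1})"
    have "(\<lambda>n. emeasure lebesgue (F n)) \<longlonglongrightarrow> emeasure lebesgue (\<Inter>n. F n)"
    proof (rule Lim_emeasure_decseq)
      have "F n \<in> sets borel" for n unfolding F_def using U by (intro sets.Int) auto
      then show "range F \<subseteq> sets lebesgue" by auto
      show "decseq F" by (rule decseq_SucI) (auto simp: F_def U_def less_Suc_eq)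
      show "emeasure lebesgue (F n) \<noteq> \<infinity>" for n
        using emeasure_mono[of "F n" "{0..1}" lebesgue] by (auto simp: F_def top_unique)
    qed
    moreover have "(\<Inter>n. F n) = {}" by (fastforce simp: F_def U_def)
    ultimately have "(\<lambda>n. emeasure lebesgue (F n)) \<longlonglongrightarrow> 0" by simp
    then have lim: "(\<lambda>n. ennreal (norm v) * emeasure lebesgue (F n)) \<longlonglongrightarrow> ennreal (norm v) * 0"
      by (intro ennreal_tendsto_cmult) auto
    have "(\<Union>i. A i) \<in> sets borel" using A by auto
    show ?case
    proof (rule step_approximableI)
      show "strongly_measurable unit_interval (\<lambda>s. indicator (\<Union>i. A i) s *\<^sub>R v)"
        using \<open>(\<Union>i. A i) \<in> sets borel\<close> by (intro strongly_measurable_simple simple_indicator) auto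
      fix e :: real assume "0 < e"
      then have "\<forall>\<^sub>F n in sequentially. ennreal (norm v) * emeasure lebesgue (F n) < ennreal e"
        using order_tendstoD(2)[OF lim, of "ennreal e"] by simp
      then obtain n where n: "ennreal (norm v) * emeasure lebesgue (F n) < ennreal e"
        using eventually_happens'[OF sequentially_bot] by blast
      have "(\<lambda>s. indicator (\<Union>i. A i) s *\<^sub>R v - indicator (U n) s *\<^sub>R v) = (\<lambda>s. indicator ((\<Union>i. A i) - U n) s *\<^sub>R v)"
      proof
        fix s
        show "indicator (\<Union>i. A i) s *\<^sub>R v - indicator (U n) s *\<^sub>R v = indicator ((\<Union>i. A i) - U n) s *\<^sub>R v"
          by (cases "s \<in> U n") (auto simp: U_def indicator_def)
      qed
      then have "(\<integral>\<^sup>+s. ennreal (norm (indicator (\<Union>i. A i) s *\<^sub>R v - indicator (U n) s *\<^sub>R v)) \<partial>unit_interval) < ennreal e"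
        using n nn_integral_indicator_norm[of "(\<Union>i. A i) - U n" v] U(2)[of n] by (simp add: F_def fun_eq_iff)
      then show "\<exists>w. step_approximable w \<and> (\<integral>\<^sup>+s. ennreal (norm (indicator (\<Union>i. A i) s *\<^sub>R v - w s)) \<partial>unit_interval) < ennreal e"
        using approx[of n] by blast
    qed
  qed
qed

lemma step_approximable_AE:
  assumes "step_approximable u" "strongly_measurable unit_interval v" "AE s in unit_interval. u s = v s"
  shows "step_approximable v"
proof (rule step_approximableI[OF assms(2)])
  fix e :: real assume "0 < e"
  have "(\<integral>\<^sup>+s. ennreal (norm (v s - u s)) \<partial>unit_interval) = (\<integral>\<^sup>+s. 0 \<partial>unit_interval)"
    using assms(3) by (intro nn_integral_cong_AE) auto
  then show "\<exists>w. step_approximable w \<and> (\<integral>\<^sup>+s. ennreal (norm (v s - w s)) \<partial>unit_interval) < ennreal e"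
    using assms(1) \<open>0 < e\<close> by (intro exI[of _ u]) simp
qed

lemma step_approximable_indicator:
  assumes "E \<in> sets lebesgue"
  shows "step_approximable (\<lambda>s. indicator E s *\<^sub>R v)"
proof -
  obtain S N N' where E: "E = S \<union> N" "N \<subseteq> N'" "N' \<in> null_sets lborel" "S \<in> sets lborel"
    using assms by (rule sets_completionE)
  have "AE s in lebesgue. s \<notin> N'"
    using E(3) by (intro AE_completion AE_not_in) 
  then have "AE s in unit_interval. s \<notin> N'" by (subst AE_restrict_space_iff) auto
  then have "AE s in unit_interval. (indicator S s *\<^sub>R v) = indicator E s *\<^sub>R v"
    by eventually_elim (use E in \<open>auto simp: indicator_def\<close>)
  then show ?thesis
    using E(4) by (intro step_approximable_AE[OF step_approximable_borel] strongly_measurable_simple simple_indicator assms) auto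
qed

lemma step_approximable_simple:
  assumes "simple_function unit_interval u"
  shows "step_approximable u"
proof -
  define I where "I = u ` {0..1}"
  define E where "E = (\<lambda>y. u -` {y} \<inter> {0..1})"
  have fin: "finite I" and E: "y \<in> I \<Longrightarrow> E y \<in> sets lebesgue" for y
    using assms by (auto simp: simple_function_def I_def E_def sets_restrict_space_iff)
  have "step_approximable (\<lambda>s. \<Sum>y\<in>I. indicator (E y) s *\<^sub>R y)"
    using fin E by (intro step_approximable_sum step_approximable_indicator)
  moreover have "(\<Sum>y\<in>I. indicator (E y) s *\<^sub>R y) = u s" if "0 \<le> s" "s \<le> 1" for s
  proof -
    have "(\<Sum>y\<in>I. indicator (E y) s *\<^sub>R y) = (\<Sum>y\<in>I. if y = u s then u s else 0)"
      using that by (intro sum.cong) (auto simp: E_def indicator_def)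
    also have "\<dots> = u s" using fin that by (simp add: I_def)
    finally show ?thesis .
  qed
  ultimately show ?thesis by (rule step_approximable_cong[rotated])
qed

text \<open>
  The simple functions \<open>s i\<close> converging to \<open>u\<close> are cut off where their norm exceeds twice that
  of \<open>u\<close>. The cut-off functions still converge to \<open>u\<close>, and \<open>3 * norm (u t)\<close> dominates the error.
\<close>

lemma step_approximable_integrable:
  assumes u: "strongly_measurable unit_interval u"
    and fin: "(\<integral>\<^sup>+s. ennreal (norm (u s)) \<partial>unit_interval) < \<infinity>"
  shows "step_approximable u"
proof (rule step_approximableI[OF u])
  obtain s where s: "\<And>i. simple_function unit_interval (s i)" "AE t in unit_interval. (\<lambda>i. s i t) \<longlonglongrightarrow> u t"
    using u by (auto simp: strongly_measurable_def)
  obtain g where g[measurable]: "g \<in> borel_measurable unit_interval" and gu: "AE t in unit_interval. g t = norm (u t)"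
    by (rule strongly_measurable_norm[OF u])
  define r where "r = (\<lambda>i t. if norm (s i t) \<le> 2 * g t then s i t else 0)"
  have r: "simple_function unit_interval (r i)" for i
  proof -
    have [measurable]: "(\<lambda>t. norm (s i t)) \<in> borel_measurable unit_interval"
      by (rule borel_measurable_simple_function[OF simple_function_compose1[OF s(1)]])
    show ?thesis unfolding r_def by (intro simple_function_If s simple_function_const) measurable
  qed
  have "\<exists>h. h \<in> borel_measurable unit_interval \<and> (AE t in unit_interval. h t = norm (u t - r i t))" for i
    using strongly_measurable_norm[OF strongly_measurable_diff[OF u strongly_measurable_simple[OF r]]] by metis
  then obtain h where h[measurable]: "\<And>i. h i \<in> borel_measurable unit_interval"
    and hu: "\<And>i. AE t in unit_interval. h i t = norm (u t - r i t)" by metis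
  have "(\<lambda>i. \<integral>\<^sup>+t. ennreal (h i t) \<partial>unit_interval) \<longlonglongrightarrow> (\<integral>\<^sup>+t. 0 \<partial>unit_interval)"
  proof (rule nn_integral_dominated_convergence[where w = "\<lambda>t. ennreal (3 * g t)"])
    show "AE t in unit_interval. ennreal (h i t) \<le> ennreal (3 * g t)" for i
      using hu[of i] gu
    proof eventually_elim
      case (elim t)
      have "norm (u t - r i t) \<le> norm (u t) + norm (r i t)" by (rule norm_triangle_ineq4)
      also have "norm (r i t) \<le> 2 * g t" using elim by (simp add: r_def)
      finally show ?case using elim by (intro ennreal_leI) simp
    qed
    have "(\<integral>\<^sup>+t. ennreal (3 * g t) \<partial>unit_interval) = (\<integral>\<^sup>+t. 3 * ennreal (norm (u t)) \<partial>unit_interval)"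
      using gu by (intro nn_integral_cong_AE) (auto simp: ennreal_mult)
    also have "\<dots> = (\<integral>\<^sup>+t. 3 * ennreal (g t) \<partial>unit_interval)"
      using gu by (intro nn_integral_cong_AE) auto
    also have "\<dots> = 3 * (\<integral>\<^sup>+t. ennreal (g t) \<partial>unit_interval)" by (rule nn_integral_cmult) measurable
    also have "(\<integral>\<^sup>+t. ennreal (g t) \<partial>unit_interval) = (\<integral>\<^sup>+t. ennreal (norm (u t)) \<partial>unit_interval)"
      using gu by (intro nn_integral_cong_AE) auto
    finally show "(\<integral>\<^sup>+t. ennreal (3 * g t) \<partial>unit_interval) < \<infinity>"
      using fin by (simp add: ennreal_mult_less_top)
    have "AE t in unit_interval. \<forall>i. h i t = norm (u t - r i t)" using hu by (simp add: AE_all_countable)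
    then show "AE t in unit_interval. (\<lambda>i. ennreal (h i t)) \<longlonglongrightarrow> 0"
      using s(2) gu
    proof eventually_elim
      case (elim t)
      have "(\<lambda>i. r i t) \<longlonglongrightarrow> u t"
      proof (cases "u t = 0")
        case True
        then have "r i t = 0" for i using elim by (simp add: r_def)
        with True show ?thesis by simp
      next
        case False
        then have "norm (u t) < 2 * g t" using elim by simp
        with order_tendstoD(2)[OF tendsto_norm[OF elim(2)]]
        have "\<forall>\<^sub>F i in sequentially. norm (s i t) < 2 * g t" by blast
        then have "\<forall>\<^sub>F i in sequentially. s i t = r i t"
          by eventually_elim (simp add: r_def)
        then show ?thesis using elim(2) by (rule Lim_transform_eventually[rotated])
      qed
      then have "(\<lambda>i. norm (u t - r i t)) \<longlonglongrightarrow> norm (u t - u t)" by (intro tendsto_intros)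
      then have "(\<lambda>i. ennreal (norm (u t - r i t))) \<longlonglongrightarrow> ennreal 0" by (intro tendsto_ennrealI) simp
      then show ?case using elim(1) by simp
    qed
  qed measurable
  then have lim: "(\<lambda>i. \<integral>\<^sup>+t. ennreal (norm (u t - r i t)) \<partial>unit_interval) \<longlonglongrightarrow> 0"
  proof -
    have "(\<integral>\<^sup>+t. ennreal (h i t) \<partial>unit_interval) = (\<integral>\<^sup>+t. ennreal (norm (u t - r i t)) \<partial>unit_interval)" for i
      using hu[of i] by (intro nn_integral_cong_AE) auto
    with \<open>(\<lambda>i. \<integral>\<^sup>+t. ennreal (h i t) \<partial>unit_interval) \<longlonglongrightarrow> _\<close> show ?thesis by simp
  qed
  fix e :: real assume "0 < e"
  then have "\<forall>\<^sub>F i in sequentially. (\<integral>\<^sup>+t. ennreal (norm (u t - r i t)) \<partial>unit_interval) < ennreal e"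
    using order_tendstoD(2)[OF lim, of "ennreal e"] by simp
  then obtain i where "(\<integral>\<^sup>+t. ennreal (norm (u t - r i t)) \<partial>unit_interval) < ennreal e"
    using eventually_happens'[OF sequentially_bot] by blast
  then show "\<exists>v. step_approximable v \<and> (\<integral>\<^sup>+t. ennreal (norm (u t - v t)) \<partial>unit_interval) < ennreal e"
    using step_approximable_simple[OF r] by blast
qed

lemma positive_step_approximation:
  fixes u :: "real \<Rightarrow> 'u::banach_lattice"
  assumes u: "strongly_measurable unit_interval u"
    and fin: "(\<integral>\<^sup>+s. ennreal (norm (u s)) \<partial>unit_interval) < \<infinity>"
    and pos: "AE s in unit_interval. 0 \<le> u s" and e: "0 < e"
  obtains N w where "0 < N" "\<And>k. 0 \<le> w k"
    "(\<integral>\<^sup>+s. ennreal (norm (u s - w (mesh_index N s))) \<partial>unit_interval) < ennreal e"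
proof -
  obtain N w where N: "0 < N" and w: "(\<integral>\<^sup>+s. ennreal (norm (u s - w (mesh_index N s))) \<partial>unit_interval) < ennreal e"
    using step_approximable_integrable[OF u fin] e unfolding step_approximable_def by blast
  have "(\<integral>\<^sup>+s. ennreal (norm (u s - pprt (w (mesh_index N s)))) \<partial>unit_interval) \<le>
      (\<integral>\<^sup>+s. ennreal (norm (u s - w (mesh_index N s))) \<partial>unit_interval)"
  proof (rule nn_integral_mono_AE)
    show "AE s in unit_interval. ennreal (norm (u s - pprt (w (mesh_index N s)))) \<le> ennreal (norm (u s - w (mesh_index N s)))"
      using pos
    proof eventually_elim
      case (elim s)
      then show ?case using norm_pprt_diff_le[of "u s" "w (mesh_index N s)"] by (simp add: ennreal_leI)
    qed
  qed
  also note w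
  finally show thesis using N by (intro that[of N "\<lambda>k. pprt (w k)"]) auto
qed

section \<open>The order structure of the semigroup\<close>

text \<open>
  Here \<open>A\<close> stands for the shifted operator, whose inverse is \<open>- R\<close>.
\<close>

locale positive_euler_scheme = euler_scheme D A E M
  for D :: "'x::banach_lattice set" and A E M +
  fixes R :: "'x \<Rightarrow>\<^sub>L 'x" and c :: real
  assumes range_R: "R x \<in> D" and A_R: "A (R x) = - x" and R_A: "x \<in> D \<Longrightarrow> R (A x) = - x"
    and E_R: "0 < h \<Longrightarrow> E h (R x) = R (E h x)"
    and E_pos: "0 < h \<Longrightarrow> 0 \<le> x \<Longrightarrow> 0 \<le> E h x"
    and E_R_le: "0 < h \<Longrightarrow> 0 \<le> x \<Longrightarrow> E h (R x) \<le> R x"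
    and c_pos: "0 < c" and R_lower: "0 \<le> x \<Longrightarrow> c * norm x \<le> norm (R x)"
begin

abbreviation "T \<equiv> semigroup"

lemma T_pos: "0 \<le> x \<Longrightarrow> 0 \<le> T t x"
  using semigroup_invariant[OF closed_positive_cone, of x t] E_pos by auto

lemma T_mono: "x \<le> y \<Longrightarrow> T t x \<le> T t y"
  using T_pos[of "y - x" t] by (simp add: blinfun.diff_right)

lemma T_R: "T t (R x) = R (T t x)"
proof -
  have "(E h ^^ n) (R x) = R ((E h ^^ n) x)" if "0 < h" for h n
    using that by (induction n) (auto simp: E_R)
  then have "euler k t (R x) = R (euler k t x)" for k by (simp add: euler_def)
  then have "(\<lambda>k. euler k t (R x)) \<longlonglongrightarrow> R (T t x)"
    by (simp add: blinfun.tendsto[OF tendsto_const semigroup_lim])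
  then show ?thesis using semigroup_lim LIMSEQ_unique by blast
qed

lemma T_R_le:
  assumes x: "0 \<le> x"
  shows "T t (R x) \<le> R x"
proof -
  have "closed ((\<lambda>z. R x - z) -` {z. 0 \<le> z})"
    by (intro closed_vimage closed_positive_cone continuous_intros)
  moreover have "(\<lambda>z. R x - z) -` {z. 0 \<le> z} = {z. z \<le> R x}" by auto
  ultimately have "closed {z. z \<le> R x}" by simp
  moreover have "E h z \<in> {z. z \<le> R x}" if h: "0 < h" and z: "z \<in> {z. z \<le> R x}" for h z
  proof -
    have "0 \<le> E h (R x - z)" using h z by (intro E_pos) auto
    then have "E h z \<le> E h (R x)" by (simp add: linear_diff[OF linear_E[OF h]])
    then show ?thesis using E_R_le[OF h x] by simp
  qed
  ultimately show ?thesis using semigroup_invariant[of "{z. z \<le> R x}" "R x" t] by blast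
qed

text \<open>
  This is the positive cone of the extrapolation space transported to \<open>X\<close> by the isomorphism
  with \<open>J (R x) = j x\<close>.
\<close>

definition cone :: "'x set" where
  "cone = closure (R ` {x. 0 \<le> x})"

lemma T_antimono_on_cone:
  assumes r: "r \<in> cone" and t: "0 \<le> a" "a \<le> b"
  shows "T b r \<le> T a r"
proof -
  have "closed ((\<lambda>z. T a z - T b z) -` {z. 0 \<le> z})"
    by (intro closed_vimage closed_positive_cone continuous_intros)
  moreover have "R ` {x. 0 \<le> x} \<subseteq> (\<lambda>z. T a z - T b z) -` {z. 0 \<le> z}"
  proof clarsimp
    fix x :: 'x assume "0 \<le> x"
    then have "T a (T (b - a) (R x)) \<le> T a (R x)" by (intro T_mono T_R_le)
    then show "T b (R x) \<le> T a (R x)" using semigroup_add[of a "b - a" "R x"] t by simp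
  qed
  ultimately have "cone \<subseteq> (\<lambda>z. T a z - T b z) -` {z. 0 \<le> z}"
    unfolding cone_def by (rule closure_minimal[rotated])
  then show ?thesis using r by auto
qed

text \<open>
  The increment \<open>T a r - T b r\<close> is positive, so the lower bound on \<open>R\<close> applies to it. After
  applying \<open>R\<close> the orbit starts in the domain, where it is Lipschitz with constant
  proportional to \<open>norm (A (R r)) = norm r\<close>.
\<close>

lemma T_lipschitz_on_cone:
  assumes r: "r \<in> cone" and t: "0 \<le> a" "a \<le> b"
  shows "norm (T a r - T b r) \<le> (b - a) * (M * M / c * norm r)"
proof -
  have "c * norm (T a r - T b r) \<le> norm (R (T a r - T b r))"
    using T_antimono_on_cone[OF assms] by (intro R_lower) simp
  also have "R (T a r - T b r) = - T a (T (b - a) (R r) - R r)"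
    using semigroup_add[of a "b - a" "R r"] t by (simp add: blinfun.diff_right T_R)
  also have "norm \<dots> \<le> M * norm (T (b - a) (R r) - R r)" by (simp add: norm_semigroup)
  also have "\<dots> \<le> M * ((b - a) * (M * norm r))"
    using semigroup_diff_bound[OF _ range_R, of "b - a" r] t M_nonneg
    by (intro mult_left_mono) (auto simp: A_R)
  finally show ?thesis using c_pos by (simp add: field_simps)
qed

text \<open>
  \<open>R (T a r - T (a + h) r)\<close> is the integral of the orbit of \<open>r\<close> over \<open>[a, a + h]\<close>; this compares
  it with the rectangle rule, with an error given by the Taylor remainder of the orbit of
  \<open>R r\<close> at zero.
\<close>

lemma R_T_increment:
  assumes t: "0 \<le> a" "0 \<le> h" and e: "norm (T h (R r) - R r - h *\<^sub>R A (R r)) \<le> h * e"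
  shows "norm (h *\<^sub>R T a r - R (T a r - T (a + h) r)) \<le> M * (h * e)"
proof -
  have "h *\<^sub>R T a r - R (T a r - T (a + h) r) = T a (T h (R r) - R r - h *\<^sub>R A (R r))"
    using semigroup_add[OF t, of r]
    by (simp add: blinfun.diff_right blinfun.add_right blinfun.scaleR_right A_R T_R blinfun.minus_right)
  also have "norm \<dots> \<le> M * norm (T h (R r) - R r - h *\<^sub>R A (R r))" by (rule norm_semigroup)
  also have "\<dots> \<le> M * (h * e)" by (rule mult_left_mono[OF e M_nonneg])
  finally show ?thesis .
qed

lemma T_near_zero:
  assumes "0 < e"
  obtains d where "0 < d" "\<And>h. 0 \<le> h \<Longrightarrow> h \<le> d \<Longrightarrow> norm (T h x - x) \<le> e"
proof -
  obtain b where b: "0 < b" "\<And>h. 0 < h \<Longrightarrow> h < b \<Longrightarrow> dist (T h x) x < e"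
    using tendstoD[OF semigroup_tendsto_id assms, of x] unfolding eventually_at_right_field by auto
  show thesis
  proof (rule that[of "b / 2"])
    fix h assume "0 \<le> h" "h \<le> b / 2"
    then show "norm (T h x - x) \<le> e"
      using b assms by (cases "h = 0") (auto simp: semigroup_0 dist_norm intro!: less_imp_le)
  qed (use b in simp)
qed

text \<open>
  \<open>J\<close> is the bounded extension of \<open>- j \<circ> A\<close> from \<open>D\<close> to \<open>X\<close>. It is obtained as the strong limit of
  \<open>- j \<circ> A \<circ> E h\<close>, which is defined everywhere because \<open>E h\<close> maps into \<open>D\<close>. The lower bound makes
  its range closed, and the range contains the dense range of \<open>j\<close>.
\<close>

lemma exists_extension_isomorphism:
  fixes j :: "'x \<Rightarrow> 'y::banach"
  assumes j: "linear j" "closure (range j) = UNIV" and pos: "0 < c1"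
    and lower: "\<And>x. c1 * norm (R x) \<le> norm (j x)" and upper: "\<And>x. norm (j x) \<le> c2 * norm (R x)"
  obtains J :: "'x \<Rightarrow>\<^sub>L 'y" where "\<And>x. J (R x) = j x" "\<And>x. c1 * norm x \<le> norm (J x)" "surj (blinfun_apply J)"
proof -
  define L where "L = (\<lambda>k x. (2 ^ k) *\<^sub>R j (x - E (1 / 2 ^ k) x))"
  have L_eq: "L k x = j (- A (E (1 / 2 ^ k) x))" for k x
  proof -
    have "(2 ^ k) *\<^sub>R ((1 / 2 ^ k) *\<^sub>R A (E (1 / 2 ^ k) x)) = A (E (1 / 2 ^ k) x)" by simp
    also have "(1 / 2 ^ k) *\<^sub>R A (E (1 / 2 ^ k) x) = E (1 / 2 ^ k) x - x" by (rule A_E) simp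
    finally have "(2 ^ k) *\<^sub>R (x - E (1 / 2 ^ k) x) = - A (E (1 / 2 ^ k) x)"
      by (metis minus_diff_eq scaleR_minus_right)
    then show ?thesis unfolding L_def by (metis linear_scale[OF j(1)])
  qed
  have linL: "linear (L k)" for k
    using linear_E[of "1 / 2 ^ k"] j(1)
    by (intro linearI) (simp_all add: L_def linear_add linear_diff linear_scale algebra_simps)
  have boundL: "norm (L k x) \<le> (\<bar>c2\<bar> * M) * norm x" for k x
  proof -
    have "norm (L k x) \<le> c2 * norm (R (- A (E (1 / 2 ^ k) x)))" unfolding L_eq by (rule upper)
    also have "\<dots> = c2 * norm (E (1 / 2 ^ k) x)" by (simp add: blinfun.minus_right R_A range_E)
    also have "\<dots> \<le> \<bar>c2\<bar> * (M * norm x)" by (intro mult_mono norm_E) auto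
    finally show ?thesis by (simp add: mult.assoc)
  qed
  have contj: "(\<lambda>n. j (y n)) \<longlonglongrightarrow> j x" if y: "y \<longlonglongrightarrow> x" for y :: "nat \<Rightarrow> 'x" and x
  proof -
    have "(\<lambda>n. R (y n - x)) \<longlonglongrightarrow> R 0"
      using y by (intro blinfun.tendsto tendsto_const) (simp add: LIM_zero)
    then have "(\<lambda>n. c2 * norm (R (y n - x))) \<longlonglongrightarrow> c2 * norm (R 0)"
      by (intro tendsto_mult_left tendsto_norm)
    then have "(\<lambda>n. c2 * norm (R (y n - x))) \<longlonglongrightarrow> 0" by simp
    then have "(\<lambda>n. j (y n) - j x) \<longlonglongrightarrow> 0"
      by (rule Lim_null_comparison[rotated]) (use upper in \<open>simp flip: linear_diff[OF j(1)]\<close>)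
    then show ?thesis by (simp add: LIM_zero_iff)
  qed
  have limD: "(\<lambda>k. L k x) \<longlonglongrightarrow> j (- A x)" if x: "x \<in> D" for x
  proof -
    have "(\<lambda>k. - E (1 / 2 ^ k) (A x)) \<longlonglongrightarrow> - A x" by (intro tendsto_minus E_tendsto_id)
    then show ?thesis using contj x by (simp add: L_eq A_commute_E)
  qed
  have "convergent (\<lambda>k. L k x)" for x
    by (rule uniformly_bounded_convergent_on_dense[OF linL boundL dense]) (use limD convergentI in blast)
  from strong_limit_blinfun[OF linL boundL this] obtain J :: "'x \<Rightarrow>\<^sub>L 'y"
    where J: "\<And>x. (\<lambda>k. L k x) \<longlonglongrightarrow> J x" by blast
  have JD: "J x = j (- A x)" if "x \<in> D" for x using LIMSEQ_unique[OF J limD[OF that]] .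
  have JR: "J (R x) = j x" for x by (simp add: JD range_R A_R)
  have J_lower: "c1 * norm x \<le> norm (J x)" for x
  proof -
    have "closed {x. c1 * norm x \<le> norm (J x)}"
      by (intro closed_Collect_le continuous_intros)
    moreover have "D \<subseteq> {x. c1 * norm x \<le> norm (J x)}"
    proof clarsimp
      fix x assume "x \<in> D"
      then show "c1 * norm x \<le> norm (J x)" using lower[of "- A x"] by (simp add: JD R_A blinfun.minus_right)
    qed
    ultimately have "closure D \<subseteq> {x. c1 * norm x \<le> norm (J x)}" by (rule closure_minimal[rotated])
    then show ?thesis using dense by auto
  qed
  have "y \<in> range (blinfun_apply J)" for y
  proof -
    have "y \<in> closure (range j)" using j(2) by simp
    then obtain y' where y': "\<And>n. y' n \<in> range j" "y' \<longlonglongrightarrow> y" unfolding closure_sequential by auto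
    then have "\<forall>n. \<exists>z. y' n = j z" by auto
    from choice[OF this] obtain z where z: "\<And>n. y' n = j (z n)" by auto
    have "Cauchy (\<lambda>n. R (z n))"
    proof (rule metric_CauchyI)
      fix e :: real assume "0 < e"
      then have "0 < c1 * e" using pos by simp
      with metric_CauchyD[OF LIMSEQ_imp_Cauchy[OF y'(2)]]
      obtain N where N: "\<And>m n. N \<le> m \<Longrightarrow> N \<le> n \<Longrightarrow> dist (y' m) (y' n) < c1 * e" by blast
      have "dist (R (z m)) (R (z n)) < e" if "N \<le> m" "N \<le> n" for m n
      proof -
        have "c1 * norm (R (z m) - R (z n)) \<le> norm (J (R (z m) - R (z n)))" by (rule J_lower)
        also have "\<dots> = dist (y' m) (y' n)" by (simp add: blinfun.diff_right JR z dist_norm)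
        also have "\<dots> < c1 * e" by (rule N[OF that])
        finally show ?thesis using pos by (simp add: dist_norm)
      qed
      then show "\<exists>N. \<forall>m\<ge>N. \<forall>n\<ge>N. dist (R (z m)) (R (z n)) < e" by blast
    qed
    then obtain r where "(\<lambda>n. R (z n)) \<longlonglongrightarrow> r" by (auto simp: Cauchy_convergent_iff convergent_def)
    then have "(\<lambda>n. J (R (z n))) \<longlonglongrightarrow> J r" by (intro blinfun.tendsto tendsto_const)
    then have "y' \<longlonglongrightarrow> J r" by (simp add: JR flip: z)
    then show ?thesis using LIMSEQ_unique[OF y'(2)] by blast
  qed
  then have "surj (blinfun_apply J)" by auto
  then show thesis by (rule that[OF JR J_lower])
qed

end

section \<open>The input map on step functions\<close>

locale positive_input = positive_euler_scheme D A E M R c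
  for D :: "'x::banach_lattice set" and A E M R c +
  fixes r :: "'u::banach_lattice \<Rightarrow>\<^sub>L 'x"
  assumes r_cone: "0 \<le> v \<Longrightarrow> r v \<in> cone"
begin

text \<open>
  If \<open>u\<close> is the step function with values \<open>w k\<close>, this is the element \<open>x\<close> of \<open>X\<close> with
  \<open>R x = \<integral> T (1 - s) (r (u s)) ds\<close> over the unit interval: on the \<open>k\<close>-th cell \<open>1 - s\<close> runs through
  the interval between \<open>1 - (k + 1) / N\<close> and \<open>1 - k / N\<close>.
\<close>

definition step_input :: "nat \<Rightarrow> (nat \<Rightarrow> 'u) \<Rightarrow> 'x" where
  "step_input N w = (\<Sum>k<N. T (1 - real (Suc k) / real N) (r (w k)) - T (1 - real k / real N) (r (w k)))"

definition "gain = M * M / c * norm r"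

lemma gain_nonneg: "0 \<le> gain"
  using M_nonneg c_pos by (simp add: gain_def)

lemma step_input_refine:
  assumes N: "0 < N" and m: "0 < m"
  shows "step_input (N * m) (\<lambda>k. w (k div m)) = step_input N w"
proof -
  define g where "g = (\<lambda>i k. T (1 - real k / real (N * m)) (r (w i)))"
  have "step_input (N * m) (\<lambda>k. w (k div m)) = (\<Sum>k<N * m. g (k div m) (Suc k) - g (k div m) k)"
    by (simp add: step_input_def g_def)
  also have "\<dots> = (\<Sum>i<N. \<Sum>k\<in>{i * m..<i * m + m}. g (k div m) (Suc k) - g (k div m) k)"
    by (rule sum.nat_group[symmetric])
  also have "\<dots> = (\<Sum>i<N. \<Sum>k\<in>{i * m..<i * m + m}. g i (Suc k) - g i k)"
  proof (intro sum.cong refl)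
    fix i k assume "k \<in> {i * m..<i * m + m}"
    then have "k div m = i" using m by (intro div_nat_eqI) (auto simp: mult.commute)
    then show "g (k div m) (Suc k) - g (k div m) k = g i (Suc k) - g i k" by simp
  qed
  also have "\<dots> = (\<Sum>i<N. g i (i * m + m) - g i (i * m))"
    by (intro sum.cong refl sum_Suc_diff') simp
  also have "\<dots> = step_input N w"
    unfolding step_input_def
  proof (intro sum.cong refl)
    fix i
    have "real (i * m + m) / real (N * m) = real (Suc i) / real N" "real (i * m) / real (N * m) = real i / real N"
      using m nonzero_mult_divide_mult_cancel_right[of "real m" "real (Suc i)" "real N"]
      by (simp_all add: distrib_right add.commute)
    then show "g i (i * m + m) - g i (i * m) = T (1 - real (Suc i) / real N) (r (w i)) - T (1 - real i / real N) (r (w i))"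
      by (simp only: g_def)
  qed
  finally show ?thesis .
qed

lemma step_input_diff: "step_input N (\<lambda>k. v k - w k) = step_input N v - step_input N w"
  unfolding step_input_def sum_subtractf[symmetric]
  by (intro sum.cong refl) (simp add: blinfun.diff_right)

lemma mesh_point_bounds:
  assumes "k < N"
  shows "0 \<le> 1 - real (Suc k) / real N" "1 - real (Suc k) / real N \<le> 1 - real k / real N"
    "1 - real k / real N - (1 - real (Suc k) / real N) = 1 / real N"
proof -
  have "real (Suc k) / real N \<le> 1" using assms by (subst divide_le_eq_1) linarith
  then show "0 \<le> 1 - real (Suc k) / real N" by simp
  show "1 - real (Suc k) / real N \<le> 1 - real k / real N" by (simp add: divide_right_mono)
  show "1 - real k / real N - (1 - real (Suc k) / real N) = 1 / real N" by (simp add: add_divide_distrib)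
qed

lemma step_input_nonneg:
  assumes "\<And>k. 0 \<le> w k"
  shows "0 \<le> step_input N w"
  unfolding step_input_def
  using T_antimono_on_cone[OF r_cone[OF assms] mesh_point_bounds(1,2)]
  by (intro sum_nonneg) auto

lemma norm_step_input_pos:
  assumes "\<And>k. 0 \<le> w k"
  shows "norm (step_input N w) \<le> gain * (\<Sum>k<N. norm (w k) / real N)"
proof -
  have "norm (step_input N w) \<le> (\<Sum>k<N. gain * (norm (w k) / real N))"
    unfolding step_input_def
  proof (rule sum_norm_le)
    fix k assume "k \<in> {..<N}"
    then have k: "k < N" by simp
    have "norm (T (1 - real (Suc k) / real N) (r (w k)) - T (1 - real k / real N) (r (w k)))
        \<le> (1 - real k / real N - (1 - real (Suc k) / real N)) * (M * M / c * norm (r (w k)))"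
      by (rule T_lipschitz_on_cone[OF r_cone[OF assms] mesh_point_bounds(1,2)[OF k]])
    also have "\<dots> = 1 / real N * (M * M / c * norm (r (w k)))" by (simp only: mesh_point_bounds(3)[OF k])
    also have "\<dots> \<le> 1 / real N * (M * M / c * (norm r * norm (w k)))"
      using M_nonneg c_pos by (intro mult_left_mono norm_blinfun) auto
    finally show "norm (T (1 - real (Suc k) / real N) (r (w k)) - T (1 - real k / real N) (r (w k)))
        \<le> gain * (norm (w k) / real N)"
      by (simp add: gain_def mult_ac)
  qed
  then show ?thesis by (simp add: sum_distrib_left)
qed

text \<open>
  The bound for positive values extends to arbitrary values at the cost of a factor 2,
  because positive and negative parts are taken value by value and have no larger norm.
\<close>

lemma norm_step_input: "norm (step_input N w) \<le> 2 * gain * (\<Sum>k<N. norm (w k) / real N)"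
proof -
  have le: "norm (step_input N (\<lambda>k. pprt (f k))) \<le> gain * (\<Sum>k<N. norm (w k) / real N)"
    if "\<And>k. norm (f k) = norm (w k)" for f
  proof -
    have "norm (step_input N (\<lambda>k. pprt (f k))) \<le> gain * (\<Sum>k<N. norm (pprt (f k)) / real N)"
      by (rule norm_step_input_pos) simp
    also have "\<dots> \<le> gain * (\<Sum>k<N. norm (w k) / real N)"
      using norm_pprt_le[of "f _"] that gain_nonneg
      by (intro mult_left_mono sum_mono divide_right_mono) auto
    finally show ?thesis .
  qed
  have "step_input N w = step_input N (\<lambda>k. pprt (w k)) - step_input N (\<lambda>k. pprt (- w k))"
    using step_input_diff[of N "\<lambda>k. pprt (w k)" "\<lambda>k. pprt (- w k)"]
    by (simp only: pos_neg_decomp(1)[symmetric])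
  then have "norm (step_input N w) \<le> norm (step_input N (\<lambda>k. pprt (w k))) + norm (step_input N (\<lambda>k. pprt (- w k)))"
    by (simp add: norm_triangle_ineq4)
  then show ?thesis using le[of w] le[of "\<lambda>k. - w k"] by simp
qed

lemma step_input_distance:
  assumes N: "0 < N" and K: "0 < K"
  shows "ennreal (norm (step_input N v - step_input K w)) \<le>
    ennreal (2 * gain) * (\<integral>\<^sup>+s. ennreal (norm (v (mesh_index N s) - w (mesh_index K s))) \<partial>unit_interval)"
proof -
  \<comment> \<open>Both functions are rewritten over the common mesh with \<open>N * K\<close> cells.\<close>
  define z where "z = (\<lambda>k. v (k div K) - w (k div N))"
  have z: "z (mesh_index (N * K) s) = v (mesh_index N s) - w (mesh_index K s)" for s
    using mesh_index_refine[OF K, of N s] mesh_index_refine[OF N, of K s] by (simp add: z_def mult.commute)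
  have "step_input N v - step_input K w = step_input (N * K) z"
    using step_input_refine[OF N K, of v] step_input_refine[OF K N, of w]
    using step_input_diff[of "N * K" "\<lambda>k. v (k div K)" "\<lambda>k. w (k div N)"]
    by (simp only: z_def mult.commute[of K N])
  then have "ennreal (norm (step_input N v - step_input K w)) \<le> ennreal (2 * gain * (\<Sum>k<N * K. norm (z k) / real (N * K)))"
    using norm_step_input[of "N * K" z] by (simp add: ennreal_leI)
  also have "\<dots> = ennreal (2 * gain) * ennreal (\<Sum>k<N * K. norm (z k) / real (N * K))"
    using gain_nonneg by (intro ennreal_mult) (auto intro: sum_nonneg)
  also have "ennreal (\<Sum>k<N * K. norm (z k) / real (N * K)) =
      (\<integral>\<^sup>+s. ennreal (norm (z (mesh_index (N * K) s))) \<partial>unit_interval)"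
    using N K by (intro nn_integral_norm_step[symmetric]) simp
  finally show ?thesis by (simp add: z)
qed


text \<open>
  A step function takes finitely many values on the unit interval, so the strong continuity
  of \<open>T\<close> and the Taylor expansion at these values are uniform on a sufficiently fine
  refinement of its mesh. Neither the function nor its \<open>step_input\<close> changes under refinement.
\<close>

lemma fine_mesh:
  assumes N: "0 < N" and e: "0 < e"
  obtains K v where "0 < K" "\<And>s. v (mesh_index K s) = w (mesh_index N s)" "step_input K v = step_input N w"
    "\<And>k h. k < K \<Longrightarrow> 0 \<le> h \<Longrightarrow> h \<le> 1 / real K \<Longrightarrow> norm (T h (r (v k)) - r (v k)) \<le> e"
    "\<And>k. k < K \<Longrightarrow> norm (T (1 / real K) (R (r (v k))) - R (r (v k)) - (1 / real K) *\<^sub>R A (R (r (v k)))) \<le> 1 / real K * e"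
proof -
  have "\<exists>d>0. \<forall>h. 0 \<le> h \<longrightarrow> h \<le> d \<longrightarrow> norm (T h x - x) \<le> e \<and> norm (T h (R x) - R x - h *\<^sub>R A (R x)) \<le> h * e" for x
  proof -
    obtain d1 where d1: "0 < d1" "\<And>h. 0 \<le> h \<Longrightarrow> h \<le> d1 \<Longrightarrow> norm (T h x - x) \<le> e"
      using T_near_zero[OF e] by blast
    obtain d2 where d2: "0 < d2" "\<And>h. 0 \<le> h \<Longrightarrow> h \<le> d2 \<Longrightarrow> norm (T h (R x) - R x - h *\<^sub>R A (R x)) \<le> h * e"
      using semigroup_taylor[OF range_R e] by blast
    show ?thesis using d1 d2 by (intro exI[of _ "min d1 d2"]) auto
  qed
  then obtain d where d: "\<And>x. 0 < d x"
    "\<And>x h. 0 \<le> h \<Longrightarrow> h \<le> d x \<Longrightarrow> norm (T h x - x) \<le> e"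
    "\<And>x h. 0 \<le> h \<Longrightarrow> h \<le> d x \<Longrightarrow> norm (T h (R x) - R x - h *\<^sub>R A (R x)) \<le> h * e"
    by metis
  define \<delta> where "\<delta> = Min ((\<lambda>i. d (r (w i))) ` {..<N})"
  have ne: "{..<N} \<noteq> {}" using N by auto
  have \<delta>: "0 < \<delta>" "\<And>i. i < N \<Longrightarrow> \<delta> \<le> d (r (w i))"
    using d(1) ne by (auto simp: \<delta>_def)
  obtain m :: nat where m: "1 / \<delta> < real m" using reals_Archimedean2 by blast
  have "0 < 1 / \<delta>" using \<delta>(1) by simp
  then have m0: "0 < m" using m by linarith
  define K where "K = N * m"
  have K: "0 < K" using N m0 by (simp add: K_def)
  have "m \<le> K" using N by (simp add: K_def)
  then have "real m \<le> real K" by simp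
  then have "1 / \<delta> \<le> real K" using m by linarith
  then have small: "1 / real K \<le> \<delta>" using \<delta>(1) K by (simp add: field_simps)
  have div: "k div m < N" if "k < K" for k using that m0 by (simp add: K_def less_mult_imp_div_less)
  show thesis
  proof (rule that[of K "\<lambda>k. w (k div m)"])
    show "w (mesh_index K s div m) = w (mesh_index N s)" for s
      using mesh_index_refine[OF m0, of N s] by (simp add: K_def)
    show "step_input K (\<lambda>k. w (k div m)) = step_input N w"
      unfolding K_def by (rule step_input_refine[OF N m0])
    show "norm (T h (r (w (k div m))) - r (w (k div m))) \<le> e" if "k < K" "0 \<le> h" "h \<le> 1 / real K" for k h
      using d(2)[OF that(2)] \<delta>(2)[OF div[OF that(1)]] that(3) small by auto
    show "norm (T (1 / real K) (R (r (w (k div m)))) - R (r (w (k div m))) - (1 / real K) *\<^sub>R A (R (r (w (k div m))))) \<le> 1 / real K * e"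
      if "k < K" for k
      using \<delta>(2)[OF div[OF that]] small by (intro d(3)) auto
  qed (rule K)
qed

lemma AE_unit_interval_less_1: "AE s in unit_interval. 0 \<le> s \<and> s < 1"
proof -
  have "{1} \<in> null_sets (lebesgue :: real measure)" by (simp add: null_sets_def)
  then have "AE s in lebesgue. s \<notin> {1::real}" by (rule AE_not_in)
  then show ?thesis by (subst AE_restrict_space_iff) (auto elim!: eventually_mono)
qed

lemma mesh_point_time:
  assumes N: "0 < N" and s: "0 \<le> s" "s < 1"
  obtains h where "mesh_index N s < N" "0 \<le> h" "h \<le> 1 / real N"
    "0 \<le> 1 - real (Suc (mesh_index N s)) / real N" "1 - s = (1 - real (Suc (mesh_index N s)) / real N) + h"
proof -
  define k where "k = mesh_index N s"
  have k: "real k / real N \<le> s" "s < real (Suc k) / real N"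
    using mesh_index_iff[OF N s(1), of k] by (auto simp: k_def)
  have "real k / real N < 1" using k(1) s(2) by linarith
  then have kN: "k < N" using N by simp
  show thesis
  proof (rule that[of "real (Suc k) / real N - s"])
    show "real (Suc k) / real N - s \<le> 1 / real N" using k(1) by (simp add: add_divide_distrib)
  qed (use k kN mesh_point_bounds(1)[OF kN] in \<open>auto simp: k_def\<close>)
qed

lemma strongly_measurable_orbit:
  fixes J :: "'x \<Rightarrow>\<^sub>L 'y::banach"
  assumes u: "strongly_measurable unit_interval u"
  shows "strongly_measurable unit_interval (\<lambda>s. J (T (1 - s) (r (u s))))"
proof -
  obtain v where v: "\<And>i. simple_function unit_interval (v i)" "AE s in unit_interval. (\<lambda>i. v i s) \<longlonglongrightarrow> u s"
    using u by (auto simp: strongly_measurable_def)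
  \<comment> \<open>Time is rounded down to a mesh point, so that the rounding error is a nonnegative time and
    continuity of \<open>T\<close> at zero from the right suffices.\<close>
  define a where "a = (\<lambda>i s. 1 - real (Suc (mesh_index (Suc i) s)) / real (Suc i))"
  define F where "F = (\<lambda>i s. J (T (a i s) (r (v i s))))"
  have "simple_function unit_interval (F i)" for i
    unfolding F_def a_def
    by (rule simple_function_compose2[OF simple_mesh_index v(1), of "\<lambda>k x. J (T (1 - real (Suc k) / real (Suc i)) (r x))" "Suc i" i])
  moreover have "AE s in unit_interval. (\<lambda>i. F i s) \<longlonglongrightarrow> J (T (1 - s) (r (u s)))"
    using v(2) AE_unit_interval_less_1
  proof eventually_elim
    case (elim s)
    then have s: "0 \<le> s" "s < 1" by auto
    define x where "x = r (u s)"
    have rv: "(\<lambda>i. r (v i s)) \<longlonglongrightarrow> x" unfolding x_def by (intro blinfun.tendsto tendsto_const elim)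
    have "(\<lambda>i. T (a i s) (r (v i s))) \<longlonglongrightarrow> T (1 - s) x"
    proof (rule LIMSEQ_I)
      fix e :: real assume e: "0 < e"
      define e' where "e' = e / 3 / (M + 1)"
      have e': "0 < e'" "M * e' + M * e' < e"
      proof -
        show "0 < e'" using e M_nonneg by (simp add: e'_def)
        have "M * e' \<le> (M + 1) * e'" using \<open>0 < e'\<close> by simp
        also have "(M + 1) * e' = e / 3"
          using iffD1[OF nonzero_eq_divide_eq e'_def] M_nonneg by (simp add: mult.commute)
        finally show "M * e' + M * e' < e" using e by simp
      qed
      obtain d where d: "0 < d" "\<And>h. 0 \<le> h \<Longrightarrow> h \<le> d \<Longrightarrow> norm (T h x - x) \<le> e'"
        using T_near_zero[OF e'(1)] by blast
      obtain n1 where n1: "\<And>i. n1 \<le> i \<Longrightarrow> norm (r (v i s) - x) < e'"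
        using LIMSEQ_D[OF rv e'(1)] by blast
      obtain n2 :: nat where n2: "1 / d < real n2" using reals_Archimedean2 by blast
      have "norm (T (a i s) (r (v i s)) - T (1 - s) x) < e" if i: "max n1 n2 \<le> i" for i
      proof -
        obtain h where h: "0 \<le> h" "h \<le> 1 / real (Suc i)" "0 \<le> a i s" "1 - s = a i s + h"
          using mesh_point_time[of "Suc i", OF _ s] unfolding a_def by blast
        have "1 / d < real (Suc i)" using n2 i by linarith
        then have "1 / real (Suc i) \<le> d" using d(1) by (simp add: field_simps)
        then have hd: "h \<le> d" using h(2) by linarith
        have "T (a i s) (r (v i s)) - T (1 - s) x = T (a i s) (r (v i s) - x) - T (a i s) (T h x - x)"
          using semigroup_add[OF h(3,1), of x] by (simp add: h(4) blinfun.diff_right)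
        then have "norm (T (a i s) (r (v i s)) - T (1 - s) x) \<le> norm (T (a i s) (r (v i s) - x)) + norm (T (a i s) (T h x - x))"
          by (simp add: norm_triangle_ineq4)
        also have "\<dots> \<le> M * norm (r (v i s) - x) + M * norm (T h x - x)"
          by (intro add_mono norm_semigroup)
        also have "\<dots> \<le> M * e' + M * e'"
          using n1[of i] i d(2)[OF h(1) hd] M_nonneg by (intro add_mono mult_left_mono) auto
        finally show ?thesis using e'(2) by linarith
      qed
      then show "\<exists>n. \<forall>i\<ge>n. norm (T (a i s) (r (v i s)) - T (1 - s) x) < e" by blast
    qed
    then show ?case unfolding F_def x_def by (rule blinfun.tendsto[OF tendsto_const])
  qed
  ultimately show ?thesis unfolding strongly_measurable_def by (intro exI[of _ F]) auto
qed

text \<open>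
  Both approximations in the definition of the integral come from one simple function \<open>G\<close>: the
  orbit with \<open>u\<close> replaced by the step function and time sampled at the mesh points. It is
  close to the integrand in \<open>L\<^sup>1\<close> by strong continuity, and its integral is a rectangle rule
  for \<open>J (R (step_input N w))\<close>.
\<close>

lemma sampled_orbit_approximation:
  fixes J :: "'x \<Rightarrow>\<^sub>L 'y::banach"
  assumes u: "strongly_measurable unit_interval u" and N: "0 < N" and e: "0 < e"
  obtains G where "Bochner_Integration.simple_bochner_integrable unit_interval G"
    "(\<integral>\<^sup>+s. ennreal (norm (J (T (1 - s) (r (u s))) - G s)) \<partial>unit_interval) \<le>
      ennreal (norm J * M * norm r) * (\<integral>\<^sup>+s. ennreal (norm (u s - w (mesh_index N s))) \<partial>unit_interval) + ennreal (norm J * M * e)"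
    "norm (Bochner_Integration.simple_bochner_integral unit_interval G - J (R (step_input N w))) \<le> norm J * M * e"
proof -
  obtain K v where K: "0 < K" and v: "\<And>s. v (mesh_index K s) = w (mesh_index N s)" "step_input K v = step_input N w"
    and near: "\<And>k h. k < K \<Longrightarrow> 0 \<le> h \<Longrightarrow> h \<le> 1 / real K \<Longrightarrow> norm (T h (r (v k)) - r (v k)) \<le> e"
    and taylor: "\<And>k. k < K \<Longrightarrow> norm (T (1 / real K) (R (r (v k))) - R (r (v k)) - (1 / real K) *\<^sub>R A (R (r (v k)))) \<le> 1 / real K * e"
    by (rule fine_mesh[OF N e, of w]) blast
  define g where "g = (\<lambda>k. J (T (1 - real (Suc k) / real K) (r (v k))))"
  define G where "G = (\<lambda>s. g (mesh_index K s))"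
  have "(\<integral>\<^sup>+s. ennreal (norm (J (T (1 - s) (r (u s))) - G s)) \<partial>unit_interval) \<le>
      ennreal (norm J * M * norm r) * (\<integral>\<^sup>+s. ennreal (norm (u s - w (mesh_index N s))) \<partial>unit_interval)
      + ennreal (norm J * M) * (\<integral>\<^sup>+s. ennreal (norm e) \<partial>unit_interval)"
  proof (rule nn_integral_norm_le)
    show "AE s in unit_interval. norm (J (T (1 - s) (r (u s))) - G s) \<le>
        norm J * M * norm r * norm (u s - w (mesh_index N s)) + norm J * M * norm e"
      using AE_unit_interval_less_1
    proof eventually_elim
      case (elim s)
      define k where "k = mesh_index K s"
      define a where "a = 1 - real (Suc k) / real K"
      obtain h where h: "k < K" "0 \<le> h" "h \<le> 1 / real K" "0 \<le> a" "1 - s = a + h"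
        using mesh_point_time[OF K, of s] elim unfolding a_def k_def by blast
      have "G s = J (T a (r (v k)))" by (simp only: G_def g_def a_def k_def)
      then have "J (T (1 - s) (r (u s))) - G s = J (T (1 - s) (r (u s - v k)) + T a (T h (r (v k)) - r (v k)))"
        using semigroup_add[OF h(4,2), of "r (v k)"]
        by (simp add: h(5) blinfun.diff_right blinfun.add_right)
      also have "norm \<dots> \<le> norm J * norm (T (1 - s) (r (u s - v k)) + T a (T h (r (v k)) - r (v k)))"
        by (rule norm_blinfun)
      also have "\<dots> \<le> norm J * (M * (norm r * norm (u s - v k)) + M * e)"
      proof (intro mult_left_mono norm_triangle_le add_mono)
        have "norm (T (1 - s) (r (u s - v k))) \<le> M * norm (r (u s - v k))" by (rule norm_semigroup)
        also have "\<dots> \<le> M * (norm r * norm (u s - v k))" by (intro mult_left_mono norm_blinfun M_nonneg)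
        finally show "norm (T (1 - s) (r (u s - v k))) \<le> M * (norm r * norm (u s - v k))" .
        have "norm (T a (T h (r (v k)) - r (v k))) \<le> M * norm (T h (r (v k)) - r (v k))" by (rule norm_semigroup)
        also have "\<dots> \<le> M * e" by (intro mult_left_mono near h M_nonneg)
        finally show "norm (T a (T h (r (v k)) - r (v k))) \<le> M * e" .
      qed simp
      finally show ?case using e by (simp add: k_def v distrib_left mult.assoc)
    qed
    show "strongly_measurable unit_interval (\<lambda>s. u s - w (mesh_index N s))"
      by (rule strongly_measurable_diff[OF u strongly_measurable_step])
    show "strongly_measurable unit_interval (\<lambda>s::real. e)"
      by (rule strongly_measurable_simple) simp
  qed (use M_nonneg in auto)
  also have "(\<integral>\<^sup>+s. ennreal (norm e) \<partial>unit_interval) = ennreal e"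
    using e by (simp add: emeasure_unit_interval)
  also have "ennreal (norm J * M) * ennreal e = ennreal (norm J * M * e)"
    using e M_nonneg by (simp add: ennreal_mult)
  finally have 1: "(\<integral>\<^sup>+s. ennreal (norm (J (T (1 - s) (r (u s))) - G s)) \<partial>unit_interval) \<le>
      ennreal (norm J * M * norm r) * (\<integral>\<^sup>+s. ennreal (norm (u s - w (mesh_index N s))) \<partial>unit_interval) + ennreal (norm J * M * e)" .
  have "Bochner_Integration.simple_bochner_integral unit_interval G = (\<Sum>k<K. (1 / real K) *\<^sub>R g k)"
    unfolding G_def by (rule integral_step[OF K])
  then have diff: "Bochner_Integration.simple_bochner_integral unit_interval G - J (R (step_input K v)) =
     (\<Sum>k<K. J ((1 / real K) *\<^sub>R T (1 - real (Suc k) / real K) (r (v k)) - R (T (1 - real (Suc k) / real K) (r (v k)) - T (1 - real k / real K) (r (v k)))))"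
    by (simp add: step_input_def g_def blinfun.sum_right blinfun.diff_right blinfun.scaleR_right sum_subtractf)
  have "norm (Bochner_Integration.simple_bochner_integral unit_interval G - J (R (step_input K v))) \<le>
      (\<Sum>k<K. norm J * (M * (1 / real K * e)))"
    unfolding diff
  proof (rule sum_norm_le)
    fix k assume "k \<in> {..<K}"
    then have k: "k < K" by simp
    have eq: "1 - real k / real K = (1 - real (Suc k) / real K) + 1 / real K" by (simp add: add_divide_distrib)
    have "norm ((1 / real K) *\<^sub>R T (1 - real (Suc k) / real K) (r (v k)) - R (T (1 - real (Suc k) / real K) (r (v k)) - T (1 - real k / real K) (r (v k)))) \<le> M * (1 / real K * e)"
      unfolding eq by (intro R_T_increment mesh_point_bounds k taylor) simp
    then show "norm (J ((1 / real K) *\<^sub>R T (1 - real (Suc k) / real K) (r (v k)) - R (T (1 - real (Suc k) / real K) (r (v k)) - T (1 - real k / real K) (r (v k)))))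
       \<le> norm J * (M * (1 / real K * e))"
      by (meson norm_blinfun mult_left_mono norm_ge_zero order.trans)
  qed
  also have "\<dots> = norm J * M * e" using K by simp
  finally have 2: "norm (Bochner_Integration.simple_bochner_integral unit_interval G - J (R (step_input N w))) \<le> norm J * M * e"
    by (simp add: v)
  have "Bochner_Integration.simple_bochner_integrable unit_interval G"
    unfolding G_def by (rule integrable_step)
  then show thesis using 1 2 by (rule that)
qed

lemma step_inputs_converge:
  fixes u :: "real \<Rightarrow> 'u" and N :: "nat \<Rightarrow> nat" and w :: "nat \<Rightarrow> nat \<Rightarrow> 'u"
  assumes u: "strongly_measurable unit_interval u" and N: "\<And>i. 0 < N i"
    and approx: "\<And>i. (\<integral>\<^sup>+s. ennreal (norm (u s - w i (mesh_index (N i) s))) \<partial>unit_interval) < ennreal (1 / real (Suc i))"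
  shows "convergent (\<lambda>i. step_input (N i) (w i))"
proof -
  have dist: "norm (step_input (N i) (w i) - step_input (N k) (w k)) \<le> 2 * gain * (1 / real (Suc i) + 1 / real (Suc k))" for i k
  proof -
    have tri: "(\<integral>\<^sup>+s. ennreal (norm (w i (mesh_index (N i) s) - w k (mesh_index (N k) s))) \<partial>unit_interval) \<le>
        (\<integral>\<^sup>+s. ennreal (norm (w i (mesh_index (N i) s) - u s)) \<partial>unit_interval) +
        (\<integral>\<^sup>+s. ennreal (norm (u s - w k (mesh_index (N k) s))) \<partial>unit_interval)"
      by (rule nn_integral_norm_triangle[OF strongly_measurable_step[of "w i"] u strongly_measurable_step[of "w k"]])
    also have "\<dots> \<le> ennreal (1 / real (Suc i)) + ennreal (1 / real (Suc k))"
    proof (rule add_mono)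
      show "(\<integral>\<^sup>+s. ennreal (norm (w i (mesh_index (N i) s) - u s)) \<partial>unit_interval) \<le> ennreal (1 / real (Suc i))"
        unfolding norm_minus_commute[of "w i _"] by (rule less_imp_le[OF approx])
      show "(\<integral>\<^sup>+s. ennreal (norm (u s - w k (mesh_index (N k) s))) \<partial>unit_interval) \<le> ennreal (1 / real (Suc k))"
        by (rule less_imp_le[OF approx])
    qed
    also have "\<dots> = ennreal (1 / real (Suc i) + 1 / real (Suc k))"
      by (rule ennreal_plus[symmetric]) auto
    finally have "ennreal (norm (step_input (N i) (w i) - step_input (N k) (w k))) \<le>
        ennreal (2 * gain) * ennreal (1 / real (Suc i) + 1 / real (Suc k))"
      by (rule order.trans[OF step_input_distance[OF N[of i] N[of k], of "w i" "w k"] mult_left_mono]) simp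
    also have "\<dots> = ennreal (2 * gain * (1 / real (Suc i) + 1 / real (Suc k)))"
      using gain_nonneg by (intro ennreal_mult[symmetric]) auto
    finally show ?thesis
      by (rule iffD1[OF ennreal_le_iff, rotated]) (use gain_nonneg in auto)
  qed
  have "Cauchy (\<lambda>i. step_input (N i) (w i))"
  proof (rule metric_CauchyI)
    fix e :: real assume e: "0 < e"
    have lim: "(\<lambda>i. 2 * gain * (1 / real (Suc i))) \<longlonglongrightarrow> 2 * gain * 0"
      by (intro tendsto_mult_left LIMSEQ_Suc[OF lim_1_over_n])
    then obtain n where n: "\<And>i. n \<le> i \<Longrightarrow> 2 * gain * (1 / real (Suc i)) < e / 2"
      using order_tendstoD(2)[OF lim, of "e / 2"] e by (auto simp: eventually_sequentially)
    have "dist (step_input (N i) (w i)) (step_input (N k) (w k)) < e" if "n \<le> i" "n \<le> k" for i k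
      using dist[of i k] n[OF that(1)] n[OF that(2)] by (simp add: dist_norm distrib_left)
    then show "\<exists>n. \<forall>i\<ge>n. \<forall>k\<ge>n. dist (step_input (N i) (w i)) (step_input (N k) (w k)) < e" by blast
  qed
  then show ?thesis by (simp add: Cauchy_convergent_iff)
qed

text \<open>
  The elements represented by positive step functions converging to \<open>u\<close> form a Cauchy sequence
  in \<open>X\<close>; this is where positivity enters, since without the cone condition on \<open>r\<close> only
  convergence after applying \<open>R\<close> would be available.
\<close>

theorem positive_input_integral:
  fixes J :: "'x \<Rightarrow>\<^sub>L 'y::banach"
  assumes u: "strongly_measurable unit_interval u"
    and fin: "(\<integral>\<^sup>+s. ennreal (norm (u s)) \<partial>unit_interval) < \<infinity>"
    and pos: "AE s in unit_interval. 0 \<le> u s"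
  shows "\<exists>x\<ge>0. has_strong_bochner_integral unit_interval (\<lambda>s. J (T (1 - s) (r (u s)))) (J (R x))"
proof -
  have e: "0 < 1 / real (Suc i)" for i by simp
  define P where "P = (\<lambda>i N w. 0 < N \<and> (\<forall>k. 0 \<le> w k) \<and>
      (\<integral>\<^sup>+s. ennreal (norm (u s - w (mesh_index N s))) \<partial>unit_interval) < ennreal (1 / real (Suc i)))"
  have "\<exists>N w. P i N w" for i
    unfolding P_def by (rule positive_step_approximation[OF u fin pos e[of i]]) blast
  then obtain N w where NW: "\<And>i. P i (N i) (w i)" by metis
  have N: "0 < N i" and w: "0 \<le> w i k"
    and approx: "(\<integral>\<^sup>+s. ennreal (norm (u s - w i (mesh_index (N i) s))) \<partial>unit_interval) < ennreal (1 / real (Suc i))" for i k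
    using NW[of i] unfolding P_def by auto
  obtain x where x: "(\<lambda>i. step_input (N i) (w i)) \<longlonglongrightarrow> x"
    using step_inputs_converge[OF u N approx] by (auto simp: convergent_def)
  have x_pos: "0 \<le> x" using tendsto_nonneg[OF x] step_input_nonneg[OF w] by simp
  define Q where "Q = (\<lambda>i G. Bochner_Integration.simple_bochner_integrable unit_interval G \<and>
    (\<integral>\<^sup>+s. ennreal (norm (J (T (1 - s) (r (u s))) - G s)) \<partial>unit_interval) \<le>
      ennreal (norm J * M * norm r) * (\<integral>\<^sup>+s. ennreal (norm (u s - w i (mesh_index (N i) s))) \<partial>unit_interval) + ennreal (norm J * M * (1 / real (Suc i))) \<and>
    norm (Bochner_Integration.simple_bochner_integral unit_interval G - J (R (step_input (N i) (w i)))) \<le> norm J * M * (1 / real (Suc i)))"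
  have "\<exists>G. Q i G" for i
  proof (rule sampled_orbit_approximation[OF u N[of i] e[of i], of J "w i"])
    fix G :: "real \<Rightarrow> 'y"
    assume "Bochner_Integration.simple_bochner_integrable unit_interval G"
      "(\<integral>\<^sup>+s. ennreal (norm (J (T (1 - s) (r (u s))) - G s)) \<partial>unit_interval) \<le>
        ennreal (norm J * M * norm r) * (\<integral>\<^sup>+s. ennreal (norm (u s - w i (mesh_index (N i) s))) \<partial>unit_interval) + ennreal (norm J * M * (1 / real (Suc i)))"
      "norm (Bochner_Integration.simple_bochner_integral unit_interval G - J (R (step_input (N i) (w i)))) \<le> norm J * M * (1 / real (Suc i))"
    then have "Q i G" unfolding Q_def by (intro conjI)
    then show ?thesis by (rule exI[of "Q i" G])
  qed
  then obtain G where QG: "\<And>i. Q i (G i)" by metis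
  note G = QG[unfolded Q_def, THEN conjunct1]
    and G1 = QG[unfolded Q_def, THEN conjunct2, THEN conjunct1]
    and G2 = QG[unfolded Q_def, THEN conjunct2, THEN conjunct2]
  have null: "(\<lambda>i. a * (1 / real (Suc i))) \<longlonglongrightarrow> 0" for a :: real
    using tendsto_mult_left[OF LIMSEQ_Suc[OF lim_1_over_n], of a] by simp
  have "(\<lambda>i. \<integral>\<^sup>+s. ennreal (norm (J (T (1 - s) (r (u s))) - G i s)) \<partial>unit_interval) \<longlonglongrightarrow> 0"
  proof (rule tendsto_sandwich[OF _ _ tendsto_const])
    show "\<forall>\<^sub>F i in sequentially. 0 \<le> (\<integral>\<^sup>+s. ennreal (norm (J (T (1 - s) (r (u s))) - G i s)) \<partial>unit_interval)" by simp
    show "\<forall>\<^sub>F i in sequentially. (\<integral>\<^sup>+s. ennreal (norm (J (T (1 - s) (r (u s))) - G i s)) \<partial>unit_interval) \<le>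
        ennreal ((norm J * M * norm r + norm J * M) * (1 / real (Suc i)))"
    proof (intro always_eventually allI)
      fix i
      have "(\<integral>\<^sup>+s. ennreal (norm (J (T (1 - s) (r (u s))) - G i s)) \<partial>unit_interval) \<le>
          ennreal (norm J * M * norm r) * ennreal (1 / real (Suc i)) + ennreal (norm J * M * (1 / real (Suc i)))"
        using approx[of i] by (intro order.trans[OF G1] add_mono mult_left_mono) auto
      also have "\<dots> = ennreal ((norm J * M * norm r + norm J * M) * (1 / real (Suc i)))"
        using M_nonneg by (simp add: distrib_right add_divide_distrib flip: ennreal_mult ennreal_plus)
      finally show "(\<integral>\<^sup>+s. ennreal (norm (J (T (1 - s) (r (u s))) - G i s)) \<partial>unit_interval) \<le>
          ennreal ((norm J * M * norm r + norm J * M) * (1 / real (Suc i)))" .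
    qed
    show "(\<lambda>i. ennreal ((norm J * M * norm r + norm J * M) * (1 / real (Suc i)))) \<longlonglongrightarrow> 0"
      using tendsto_ennrealI[OF null] by simp
  qed
  moreover have "(\<lambda>i. Bochner_Integration.simple_bochner_integral unit_interval (G i)) \<longlonglongrightarrow> J (R x)"
  proof -
    have "(\<lambda>i. Bochner_Integration.simple_bochner_integral unit_interval (G i) - J (R (step_input (N i) (w i)))) \<longlonglongrightarrow> 0"
      by (rule Lim_null_comparison[OF always_eventually null[of "norm J * M"]]) (use G2 in blast)
    moreover have "(\<lambda>i. J (R (step_input (N i) (w i)))) \<longlonglongrightarrow> J (R x)"
      by (intro blinfun.tendsto tendsto_const x)
    from tendsto_add[OF calculation this] show ?thesis by simp
  qed
  ultimately have "has_strong_bochner_integral unit_interval (\<lambda>s. J (T (1 - s) (r (u s)))) (J (R x))"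
    unfolding has_strong_bochner_integral_def
    by (intro conjI exI[of _ G] allI strongly_measurable_orbit u G)
  then show ?thesis using x_pos by blast
qed

end

section \<open>From the resolvent to the scheme\<close>

text \<open>
  Stability on the cone comes from \<open>R \<mu> (E h x) = E h (R \<mu> x) \<le> R \<mu> x\<close>: the vector
  \<open>R \<mu> ((E h)^n x)\<close> never exceeds \<open>R \<mu> x\<close>, and the lower bound returns this to a bound on
  \<open>(E h)^n x\<close> itself. General vectors are split into positive and negative parts.
\<close>

lemma (in positive_resolvent_family) shifted_euler_scheme:
  assumes dense: "closure D = UNIV" and c: "0 < c"
    and pos: "\<And>l x. \<mu> \<le> l \<Longrightarrow> 0 \<le> x \<Longrightarrow> 0 \<le> R l x"
    and lower: "\<And>x. 0 \<le> x \<Longrightarrow> c * norm x \<le> norm (R \<mu> x)"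
  obtains M where "positive_euler_scheme D (\<lambda>x. A x - \<mu> *\<^sub>R x) (\<lambda>h x. (1 / h) *\<^sub>R R (\<mu> + 1 / h) x) M (Blinfun (R \<mu>)) c"
proof -
  define A' where "A' = (\<lambda>x. A x - \<mu> *\<^sub>R x)"
  define E where "E = (\<lambda>h x. (1 / h) *\<^sub>R R (\<mu> + 1 / h) x)"
  obtain K where K: "0 \<le> K" "\<And>x. norm (R \<mu> x) \<le> norm x * K"
    using bounded_linear.nonneg_bounded[OF bounded[OF order.refl]] by blast
  define M where "M = 2 * (K / c)"
  have le: "\<mu> \<le> \<mu> + 1 / h" if "0 < h" for h using that by simp
  have R\<mu>: "blinfun_apply (Blinfun (R \<mu>)) = R \<mu>"
    by (rule bounded_linear_Blinfun_apply[OF bounded[OF order.refl]])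
  have linear_E: "linear (E h)" if "0 < h" for h
    using linear_R[OF le[OF that]]
    by (intro linearI) (simp_all add: E_def linear_add linear_scale scaleR_add_right)
  have E_pos: "0 \<le> E h x" if "0 < h" "0 \<le> x" for h x
    using that pos[OF le[OF that(1)] that(2)] by (simp add: E_def scaleR_nonneg_nonneg)
  have E_R: "E h (R \<mu> x) = R \<mu> (E h x)" if "0 < h" for h x
    using R_commute[OF le[OF that] order.refl, of x] linear_R[OF order.refl]
    by (simp add: E_def linear_scale)
  have E_R_eq: "E h (R \<mu> x) = R \<mu> x - R (\<mu> + 1 / h) x" if "0 < h" for h x
    using resolvent_identity[OF le[OF that] order.refl, of x] by (simp add: E_def algebra_simps)
  have E_R_le: "E h (R \<mu> x) \<le> R \<mu> x" if "0 < h" "0 \<le> x" for h x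
    using pos[OF le[OF that(1)] that(2)] by (simp add: E_R_eq[OF that(1)])
  have stable_pos: "norm ((E h ^^ n) x) \<le> K / c * norm x" if h: "0 < h" and x: "0 \<le> x" for h n x
  proof -
    have "0 \<le> (E h ^^ n) x \<and> R \<mu> ((E h ^^ n) x) \<le> R \<mu> x"
    proof (induction n)
      case (Suc n)
      then have IH: "0 \<le> (E h ^^ n) x" "R \<mu> ((E h ^^ n) x) \<le> R \<mu> x" by auto
      have "R \<mu> ((E h ^^ Suc n) x) = E h (R \<mu> ((E h ^^ n) x))" by (simp add: E_R[OF h])
      also have "\<dots> \<le> R \<mu> ((E h ^^ n) x)" by (rule E_R_le[OF h IH(1)])
      also note IH(2)
      finally show ?case using E_pos[OF h IH(1)] by simp
    qed (use x in simp)
    then have iter: "0 \<le> (E h ^^ n) x" "R \<mu> ((E h ^^ n) x) \<le> R \<mu> x" by auto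
    have "c * norm ((E h ^^ n) x) \<le> norm (R \<mu> ((E h ^^ n) x))" by (rule lower[OF iter(1)])
    also have "\<dots> \<le> norm (R \<mu> x)" using iter pos by (intro norm_mono_pos) auto
    also have "\<dots> \<le> norm x * K" by (rule K)
    finally show ?thesis using c by (simp add: field_simps)
  qed
  have stable: "norm ((E h ^^ n) x) \<le> M * norm x" if h: "0 < h" for h n x
  proof -
    have "(E h ^^ n) x = (E h ^^ n) (pprt x) - (E h ^^ n) (pprt (- x))"
      by (metis pos_neg_decomp(1) linear_diff[OF linear_funpow[OF linear_E[OF h]]])
    then have "norm ((E h ^^ n) x) \<le> norm ((E h ^^ n) (pprt x)) + norm ((E h ^^ n) (pprt (- x)))"
      by (metis norm_triangle_ineq4)
    also have "\<dots> \<le> K / c * norm (pprt x) + K / c * norm (pprt (- x))"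
      by (intro add_mono stable_pos h) auto
    also have "\<dots> \<le> K / c * norm x + K / c * norm x"
      using K c by (intro add_mono mult_left_mono norm_pprt_le pos_neg_decomp(2)) auto
    finally show ?thesis by (simp add: M_def)
  qed
  have op': "linear_operator D A'"
    using op by (auto simp: linear_operator_def A'_def algebra_simps)
  have A'_E: "h *\<^sub>R A' (E h x) = E h x - x" if h: "0 < h" for h x
  proof -
    define y where "y = R (\<mu> + 1 / h) x"
    have "A (E h x) = (1 / h) *\<^sub>R (\<mu> *\<^sub>R y + (1 / h) *\<^sub>R y - x)"
      unfolding E_def A_scaleR[OF range_R[OF le[OF h]]] A_R[OF le[OF h]] y_def scaleR_add_left ..
    then have "A' (E h x) = (1 / h) *\<^sub>R ((1 / h) *\<^sub>R y - x)"
      unfolding A'_def E_def y_def[symmetric]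
      by (simp add: scaleR_diff_right scaleR_add_right mult.commute)
    then show ?thesis using h by (simp add: E_def y_def)
  qed
  have "positive_euler_scheme D A' E M (Blinfun (R \<mu>)) c"
  proof (intro positive_euler_scheme.intro euler_scheme.intro positive_euler_scheme_axioms.intro, unfold R\<mu>)
    show "linear_operator D A'" by (rule op')
    show "closure D = UNIV" by (rule dense)
    show "0 \<le> M" using K c by (simp add: M_def)
    show "0 < c" by (rule c)
    fix h :: real and x
    show "R \<mu> x \<in> D" by (simp add: range_R)
    show "A' (R \<mu> x) = - x" using A_R[of \<mu> x] by (simp add: A'_def)
    show "R \<mu> (A' x) = - x" if "x \<in> D"
    proof -
      have "R \<mu> (A' x) = - R \<mu> (\<mu> *\<^sub>R x - A x)"
        using linear_neg[OF linear_R[OF order.refl], of "\<mu> *\<^sub>R x - A x"] by (simp add: A'_def)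
      then show ?thesis using R_left[OF order.refl that] by simp
    qed
    show "c * norm x \<le> norm (R \<mu> x)" if "0 \<le> x" by (rule lower[OF that])
    assume h: "0 < h"
    show "linear (E h)" by (rule linear_E[OF h])
    show "E h x \<in> D" unfolding E_def by (intro subspace_scale subspace_D range_R le h)
    show "h *\<^sub>R A' (E h x) = E h x - x" by (rule A'_E[OF h])
    show "A' (E h x) = E h (A' x)" if "x \<in> D"
      using linear_R[OF le[OF h]] that
      by (simp add: A'_def E_def A_scaleR range_R[OF le[OF h]] A_commute_R[OF le[OF h]] linear_diff linear_scale algebra_simps)
    show "E h (E h' x) = E h' (E h x)" if "0 < h'" for h'
      using linear_R[OF le[OF h]] linear_R[OF le[OF that]] R_commute[OF le[OF h] le[OF that], of x]
      by (simp add: E_def linear_scale)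
    show "norm ((E h ^^ n) x) \<le> M * norm x" for n by (rule stable[OF h])
    show "E h (R \<mu> x) = R \<mu> (E h x)" by (rule E_R[OF h])
    show "0 \<le> E h x" if "0 \<le> x" by (rule E_pos[OF h that])
    show "E h (R \<mu> x) \<le> R \<mu> x" if "0 \<le> x" by (rule E_R_le[OF h that])
  qed
  then show thesis using that unfolding A'_def E_def by blast
qed

text \<open>
  The norm of the extrapolation space may be given by any real point of the resolvent set,
  even one below the spectral bound; by the resolvent identity it may be computed with the
  resolvent at \<open>\<mu>\<close> up to constants.
\<close>

lemma resolvent_norm_equivalence:
  assumes op: "linear_operator D A" and l: "complex_of_real l \<in> resolvent_set D A"
    and m: "complex_of_real m \<in> resolvent_set D A"
  obtains C where "0 < C" "\<And>x. norm (resolvent D A l x) \<le> C * norm (resolvent D A m x)"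
proof -
  note rl = resolvent_eqs[OF op l] and rm = resolvent_eqs[OF op m]
  obtain K where K: "0 \<le> K" "\<And>x. norm (resolvent D A l x) \<le> norm x * K"
    using bounded_linear.nonneg_bounded[OF rl(1)] by blast
  have "norm (resolvent D A l x) \<le> (1 + \<bar>l - m\<bar> * K) * norm (resolvent D A m x)" for x
  proof -
    define y where "y = resolvent D A m x"
    have "l *\<^sub>R y - A y = x + (l - m) *\<^sub>R y" using rm(3)[of x] by (simp add: y_def algebra_simps)
    then have "y = resolvent D A l (x + (l - m) *\<^sub>R y)" using rl(4)[of y] rm(2) by (simp add: y_def)
    also have "\<dots> = resolvent D A l x + (l - m) *\<^sub>R resolvent D A l y"
      using bounded_linear.linear[OF rl(1)] by (simp add: linear_add linear_scale)
    finally have "resolvent D A l x = y - (l - m) *\<^sub>R resolvent D A l y"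
      by (rule eq_diff_eq[THEN iffD2, OF sym])
    then have "norm (resolvent D A l x) \<le> norm y + \<bar>l - m\<bar> * norm (resolvent D A l y)"
      by (metis norm_scaleR norm_triangle_ineq4)
    also have "\<dots> \<le> norm y + \<bar>l - m\<bar> * (norm y * K)" by (intro add_left_mono mult_left_mono K) simp
    finally show ?thesis by (simp add: y_def algebra_simps)
  qed
  moreover have "0 < 1 + \<bar>l - m\<bar> * K" using K by (simp add: add_pos_nonneg)
  ultimately show thesis using that by blast
qed

section \<open>Rescaling and transport of semigroups\<close>

lemma C0_semigroup_rescale:
  assumes "C0_semigroup T"
  shows "C0_semigroup (\<lambda>t. exp (\<mu> * t) *\<^sub>R T t)"
  unfolding C0_semigroup_def
proof (intro conjI allI impI)
  show "exp (\<mu> * 0) *\<^sub>R T 0 = id_blinfun" using assms by (simp add: C0_semigroup_def)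
  show "exp (\<mu> * (s + t)) *\<^sub>R T (s + t) = (exp (\<mu> * s) *\<^sub>R T s) o\<^sub>L (exp (\<mu> * t) *\<^sub>R T t)"
    if "0 \<le> s" "0 \<le> t" for s t
    using assms that
    by (intro blinfun_eqI) (simp add: C0_semigroup_def blinfun.scaleR_left blinfun.scaleR_right distrib_left exp_add)
  fix x
  have "((\<lambda>t. exp (\<mu> * t) *\<^sub>R T t x) \<longlongrightarrow> exp (\<mu> * 0) *\<^sub>R x) (at_right 0)"
    using assms by (intro tendsto_intros) (auto simp: C0_semigroup_def)
  then show "((\<lambda>t. (exp (\<mu> * t) *\<^sub>R T t) x) \<longlongrightarrow> x) (at_right 0)" by (simp add: blinfun.scaleR_left)
qed

lemma generates_rescale:
  assumes gen: "generates D (\<lambda>x. A x - \<mu> *\<^sub>R x) T"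
  shows "generates D A (\<lambda>t. exp (\<mu> * t) *\<^sub>R T t)"
proof -
  define q where "q = (\<lambda>x h. (T h x - x) /\<^sub>R h)"
  define q' where "q' = (\<lambda>x h. ((exp (\<mu> * h) *\<^sub>R T h) x - x) /\<^sub>R h)"
  define d where "d = (\<lambda>h. (exp (\<mu> * h) - 1) / h)"
  have q'_eq: "q' x h = exp (\<mu> * h) *\<^sub>R q x h + d h *\<^sub>R x" for x h
    by (simp add: q_def q'_def d_def blinfun.scaleR_left scaleR_diff_right scaleR_diff_left divide_inverse mult.commute)
       (simp add: algebra_simps)
  have d: "(d \<longlongrightarrow> \<mu>) (at_right 0)"
  proof -
    have "((\<lambda>x. exp (\<mu> * x)) has_field_derivative \<mu>) (at 0)"
      by (auto intro!: derivative_eq_intros)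
    then have "(d \<longlongrightarrow> \<mu>) (at 0)" by (simp add: DERIV_def d_def)
    then show ?thesis by (rule tendsto_within_subset) simp
  qed
  have e: "((\<lambda>h. exp (\<mu> * h)) \<longlongrightarrow> 1) (at_right 0)"
    by (auto intro!: tendsto_eq_intros)
  have to: "(q' x \<longlongrightarrow> y + \<mu> *\<^sub>R x) (at_right 0)" if "(q x \<longlongrightarrow> y) (at_right 0)" for x y
  proof -
    have "((\<lambda>h. exp (\<mu> * h) *\<^sub>R q x h + d h *\<^sub>R x) \<longlongrightarrow> 1 *\<^sub>R y + \<mu> *\<^sub>R x) (at_right 0)"
      by (intro tendsto_intros e d that)
    then show ?thesis by (simp add: q'_eq[abs_def])
  qed
  have from_q': "(q x \<longlongrightarrow> y - \<mu> *\<^sub>R x) (at_right 0)" if "(q' x \<longlongrightarrow> y) (at_right 0)" for x y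
  proof -
    have "((\<lambda>h. inverse (exp (\<mu> * h)) *\<^sub>R (q' x h - d h *\<^sub>R x)) \<longlongrightarrow> inverse 1 *\<^sub>R (y - \<mu> *\<^sub>R x)) (at_right 0)"
      by (intro tendsto_intros e d that) simp
    then show ?thesis by (simp add: q'_eq)
  qed
  have "D = {x. \<exists>y. (q x \<longlongrightarrow> y) (at_right 0)}" and gA: "\<And>x. x \<in> D \<Longrightarrow> (q x \<longlongrightarrow> A x - \<mu> *\<^sub>R x) (at_right 0)"
    using gen by (auto simp: generates_def q_def)
  then have "D = {x. \<exists>y. (q' x \<longlongrightarrow> y) (at_right 0)}" using to from_q' by blast
  moreover have "(q' x \<longlongrightarrow> A x) (at_right 0)" if "x \<in> D" for x
    using to[OF gA[OF that]] by simp
  ultimately show ?thesis unfolding generates_def q'_def by blast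
qed

lemma C0_semigroup_conjugate:
  fixes J :: "'a::banach \<Rightarrow>\<^sub>L 'b::banach" and J' :: "'b \<Rightarrow>\<^sub>L 'a"
  assumes T: "C0_semigroup T" and J: "\<And>x. J' (J x) = x" "\<And>y. J (J' y) = y"
  shows "C0_semigroup (\<lambda>t. J o\<^sub>L T t o\<^sub>L J')"
  unfolding C0_semigroup_def
proof (intro conjI allI impI)
  show "J o\<^sub>L T 0 o\<^sub>L J' = id_blinfun"
    using T J by (intro blinfun_eqI) (simp add: C0_semigroup_def)
  show "J o\<^sub>L T (s + t) o\<^sub>L J' = (J o\<^sub>L T s o\<^sub>L J') o\<^sub>L (J o\<^sub>L T t o\<^sub>L J')" if "0 \<le> s" "0 \<le> t" for s t
    using T J that by (intro blinfun_eqI) (simp add: C0_semigroup_def)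
  fix y
  have "((\<lambda>t. J (T t (J' y))) \<longlongrightarrow> J (J' y)) (at_right 0)"
    using T by (intro blinfun.tendsto tendsto_const) (simp add: C0_semigroup_def)
  then show "((\<lambda>t. (J o\<^sub>L T t o\<^sub>L J') y) \<longlongrightarrow> y) (at_right 0)" by (simp add: J)
qed

lemma inverse_blinfun:
  fixes J :: "'a::real_normed_vector \<Rightarrow>\<^sub>L 'b::real_normed_vector"
  assumes pos: "0 < k" and lower: "\<And>x. k * norm x \<le> norm (J x)" and surj: "surj (blinfun_apply J)"
  obtains J' :: "'b \<Rightarrow>\<^sub>L 'a" where "\<And>x. J' (J x) = x" "\<And>y. J (J' y) = y"
proof -
  have inj: "inj (blinfun_apply J)"
  proof (rule injI)
    fix x y assume "J x = J y"
    then have "k * norm (x - y) \<le> 0" using lower[of "x - y"] by (simp add: blinfun.diff_right)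
    then show "x = y" using pos by (simp add: mult_le_0_iff)
  qed
  define g where "g = inv (blinfun_apply J)"
  have g: "g (J x) = x" "J (g y) = y" for x y
    using inj surj by (auto simp: g_def surj_f_inv_f)
  have "bounded_linear g"
  proof (rule bounded_linear_intro)
    show "g (x + y) = g x + g y" for x y using g(1)[of "g x + g y"] by (simp add: blinfun.add_right g(2))
    show "g (a *\<^sub>R x) = a *\<^sub>R g x" for a x using g(1)[of "a *\<^sub>R g x"] by (simp add: blinfun.scaleR_right g(2))
    show "norm (g y) \<le> norm y * (1 / k)" for y using lower[of "g y"] pos by (simp add: g(2) field_simps)
  qed
  then have "blinfun_apply (Blinfun g) = g" by (rule bounded_linear_Blinfun_apply)
  then show thesis using g that[of "Blinfun g"] by simp
qed

section \<open>Restricting inputs to the unit interval\<close>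

lemma AE_lebesgue_on_subset:
  assumes "S \<in> sets lebesgue" "S' \<in> sets lebesgue" "S \<subseteq> S'" "AE t in lebesgue_on S'. P t"
  shows "AE t in lebesgue_on S. P t"
proof -
  have "AE t in lebesgue. t \<in> S' \<longrightarrow> P t" using assms by (subst (asm) AE_restrict_space_iff) auto
  then show ?thesis using assms(1,3) by (subst AE_restrict_space_iff) (auto elim!: eventually_mono)
qed

lemma strongly_measurable_lebesgue_on_subset:
  assumes S: "S \<in> sets lebesgue" "S' \<in> sets lebesgue" "S \<subseteq> S'" and u: "strongly_measurable (lebesgue_on S') u"
  shows "strongly_measurable (lebesgue_on S) u"
proof -
  obtain s where s: "\<And>i. simple_function (lebesgue_on S') (s i)" "AE t in lebesgue_on S'. (\<lambda>i. s i t) \<longlonglongrightarrow> u t"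
    using u by (auto simp: strongly_measurable_def)
  have "simple_function (lebesgue_on S) (s i)" for i
    unfolding simple_function_def
  proof (intro conjI ballI)
    show "finite (s i ` space (lebesgue_on S))"
      using s(1)[of i] S(3) by (auto simp: simple_function_def intro: finite_subset[OF image_mono])
    fix x assume "x \<in> s i ` space (lebesgue_on S)"
    then have "s i -` {x} \<inter> S' \<in> sets (lebesgue_on S')"
      using s(1)[of i] S(3) by (auto simp: simple_function_def)
    then have "s i -` {x} \<inter> S' \<in> sets lebesgue" using S by (simp add: sets_restrict_space_iff)
    moreover have "s i -` {x} \<inter> S = S \<inter> (s i -` {x} \<inter> S')" using S(3) by auto
    ultimately show "s i -` {x} \<inter> space (lebesgue_on S) \<in> sets (lebesgue_on S)"
      unfolding sets_restrict_space space_lebesgue_on by blast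
  qed
  then show ?thesis
    using AE_lebesgue_on_subset[OF S s(2)] unfolding strongly_measurable_def by blast
qed

lemma strongly_measurable_continuous_real:
  fixes \<phi> :: "real \<Rightarrow> real"
  assumes "continuous_on UNIV \<phi>"
  shows "strongly_measurable unit_interval \<phi>"
proof -
  define s where "s = (\<lambda>i t. \<phi> (real (mesh_index (Suc i) t) / real (Suc i)))"
  have "simple_function unit_interval (s i)" for i
    unfolding s_def by (rule simple_step[of "\<lambda>k. \<phi> (real k / real (Suc i))"])
  moreover have "(\<lambda>i. s i t) \<longlonglongrightarrow> \<phi> t" if t: "0 \<le> t" "t \<le> 1" for t
  proof -
    have "(\<lambda>i. real (mesh_index (Suc i) t) / real (Suc i) - t) \<longlonglongrightarrow> 0"
    proof (rule Lim_null_comparison[OF always_eventually LIMSEQ_Suc[OF lim_1_over_n]], rule allI)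
      fix i
      have "real (mesh_index (Suc i) t) / real (Suc i) \<le> t" "t < real (Suc (mesh_index (Suc i) t)) / real (Suc i)"
        using mesh_index_iff[of "Suc i" t "mesh_index (Suc i) t"] t by blast+
      moreover have "real (Suc (mesh_index (Suc i) t)) / real (Suc i) = real (mesh_index (Suc i) t) / real (Suc i) + 1 / real (Suc i)"
        by (simp add: add_divide_distrib)
      ultimately show "norm (real (mesh_index (Suc i) t) / real (Suc i) - t) \<le> 1 / real (Suc i)"
        by (simp add: abs_le_iff)
    qed
    then have "(\<lambda>i. real (mesh_index (Suc i) t) / real (Suc i)) \<longlonglongrightarrow> t" by (simp only: LIM_zero_iff)
    then show ?thesis unfolding s_def
      by (rule continuous_on_tendsto_compose[OF assms]) auto
  qed
  ultimately show ?thesis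
    unfolding strongly_measurable_def by (intro exI[of _ s] conjI allI AE_I2) auto
qed

text \<open>
  The weight undoes the shift: the operator \<open>exp (\<mu> (1 - s)) T (1 - s)\<close> acts on an input \<open>u s\<close>
  as \<open>T (1 - s)\<close> does on the weighted input, by linearity.
\<close>

lemma weighted_positive_input:
  fixes u :: "real \<Rightarrow> 'u::banach_lattice" and \<mu> :: real
  assumes u: "u \<in> Lp_pos 1"
  defines "v \<equiv> \<lambda>s. exp (\<mu> * (1 - s)) *\<^sub>R u s"
  shows "strongly_measurable unit_interval v" "(\<integral>\<^sup>+s. ennreal (norm (v s)) \<partial>unit_interval) < \<infinity>"
    "AE s in unit_interval. 0 \<le> v s"
proof -
  have S: "{0..1} \<in> sets (lebesgue :: real measure)" "{0..} \<in> sets (lebesgue :: real measure)" "{0..1} \<subseteq> {0::real..}"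
    by auto
  have u1: "strongly_measurable (lebesgue_on {0..}) u" "(\<integral>\<^sup>+t. ennreal (norm (u t)) \<partial>lebesgue_on {0..}) < \<infinity>"
    "AE t in lebesgue_on {0..}. 0 \<le> u t"
    using u by (auto simp: Lp_pos_def Lp_def powr_one)
  have mu: "strongly_measurable unit_interval u" by (rule strongly_measurable_lebesgue_on_subset[OF S u1(1)])
  show "strongly_measurable unit_interval v"
    unfolding v_def
    by (rule strongly_measurable_compose2[OF _ strongly_measurable_continuous_real mu, of "\<lambda>a x. a *\<^sub>R x"])
       (intro continuous_intros)+
  show "AE s in unit_interval. 0 \<le> v s"
    using AE_lebesgue_on_subset[OF S u1(3)] by eventually_elim (simp add: v_def scaleR_nonneg_nonneg)
  have "(\<integral>\<^sup>+s. ennreal (norm (v s)) \<partial>unit_interval) \<le>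
      ennreal (exp \<bar>\<mu>\<bar>) * (\<integral>\<^sup>+s. ennreal (norm (u s)) \<partial>unit_interval) + ennreal 0 * (\<integral>\<^sup>+s. ennreal (norm (u s)) \<partial>unit_interval)"
  proof (rule nn_integral_norm_le[OF mu mu])
    show "AE s in unit_interval. norm (v s) \<le> exp \<bar>\<mu>\<bar> * norm (u s) + 0 * norm (u s)"
    proof (rule AE_I2)
      fix s :: real assume "s \<in> space unit_interval"
      then have s: "0 \<le> 1 - s" "1 - s \<le> 1" by auto
      have "\<mu> * (1 - s) \<le> \<bar>\<mu>\<bar> * (1 - s)" using s by (intro mult_right_mono) auto
      also have "\<dots> \<le> \<bar>\<mu>\<bar>" using s by (simp add: mult_left_le)
      finally show "norm (v s) \<le> exp \<bar>\<mu>\<bar> * norm (u s) + 0 * norm (u s)"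
        by (simp add: v_def mult_right_mono)
    qed
  qed auto
  also have "\<dots> = ennreal (exp \<bar>\<mu>\<bar>) * (\<integral>\<^sup>+s. ennreal (norm (u s)) \<partial>unit_interval)" by simp
  finally have le: "(\<integral>\<^sup>+s. ennreal (norm (v s)) \<partial>unit_interval) \<le>
      ennreal (exp \<bar>\<mu>\<bar>) * (\<integral>\<^sup>+s. ennreal (norm (u s)) \<partial>unit_interval)" .
  have "(\<integral>\<^sup>+s. ennreal (norm (u s)) \<partial>unit_interval) \<le> (\<integral>\<^sup>+s. ennreal (norm (u s)) \<partial>lebesgue_on {0..})"
    using S by (subst (1 2) nn_integral_restrict_space) (auto intro!: nn_integral_mono split: split_indicator)
  then have "(\<integral>\<^sup>+s. ennreal (norm (u s)) \<partial>unit_interval) < \<infinity>"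
    using u1(2) by (rule order.strict_trans1)
  then have "ennreal (exp \<bar>\<mu>\<bar>) * (\<integral>\<^sup>+s. ennreal (norm (u s)) \<partial>unit_interval) < \<infinity>"
    by (simp add: ennreal_mult_less_top)
  with le show "(\<integral>\<^sup>+s. ennreal (norm (v s)) \<partial>unit_interval) < \<infinity>"
    by (rule order.strict_trans1)
qed

section \<open>Admissibility\<close>

theorem theorem2p1:
  fixes D :: "'x::banach_lattice set" and A :: "'x \<Rightarrow> 'x"
    and j :: "'x \<Rightarrow> 'y::banach" and B :: "'u::banach_lattice \<Rightarrow>\<^sub>L 'y"
    and \<mu> c :: real
  assumes "linear_operator D A"
    and "closure D = UNIV"
    and "resolvent_positive D A"
    and "spectral_bound D A < ereal \<mu>"
    and "0 < c"
    and "\<And>x. 0 \<le> x \<Longrightarrow> c * norm x \<le> norm (resolvent D A \<mu> x)"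
    and "extrapolation_space D A j"
    and "positive_control j B"
  shows "positive_Lp_admissible 1 D A j B"
proof -
  interpret res: positive_resolvent_family D A "resolvent D A" \<mu>
    using resolvent_family_resolvent[OF assms(1,4)] by (simp add: positive_resolvent_family_def)
  from assms(3)[unfolded resolvent_positive_def] obtain \<omega> where
    "\<forall>l>\<omega>. complex_of_real l \<in> resolvent_set D A \<and> (\<forall>x\<ge>0. 0 \<le> resolvent D A l x)" ..
  then have \<omega>: "0 \<le> resolvent D A l x" if "\<omega> < l" "0 \<le> x" for l x using that by simp
  have pos: "0 \<le> resolvent D A l x" if "\<mu> \<le> l" "0 \<le> x" for l x
    by (rule res.R_positive[OF \<omega> that])
  define A' where "A' = (\<lambda>x. A x - \<mu> *\<^sub>R x)"
  define E where "E = (\<lambda>h x. (1 / h) *\<^sub>R resolvent D A (\<mu> + 1 / h) x)"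
  define R where "R = Blinfun (resolvent D A \<mu>)"
  obtain M where M: "positive_euler_scheme D A' E M R c"
    unfolding A'_def E_def R_def by (rule res.shifted_euler_scheme[OF assms(2,5) pos assms(6)])
  interpret pe: positive_euler_scheme D A' E M R c by (rule M)
  have R_eq: "blinfun_apply R = resolvent D A \<mu>"
    unfolding R_def by (rule bounded_linear_Blinfun_apply[OF res.bounded[OF order.refl]])
  obtain l where j: "linear j" "closure (range j) = UNIV" and l: "complex_of_real l \<in> resolvent_set D A"
    and norm_j: "\<And>x. norm (j x) = norm (resolvent D A l x)"
    using assms(7) unfolding extrapolation_space_def by blast
  have m: "complex_of_real \<mu> \<in> resolvent_set D A"
    by (rule resolvent_set_above_spectral_bound[OF assms(4) order.refl])
  obtain C1 where C1: "0 < C1" "\<And>x. norm (resolvent D A \<mu> x) \<le> C1 * norm (resolvent D A l x)"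
    using resolvent_norm_equivalence[OF assms(1) m l] by blast
  obtain C2 where C2: "0 < C2" "\<And>x. norm (resolvent D A l x) \<le> C2 * norm (resolvent D A \<mu> x)"
    using resolvent_norm_equivalence[OF assms(1) l m] by blast
  have lower: "1 / C1 * norm (R x) \<le> norm (j x)" for x
    using C1(1) C1(2)[of x] by (simp add: R_eq norm_j field_simps)
  have upper: "norm (j x) \<le> C2 * norm (R x)" for x
    using C2(2)[of x] by (simp add: R_eq norm_j)
  have C1_inv: "0 < 1 / C1" using C1(1) by simp
  obtain J :: "'x \<Rightarrow>\<^sub>L 'y" where J: "\<And>x. J (R x) = j x" "\<And>x. 1 / C1 * norm x \<le> norm (J x)" "surj (blinfun_apply J)"
    using pe.exists_extension_isomorphism[OF j C1_inv lower upper] by blast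
  obtain J' :: "'y \<Rightarrow>\<^sub>L 'x" where J': "\<And>x. J' (J x) = x" "\<And>y. J (J' y) = y"
    using inverse_blinfun[OF C1_inv J(2,3)] by blast
  define r where "r = J' o\<^sub>L B"
  have r_cone: "r v \<in> pe.cone" if "0 \<le> v" for v
  proof -
    have "B v \<in> closure (j ` {x. 0 \<le> x})"
      using assms(8) that by (simp add: positive_control_def extrapolation_cone_def)
    moreover have "J' ` closure (j ` {x. 0 \<le> x}) \<subseteq> closure (J' ` j ` {x. 0 \<le> x})"
      by (intro image_closure_subset linear_continuous_on blinfun.bounded_linear_right closed_closure closure_subset)
    ultimately have "J' (B v) \<in> closure (J' ` j ` {x. 0 \<le> x})" by blast
    also have "J' ` j ` {x. 0 \<le> x} = R ` {x. 0 \<le> x}"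
      by (simp add: image_image J'(1) flip: J(1))
    finally show ?thesis by (simp add: r_def pe.cone_def)
  qed
  interpret pin: positive_input D A' E M R c r
    by unfold_locales (rule r_cone)
  define T where "T = (\<lambda>t. exp (\<mu> * t) *\<^sub>R pe.semigroup t)"
  define S where "S = (\<lambda>t. J o\<^sub>L T t o\<^sub>L J')"
  have C0: "C0_semigroup T" unfolding T_def by (rule C0_semigroup_rescale[OF pe.C0_semigroup_semigroup])
  have gen: "generates D A T"
    unfolding T_def by (rule generates_rescale) (use pe.generates_semigroup in \<open>simp add: A'_def\<close>)
  have posT: "positive_semigroup T"
    unfolding positive_semigroup_def T_def
    by (simp add: blinfun.scaleR_left scaleR_nonneg_nonneg pe.T_pos)
  have ext: "extends_semigroup j T S"
    unfolding extends_semigroup_def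
  proof (intro conjI allI impI)
    show "C0_semigroup S" unfolding S_def by (rule C0_semigroup_conjugate[OF C0 J'])
    fix t x
    have "J' (j x) = R x" using J'(1)[of "R x"] by (simp add: J(1))
    moreover have "T t (R x) = R (T t x)" by (simp add: T_def blinfun.scaleR_left blinfun.scaleR_right pe.T_R)
    ultimately show "S t (j x) = j (T t x)" by (simp add: S_def J(1))
  qed
  have "input_map S B 1 u \<in> j ` {x. 0 \<le> x}" if u: "u \<in> Lp_pos 1" for u
  proof -
    define v where "v = (\<lambda>s. exp (\<mu> * (1 - s)) *\<^sub>R u s)"
    have v: "strongly_measurable unit_interval v" "(\<integral>\<^sup>+s. ennreal (norm (v s)) \<partial>unit_interval) < \<infinity>"
      "AE s in unit_interval. 0 \<le> v s"
      unfolding v_def by (rule weighted_positive_input[OF u])+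
    obtain x where x: "0 \<le> x" "has_strong_bochner_integral unit_interval (\<lambda>s. J (pe.semigroup (1 - s) (r (v s)))) (J (R x))"
      using pin.positive_input_integral[OF v, of J] by blast
    have "J (pe.semigroup (1 - s) (r (v s))) = S (1 - s) (B (u s))" for s
      by (simp add: S_def T_def v_def r_def blinfun.scaleR_left blinfun.scaleR_right)
    then have "input_map S B 1 u = j x"
      using strong_bochner_integral_eq[OF x(2)] by (simp add: input_map_def J(1))
    then show ?thesis using x(1) by auto
  qed
  then have "\<exists>\<tau>>0. \<forall>u\<in>Lp_pos 1. input_map S B \<tau> u \<in> j ` {x. 0 \<le> x}"
    by (intro exI[of _ 1]) auto
  then show ?thesis
    unfolding positive_Lp_admissible_def using C0 gen posT ext by blast
qed

end
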